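(* There is an algorithm which, given a pin-permutation $\pi$, builds a finite automaton accepting the language $\overleftarrow{\mathcal{L}_\pi}$ in time and space $\mathcal{O}(|\pi|^4)$; and there is an algorithm which, given a pin-permutation $\pi$, builds a finite automaton accepting a language $\mathcal{L}'_\pi$ such that $\mathcal{L}'_\pi\cap\mathcal{M}=\overleftarrow{\mathcal{L}_\pi}\cap\mathcal{M}$ in time and space $\mathcal{O}(|\pi|^2)$.
   Context: Pins, bounding boxes, pin sequences: a pin is a point in the plane; a pin $p$ separates a set $P$ from a set $Q$ if the horizontal or vertical line through $p$ divides the plane into two parts, one containing $P$ and the other $Q$; the bounding box of a set of points is the smallest axis-parallel rectangle containing it. A pin sequence is a sequence $(p_1,\dots,p_k)$ of points, no two on a common horizontal or vertical line, such that each $p_i$ ($i\ge2$) lies outside the bounding box of $\{p_1,\dots,p_{i-1}\}$ and either separates $p_{i-1}$ from $\{p_1,\dots,p_{i-2}\}$ or does not separate $\{p_1,\dots,p_{i-1}\}$ into two nonempty sets. A pin representation of a permutation $\pi$ is a pin sequence order-isomorphic to the diagram $\{(i,\pi_i)\}$ of $\pi$; $\pi$ is a pin-permutation if it has one. Pin words: given a pin representation $(p_1,\dots,p_n)$ of $\pi$ and a point $p_0$ such that $(p_0,p_1,\dots,p_n)$ is a pin sequence, encode each $p_i$, $i\ge1$, by a letter: $U$ (resp. $D,L,R$) if $p_i$ separates $p_{i-1}$ from $\{p_0,\dots,p_{i-2}\}$ from the top (resp. bottom, left, right); $1$ (resp. $2,3,4$) if $p_i$ separates no two nonempty subsets of $\{p_0,\dots,p_{i-1}\}$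 and lies up-right (resp. up-left, bottom-left, bottom-right) of the bounding box of $\{p_0,\dots,p_{i-1}\}$. The word $w_1\cdots w_n$ is a pin word encoding $\pi$; $P(\pi)$ is the set of all pin words encoding $\pi$ (empty if $\pi$ is not a pin-permutation). $U,D,L,R$ are directions, $1,2,3,4$ numerals. A strict pin word is a pin word consisting of one numeral followed only by directions. Every pin word $u$ begins with a numeral; cutting $u$ just before each numeral gives its strong numeral-led factor decomposition $u=u^{(1)}\cdots u^{(j)}$, each $u^{(i)}$ a strict pin word. Let $A=\{U,D,L,R\}$. $\mathcal{M}$ is the set of words of length at least $2$ over $A$ in which each letter in $\{L,R\}$ is followed (if at all) by a letter of $\{U,D\}$ and conversely. The map $\phi$ on strict pin words: for $u=u'u''$ with $|u'|=2$, $\phi(u)=\varphi(u')u''$ where $\varphi$: $1R\mapsto RUR$, $1L\mapsto RUL$, $1U\mapsto URU$, $1D\mapsto URD$, $2R\mapsto LUR$, $2L\mapsto LUL$, $2U\mapsto ULU$, $2D\mapsto ULD$, $3R\mapsto LDR$, $3L\mapsto LDL$, $3U\mapsto DLU$, $3D\mapsto DLD$, $4R\mapsto RDR$, $4L\mapsto RDL$, $4U\mapsto DRU$, $4D\mapsto DRD$; for single letters $\phi(1)=\{UR,RU\}$, $\phi(2)=\{UL,LU\}$, $\phi(3)=\{DL,LD\}$, $\phi(4)=\{RD,DR\}$ (sets of words). For a pin word $u$ with strong numeral-led factor decomposition $u^{(1)}\cdots u^{(j)}$, $\mathcal{L}(u)=A^\star\phi(u^{(1)})A^\star\phi(u^{(2)})\cdots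 A^\star\phi(u^{(j)})A^\star$ (where $\phi(u^{(i)})$ is a set when $|u^{(i)}|=1$), and $\mathcal{L}_\pi=\bigcup_{u\in P(\pi)}\mathcal{L}(u)$. For a word $v=v_1\cdots v_m$, $\overleftarrow{v}=v_m\cdots v_1$, and $\overleftarrow{\mathcal{L}}=\{\overleftarrow{v}:v\in\mathcal{L}\}$. *)

theory Defs
  imports Complex_Main "HOL-Combinatorics.Permutations" "HOL-Library.Landau_Symbols"
begin

section \<open>Pin sequences and pin-permutations\<close>

type_synonym point = "real \<times> real"

definition bbox :: "point set \<Rightarrow> point set" where
  "bbox S = \<Inter> {R. \<exists>a b c d. R = {a..b} \<times> {c..d} \<and> S \<subseteq> R}"

text \<open>The two parts determined by an axis-parallel line are its open sides; the points of
  interest never lie on the line itself.\<close>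

definition separates :: "point \<Rightarrow> point set \<Rightarrow> point set \<Rightarrow> bool" where
  "separates p P Q \<longleftrightarrow>
     P \<subseteq> {q. fst q < fst p} \<and> Q \<subseteq> {q. fst q > fst p} \<or>
     Q \<subseteq> {q. fst q < fst p} \<and> P \<subseteq> {q. fst q > fst p} \<or>
     P \<subseteq> {q. snd q < snd p} \<and> Q \<subseteq> {q. snd q > snd p} \<or>
     Q \<subseteq> {q. snd q < snd p} \<and> P \<subseteq> {q. snd q > snd p}"

text \<open>Lists are indexed from 0, so \<open>take i ps\<close> lists the predecessors of \<open>ps ! i\<close>.\<close>

definition pin_sequence :: "point list \<Rightarrow> bool" where
  "pin_sequence ps \<longleftrightarrow>
     (\<forall>i j. i < j \<and> j < length ps \<longrightarrow>
        fst (ps ! i) \<noteq> fst (ps ! j) \<and> snd (ps ! i) \<noteq> snd (ps ! j)) \<and>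
     (\<forall>i. 1 \<le> i \<and> i < length ps \<longrightarrow>
        ps ! i \<notin> bbox (set (take i ps)) \<and>
        (separates (ps ! i) {ps ! (i - 1)} (set (take (i - 1) ps)) \<or>
         \<not> (\<exists>P Q. P \<noteq> {} \<and> Q \<noteq> {} \<and> P \<union> Q = set (take i ps) \<and> separates (ps ! i) P Q)))"

definition order_isomorphic :: "point set \<Rightarrow> point set \<Rightarrow> bool" where
  "order_isomorphic S T \<longleftrightarrow>
     (\<exists>f. bij_betw f S T \<and>
        (\<forall>p\<in>S. \<forall>q\<in>S. (fst p < fst q \<longleftrightarrow> fst (f p) < fst (f q)) \<and>
                      (snd p < snd q \<longleftrightarrow> snd (f p) < snd (f q))))"

text \<open>A permutation of size \<open>n\<close> is a function \<open>\<pi>\<close> with \<open>\<pi> permutes {1..n}\<close>.\<close>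

definition diagram :: "nat \<Rightarrow> (nat \<Rightarrow> nat) \<Rightarrow> point set" where
  "diagram n \<pi> = (\<lambda>i. (real i, real (\<pi> i))) ` {1..n}"

definition pin_representation :: "nat \<Rightarrow> (nat \<Rightarrow> nat) \<Rightarrow> point list \<Rightarrow> bool" where
  "pin_representation n \<pi> ps \<longleftrightarrow>
     pin_sequence ps \<and> order_isomorphic (set ps) (diagram n \<pi>)"

definition pin_permutation :: "nat \<Rightarrow> (nat \<Rightarrow> nat) \<Rightarrow> bool" where
  "pin_permutation n \<pi> \<longleftrightarrow> \<pi> permutes {1..n} \<and> (\<exists>ps. pin_representation n \<pi> ps)"

section \<open>Pin words\<close>

datatype dir = Up | Down | Left | Right
datatype quad = Q1 | Q2 | Q3 | Q4
datatype pin_letter = Num quad | Dir dir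

fun beyond :: "dir \<Rightarrow> point \<Rightarrow> point set \<Rightarrow> bool" where
  "beyond Up p S \<longleftrightarrow> (\<forall>q\<in>S. snd q < snd p)"
| "beyond Down p S \<longleftrightarrow> (\<forall>q\<in>S. snd p < snd q)"
| "beyond Left p S \<longleftrightarrow> (\<forall>q\<in>S. fst p < fst q)"
| "beyond Right p S \<longleftrightarrow> (\<forall>q\<in>S. fst q < fst p)"

fun quad_dirs :: "quad \<Rightarrow> dir set" where
  "quad_dirs Q1 = {Up, Right}"
| "quad_dirs Q2 = {Up, Left}"
| "quad_dirs Q3 = {Down, Left}"
| "quad_dirs Q4 = {Down, Right}"

text \<open>\<open>letter_of qs p l\<close>: the pin \<open>p\<close> added after the points \<open>qs = [p\<^sub>0, \<dots>, p\<^sub>i\<^sub>-\<^sub>1]\<close> may be encoded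
  by \<open>l\<close>. A direction requires \<open>i \<ge> 2\<close>: for \<open>i = 1\<close> the separation from \<open>{}\<close> would hold
  vacuously, whereas a pin word must begin with a numeral. A pin beyond all of \<open>qs\<close> vertically
  can separate these points only by its vertical line, and symmetrically.\<close>

fun letter_of :: "point list \<Rightarrow> point \<Rightarrow> pin_letter \<Rightarrow> bool" where
  "letter_of qs p (Dir d) \<longleftrightarrow>
     2 \<le> length qs \<and> separates p {last qs} (set (butlast qs)) \<and> beyond d p (set qs)"
| "letter_of qs p (Num k) \<longleftrightarrow>
     \<not> (\<exists>P Q. P \<noteq> {} \<and> Q \<noteq> {} \<and> P \<subseteq> set qs \<and> Q \<subseteq> set qs \<and> separates p P Q) \<and>
     (\<forall>d\<in>quad_dirs k. beyond d p (bbox (set qs)))"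

definition encoded_by :: "point \<Rightarrow> point list \<Rightarrow> pin_letter list \<Rightarrow> bool" where
  "encoded_by p0 ps w \<longleftrightarrow> length w = length ps \<and>
     (\<forall>i < length ps. letter_of (take (Suc i) (p0 # ps)) (ps ! i) (w ! i))"

definition pin_words :: "nat \<Rightarrow> (nat \<Rightarrow> nat) \<Rightarrow> pin_letter list set" where
  "pin_words n \<pi> = {w. \<exists>p0 ps. pin_representation n \<pi> ps \<and>
     pin_sequence (p0 # ps) \<and> encoded_by p0 ps w}"

section \<open>The languages of a pin-permutation\<close>

text \<open>A strict pin word is represented by its numeral and its list of directions.\<close>

type_synonym strict_word = "quad \<times> dir list"

definition letters_of_strict :: "strict_word \<Rightarrow> pin_letter list" where
  "letters_of_strict u = Num (fst u) # map Dir (snd u)"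

text \<open>As each factor consists of a numeral followed by directions, there is at most one such
  \<open>us\<close>, obtained by cutting \<open>u\<close> just before each numeral.\<close>

definition is_sn_decomposition :: "pin_letter list \<Rightarrow> strict_word list \<Rightarrow> bool" where
  "is_sn_decomposition u us \<longleftrightarrow> u = concat (map letters_of_strict us)"

fun phi2 :: "quad \<Rightarrow> dir \<Rightarrow> dir list" where
  "phi2 Q1 Right = [Right, Up, Right]"
| "phi2 Q1 Left  = [Right, Up, Left]"
| "phi2 Q1 Up    = [Up, Right, Up]"
| "phi2 Q1 Down  = [Up, Right, Down]"
| "phi2 Q2 Right = [Left, Up, Right]"
| "phi2 Q2 Left  = [Left, Up, Left]"
| "phi2 Q2 Up    = [Up, Left, Up]"
| "phi2 Q2 Down  = [Up, Left, Down]"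
| "phi2 Q3 Right = [Left, Down, Right]"
| "phi2 Q3 Left  = [Left, Down, Left]"
| "phi2 Q3 Up    = [Down, Left, Up]"
| "phi2 Q3 Down  = [Down, Left, Down]"
| "phi2 Q4 Right = [Right, Down, Right]"
| "phi2 Q4 Left  = [Right, Down, Left]"
| "phi2 Q4 Up    = [Down, Right, Up]"
| "phi2 Q4 Down  = [Down, Right, Down]"

fun phi1 :: "quad \<Rightarrow> dir list set" where
  "phi1 Q1 = {[Up, Right], [Right, Up]}"
| "phi1 Q2 = {[Up, Left], [Left, Up]}"
| "phi1 Q3 = {[Down, Left], [Left, Down]}"
| "phi1 Q4 = {[Right, Down], [Down, Right]}"

text \<open>Words of length at least 2 have a single image, here turned into a singleton.\<close>

fun phi :: "strict_word \<Rightarrow> dir list set" where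
  "phi (k, []) = phi1 k"
| "phi (k, d # ds) = {phi2 k d @ ds}"

definition conc :: "'a list set \<Rightarrow> 'a list set \<Rightarrow> 'a list set" where
  "conc K L = {x @ y | x y. x \<in> K \<and> y \<in> L}"

text \<open>\<open>UNIV\<close> is the set of all words over the four directions.\<close>

fun factors_lang :: "strict_word list \<Rightarrow> dir list set" where
  "factors_lang [] = UNIV"
| "factors_lang (u # us) = conc UNIV (conc (phi u) (factors_lang us))"

definition word_lang :: "pin_letter list \<Rightarrow> dir list set" where
  "word_lang u = (\<Union>us \<in> {us. is_sn_decomposition u us}. factors_lang us)"

definition perm_lang :: "nat \<Rightarrow> (nat \<Rightarrow> nat) \<Rightarrow> dir list set" where
  "perm_lang n \<pi> = (\<Union>u \<in> pin_words n \<pi>. word_lang u)"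

definition alternating_words :: "dir list set" where
  "alternating_words = {w. 2 \<le> length w \<and>
     successively (\<lambda>a b. (a \<in> {Left, Right} \<longrightarrow> b \<in> {Up, Down}) \<and>
                         (a \<in> {Up, Down} \<longrightarrow> b \<in> {Left, Right})) w}"

section \<open>Finite automata\<close>

text \<open>Nondeterministic automata without empty transitions, with states \<open>0, \<dots>, fa_states - 1\<close>.\<close>

record fa =
  fa_states :: nat
  fa_init :: "nat list"
  fa_final :: "nat list"
  fa_trans :: "(nat \<times> dir \<times> nat) list"

definition fa_wf :: "fa \<Rightarrow> bool" where
  "fa_wf A \<longleftrightarrow> set (fa_init A) \<subseteq> {..<fa_states A} \<and> set (fa_final A) \<subseteq> {..<fa_states A} \<and>
     set (fa_trans A) \<subseteq> {..<fa_states A} \<times> UNIV \<times> {..<fa_states A}"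

fun fa_run :: "fa \<Rightarrow> nat \<Rightarrow> dir list \<Rightarrow> nat \<Rightarrow> bool" where
  "fa_run A p [] q \<longleftrightarrow> p = q"
| "fa_run A p (a # w) q \<longleftrightarrow> (\<exists>p'. (p, a, p') \<in> set (fa_trans A) \<and> fa_run A p' w q)"

definition fa_lang :: "fa \<Rightarrow> dir list set" where
  "fa_lang A = {w. \<exists>p \<in> set (fa_init A). \<exists>q \<in> set (fa_final A). fa_run A p w q}"

fun dir_code :: "dir \<Rightarrow> nat" where
  "dir_code Up = 0"
| "dir_code Down = 1"
| "dir_code Left = 2"
| "dir_code Right = 3"

definition fa_code :: "fa \<Rightarrow> nat list" where
  "fa_code A =
     fa_states A #
     length (fa_init A) # fa_init A @
     length (fa_final A) # fa_final A @
     length (fa_trans A) # concat (map (\<lambda>(p, a, q). [p, dir_code a, q]) (fa_trans A))"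

section \<open>Algorithms: a random access machine\<close>

text \<open>Algorithms are structured programs for a word RAM with registers and a memory, both indexed
  by natural numbers. A program mentions only finitely many registers, and its expressions have
  bounded size; hence charging one unit of time per executed command or test agrees, up to a
  constant factor depending on the program only, with charging one unit per elementary operation.\<close>

datatype aexp = Const nat | Reg nat | Mem aexp
  | Add aexp aexp | Sub aexp aexp | Mul aexp aexp | Quo aexp aexp

datatype bexp = Less aexp aexp | Equal aexp aexp | Neg bexp | Conj bexp bexp

datatype com = Skip | Assign nat aexp | Store aexp aexp
  | Seq com com | Cond bexp com com | While bexp com

type_synonym state = "(nat \<Rightarrow> nat) \<times> (nat \<Rightarrow> nat)"  \<comment> \<open>registers, memory\<close>

fun aval :: "aexp \<Rightarrow> state \<Rightarrow> nat" where
  "aval (Const k) s = k"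
| "aval (Reg x) s = fst s x"
| "aval (Mem a) s = snd s (aval a s)"
| "aval (Add a b) s = aval a s + aval b s"
| "aval (Sub a b) s = aval a s - aval b s"
| "aval (Mul a b) s = aval a s * aval b s"
| "aval (Quo a b) s = aval a s div aval b s"

fun bval :: "bexp \<Rightarrow> state \<Rightarrow> bool" where
  "bval (Less a b) s \<longleftrightarrow> aval a s < aval b s"
| "bval (Equal a b) s \<longleftrightarrow> aval a s = aval b s"
| "bval (Neg b) s \<longleftrightarrow> \<not> bval b s"
| "bval (Conj b c) s \<longleftrightarrow> bval b s \<and> bval c s"

text \<open>The machine has only the memory cells with addresses below \<open>M\<close>, and its words hold only
  the numbers below \<open>W\<close>. Every intermediate result has to fit into a word.\<close>

fun afits :: "nat \<Rightarrow> nat \<Rightarrow> aexp \<Rightarrow> state \<Rightarrow> bool" where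
  "afits W M (Const k) s \<longleftrightarrow> k < W"
| "afits W M (Reg x) s \<longleftrightarrow> fst s x < W"
| "afits W M (Mem a) s \<longleftrightarrow> afits W M a s \<and> aval a s < M \<and> aval (Mem a) s < W"
| "afits W M (Add a b) s \<longleftrightarrow> afits W M a s \<and> afits W M b s \<and> aval (Add a b) s < W"
| "afits W M (Sub a b) s \<longleftrightarrow> afits W M a s \<and> afits W M b s \<and> aval (Sub a b) s < W"
| "afits W M (Mul a b) s \<longleftrightarrow> afits W M a s \<and> afits W M b s \<and> aval (Mul a b) s < W"
| "afits W M (Quo a b) s \<longleftrightarrow> afits W M a s \<and> afits W M b s \<and> aval (Quo a b) s < W"

fun bfits :: "nat \<Rightarrow> nat \<Rightarrow> bexp \<Rightarrow> state \<Rightarrow> bool" where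
  "bfits W M (Less a b) s \<longleftrightarrow> afits W M a s \<and> afits W M b s"
| "bfits W M (Equal a b) s \<longleftrightarrow> afits W M a s \<and> afits W M b s"
| "bfits W M (Neg b) s \<longleftrightarrow> bfits W M b s"
| "bfits W M (Conj b c) s \<longleftrightarrow> bfits W M b s \<and> bfits W M c s"

text \<open>\<open>exec W M c s t s'\<close>: on the machine with bounds \<open>W\<close> and \<open>M\<close>, the program \<open>c\<close> started in
  state \<open>s\<close> halts in state \<open>s'\<close> after \<open>t\<close> steps. A computation exceeding a bound has no result.\<close>

inductive exec :: "nat \<Rightarrow> nat \<Rightarrow> com \<Rightarrow> state \<Rightarrow> nat \<Rightarrow> state \<Rightarrow> bool" for W M where
  Skip: "exec W M Skip s 1 s"
| Assign: "afits W M a s \<Longrightarrow> exec W M (Assign x a) s 1 ((fst s)(x := aval a s), snd s)"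
| Store: "afits W M a s \<Longrightarrow> afits W M b s \<Longrightarrow> aval a s < M \<Longrightarrow>
    exec W M (Store a b) s 1 (fst s, (snd s)(aval a s := aval b s))"
| Seq: "exec W M c s t s' \<Longrightarrow> exec W M c' s' t' s'' \<Longrightarrow> exec W M (Seq c c') s (t + t') s''"
| CondTrue: "bfits W M b s \<Longrightarrow> bval b s \<Longrightarrow> exec W M c s t s' \<Longrightarrow>
    exec W M (Cond b c c') s (1 + t) s'"
| CondFalse: "bfits W M b s \<Longrightarrow> \<not> bval b s \<Longrightarrow> exec W M c' s t s' \<Longrightarrow>
    exec W M (Cond b c c') s (1 + t) s'"
| WhileFalse: "bfits W M b s \<Longrightarrow> \<not> bval b s \<Longrightarrow> exec W M (While b c) s 1 s"
| WhileTrue: "bfits W M b s \<Longrightarrow> bval b s \<Longrightarrow> exec W M c s t s' \<Longrightarrow>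
    exec W M (While b c) s' t' s'' \<Longrightarrow> exec W M (While b c) s (1 + t + t') s''"

text \<open>Input: \<open>n\<close> in register 0 and \<open>\<pi>(1), \<dots>, \<pi>(n)\<close> in the memory cells \<open>0, \<dots>, n - 1\<close>;
  everything else is 0. Output: the code of an automaton, starting at the address found in
  register 0 and lying inside the memory of the machine.\<close>

definition input_state :: "nat \<Rightarrow> (nat \<Rightarrow> nat) \<Rightarrow> state" where
  "input_state n \<pi> = ((\<lambda>_. 0)(0 := n), (\<lambda>i. if i < n then \<pi> (Suc i) else 0))"

definition outputs :: "nat \<Rightarrow> state \<Rightarrow> fa \<Rightarrow> bool" where
  "outputs M s A \<longleftrightarrow> fst s 0 + length (fa_code A) \<le> M \<and>
     (\<forall>i < length (fa_code A). snd s (fst s 0 + i) = fa_code A ! i)"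

text \<open>\<open>builds_automaton c spec f\<close>: given a pin-permutation \<open>\<pi>\<close> of size \<open>n\<close>, the program \<open>c\<close> builds
  a finite automaton accepting a language \<open>K\<close> with \<open>spec n \<pi> K\<close>, in time \<open>T n \<in> O(f n)\<close>
  and using \<open>M n \<in> O(f n)\<close> memory cells. Words have \<open>O(log n)\<close> bits, that is,
  they hold numbers bounded by a polynomial in \<open>n\<close>.\<close>

definition builds_automaton ::
    "com \<Rightarrow> (nat \<Rightarrow> (nat \<Rightarrow> nat) \<Rightarrow> dir list set \<Rightarrow> bool) \<Rightarrow> (nat \<Rightarrow> real) \<Rightarrow> bool" where
  "builds_automaton c spec f \<longleftrightarrow>
     (\<exists>(T :: nat \<Rightarrow> nat) (M :: nat \<Rightarrow> nat) (W :: nat \<Rightarrow> nat) (k :: nat).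
        (\<lambda>n. real (T n)) \<in> O(f) \<and> (\<lambda>n. real (M n)) \<in> O(f) \<and>
        (\<lambda>n. real (W n)) \<in> O(\<lambda>n. real n ^ k) \<and>
        (\<forall>n \<pi>. 1 \<le> n \<and> pin_permutation n \<pi> \<longrightarrow>
           (\<exists>t s A. exec (W n) (M n) c (input_state n \<pi>) t s \<and> t \<le> T n \<and>
              outputs (M n) s A \<and> fa_wf A \<and> spec n \<pi> (fa_lang A))))"

end

theory Submission
  imports Defs
begin

text \<open>The pins are peeled off in reverse order, so that the sets \<open>S\<close> of remaining points are the
  initial segments of pin sequences. The peeled pins lie outside the bounding box of \<open>S\<close>, and only
  the first pin after \<open>S\<close> may cut \<open>S\<close>; hence, in terms of positions, \<open>S\<close> is an interval, possibly
  without its second or its last but one element, and there are only \<open>O(n\<^sup>2)\<close> such sets.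
  A directional pin cuts off its predecessor \<open>q\<close> in some direction \<open>e\<close>, and one only has to remember
  that the next pin to be peeled is the extremal one in direction \<open>e\<close>. Then \<open>q\<close> is encoded by \<open>e\<close>
  itself or by a numeral whose two directions are read in the order starting with \<open>e\<close>, so the next
  letter read is \<open>e\<close> in any case. The origin \<open>p\<^sub>0\<close> imposes no further condition.
  This gives a nondeterministic automaton with \<open>9 (n + 1)\<^sup>2\<close> states and at most 40 transitions for
  each interval, whose conditions are read off a table counting, among the first \<open>p\<close> points, those
  above a given point. Since the automaton accepts exactly the reversed language, one program
  running in quadratic time serves both claims.\<close>

section \<open>Reading a reversed word by peeling pins\<close>

text \<open>A permutation can have exponentially many pin words, so the union over them cannot be
  enumerated within the bounds; nondeterministic guesses of the pin to be peeled cover all of them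
  at once. The point is that few remaining sets arise. A peeled horizontal pin is an end of the
  interval. A peeled vertical pin is an end as well if it is encoded by a numeral; if it is encoded
  by a direction, it leaves exactly one point on its left or on its right, so it is the second or
  the last but one. The remembered cut then forces the letter \<open>Left\<close> or
  \<open>Right\<close>, which removes the isolated end, and an interval is left again: gaps never
  accumulate. A remembered \<open>Left\<close> or \<open>Right\<close> thus determines the gap by
  itself. This explains the number 9: each interval has one kind of state without memory, four for
  the direction of a cut, and four for the second letter of a numeral that is still to be
  read.\<close>

definition vert :: "dir \<Rightarrow> bool" where
  "vert d \<longleftrightarrow> d = Up \<or> d = Down"

lemma vert_simps [simp]: "vert Up" "vert Down" "\<not> vert Left" "\<not> vert Right"
  by (auto simp: vert_def)

definition perp :: "dir \<Rightarrow> dir \<Rightarrow> bool" where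
  "perp d e \<longleftrightarrow> vert d \<noteq> vert e"

text \<open>The coordinate function \<open>c\<close> is a parameter: \<open>c d q\<close> measures
  how far \<open>q\<close> reaches in direction \<open>d\<close>. It is instantiated by
  \<open>crd\<close> on points and by \<open>perm_crd\<close> on positions. Only comparisons of its
  values matter, so peelings can be carried from one to the other.\<close>

definition extremal :: "(dir \<Rightarrow> 'a \<Rightarrow> real) \<Rightarrow> dir \<Rightarrow> 'a \<Rightarrow> 'a set \<Rightarrow> bool" where
  "extremal c d p S \<longleftrightarrow> (\<forall>q\<in>S - {p}. c d q < c d p)"

definition cuts_off :: "(dir \<Rightarrow> 'a \<Rightarrow> real) \<Rightarrow> dir \<Rightarrow> 'a \<Rightarrow> 'a set \<Rightarrow> bool" where
  "cuts_off c e p S \<longleftrightarrow> (\<exists>q\<in>S. c e p < c e q \<and> (\<forall>z\<in>S - {p, q}. c e z < c e p))"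

text \<open>The letters are listed from the last pin to the first. If \<open>r = Some e\<close>, the last pin has been cut
  off in direction \<open>e\<close> by the pin peeled before it.\<close>

fun peels :: "(dir \<Rightarrow> 'a \<Rightarrow> real) \<Rightarrow> 'a set \<Rightarrow> dir option \<Rightarrow> pin_letter list \<Rightarrow> bool" where
  "peels c S r [] \<longleftrightarrow> S = {} \<and> r = None"
| "peels c S r (Num k # w) \<longleftrightarrow> (\<exists>p\<in>S. (\<forall>d\<in>quad_dirs k. extremal c d p S) \<and>
     (\<forall>e. r = Some e \<longrightarrow> e \<in> quad_dirs k) \<and> peels c (S - {p}) None w)"
| "peels c S r (Dir d # w) \<longleftrightarrow> (\<exists>p\<in>S. extremal c d p S \<and> (\<forall>e. r = Some e \<longrightarrow> e = d) \<and>
     (\<exists>e. perp e d \<and> cuts_off c e p S \<and> peels c (S - {p}) (Some e) w))"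

text \<open>In \<open>Pend S y\<close> the pin of a numeral is already gone and the second of its
  two letters, \<open>y\<close>, is still to be read. In \<open>peel_step\<close> the loop at
  \<open>Peel S None\<close> absorbs the arbitrary words between factors; a remembered cut excludes
  it, because the letters of a strict factor are contiguous.\<close>

datatype 'a peel_state = Peel "'a set" "dir option" | Pend "'a set" dir

fun peel_step :: "(dir \<Rightarrow> 'a \<Rightarrow> real) \<Rightarrow> 'a peel_state \<Rightarrow> dir \<Rightarrow> 'a peel_state \<Rightarrow> bool" where
  "peel_step c (Peel S r) x t \<longleftrightarrow> r = None \<and> t = Peel S None \<or>
     (\<exists>p\<in>S. extremal c x p S \<and> (\<forall>e. r = Some e \<longrightarrow> e = x) \<and>
        (\<exists>y. perp y x \<and> (extremal c y p S \<and> t = Pend (S - {p}) y \<or>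
                               cuts_off c y p S \<and> t = Peel (S - {p}) (Some y))))"
| "peel_step c (Pend S y) x t \<longleftrightarrow> x = y \<and> t = Peel S None"

fun peel_accepts :: "(dir \<Rightarrow> 'a \<Rightarrow> real) \<Rightarrow> 'a peel_state \<Rightarrow> dir list \<Rightarrow> bool" where
  "peel_accepts c s [] \<longleftrightarrow> s = Peel {} None"
| "peel_accepts c s (x # v) \<longleftrightarrow> (\<exists>t. peel_step c s x t \<and> peel_accepts c t v)"

lemma peel_accepts_ConsI:
  "peel_step c s x t \<Longrightarrow> peel_accepts c t v \<Longrightarrow> peel_accepts c s (x # v)"
  by auto

lemma peel_step_PendI:
  "p \<in> S \<Longrightarrow> extremal c x p S \<Longrightarrow> (\<And>e. r = Some e \<Longrightarrow> e = x) \<Longrightarrow> perp y x \<Longrightarrow>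
    extremal c y p S \<Longrightarrow> peel_step c (Peel S r) x (Pend (S - {p}) y)"
  unfolding peel_step.simps by (intro disjI2 bexI[of _ p] conjI exI[of _ y] disjI1) auto

lemma peel_step_PeelI:
  "p \<in> S \<Longrightarrow> extremal c x p S \<Longrightarrow> (\<And>e. r = Some e \<Longrightarrow> e = x) \<Longrightarrow> perp y x \<Longrightarrow>
    cuts_off c y p S \<Longrightarrow> peel_step c (Peel S r) x (Peel (S - {p}) (Some y))"
  unfolding peel_step.simps
  by (rule disjI2, rule bexI[of _ p], intro conjI exI[of _ y], simp, blast, simp, rule disjI2) auto

text \<open>The first argument is the direction read immediately before, if any: \<open>phi2\<close> orders the two
  letters of a numeral such that it is followed by a perpendicular one.\<close>

inductive reads :: "dir option \<Rightarrow> pin_letter list \<Rightarrow> dir list \<Rightarrow> bool" where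
  nil: "reads None [] []"
| skip: "reads None w v \<Longrightarrow> reads None w (x # v)"
| num: "quad_dirs k = {x, y} \<Longrightarrow> (\<And>d. r = Some d \<Longrightarrow> perp y d) \<Longrightarrow> reads None w v \<Longrightarrow>
    reads r (Num k # w) (y # x # v)"
| dir: "reads (Some d) w v \<Longrightarrow> reads r (Dir d # w) (d # v)"

lemma perp_sym: "perp d e \<longleftrightarrow> perp e d"
  by (auto simp: perp_def)

lemma quad_dirs_perp: "quad_dirs k = {x, y} \<Longrightarrow> perp x y"
  by (cases k; cases x; cases y) (auto simp: perp_def)

lemma quad_dirs_ex: "perp x y \<Longrightarrow> \<exists>k. quad_dirs k = {x, y}"
proof -
  assume "perp x y"
  then have "{x, y} \<in> {quad_dirs Q1, quad_dirs Q2, quad_dirs Q3, quad_dirs Q4}"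
    by (cases x; cases y) (auto simp: perp_def)
  then show ?thesis by blast
qed

lemma quad_dirs_vert_unique: "d \<in> quad_dirs k \<Longrightarrow> e \<in> quad_dirs k \<Longrightarrow> vert d = vert e \<Longrightarrow> d = e"
  by (cases k; cases d; cases e) auto

text \<open>The two sides remember different things: \<open>reads\<close> the direction just read,
  \<open>peels\<close> the direction in which that pin has cut off its predecessor. The third
  assumption couples the two memories by perpendicularity.\<close>

lemma reads_imp_accepts:
  assumes "reads d w v"
    and "peels c S r w"
    and "case d of None \<Rightarrow> r = None | Some d' \<Rightarrow> (\<exists>e. r = Some e \<and> perp e d')"
  shows "peel_accepts c (Peel S r) v"
  using assms
proof (induction arbitrary: S r rule: reads.induct)
  case nil
  then show ?case by simp
next
  case (skip w v x)
  have "r = None" "peel_accepts c (Peel S None) v"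
    using skip.IH[of S None] skip.prems by auto
  then show ?case by (intro peel_accepts_ConsI[of _ _ _ "Peel S None"]) auto
next
  case (num k x y d w v)
  obtain p where p: "p \<in> S" "\<forall>d\<in>quad_dirs k. extremal c d p S"
      "\<forall>e. r = Some e \<longrightarrow> e \<in> quad_dirs k" "peels c (S - {p}) None w"
    using num.prems by auto
  \<comment> \<open>Both \<open>e\<close> and \<open>y\<close> are perpendicular to the letter read
    before, and a quadrant has only one direction on each axis.\<close>
  have r: "\<forall>e. r = Some e \<longrightarrow> e = y"
  proof (intro allI impI)
    fix e assume e: "r = Some e"
    then obtain d' where "d = Some d'" "perp e d'"
      using num.prems(2) by (cases d) auto
    then have "vert y = vert e" using num.hyps(2) by (auto simp: perp_def)
    moreover have "e \<in> quad_dirs k" "y \<in> quad_dirs k" using p(3) e num.hyps(1) by auto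
    ultimately show "e = y" using quad_dirs_vert_unique by blast
  qed
  have "peel_accepts c (Peel (S - {p}) None) v"
    using num.IH p(4) by simp
  then have "peel_accepts c (Pend (S - {p}) x) (x # v)" by simp
  moreover have "peel_step c (Peel S r) y (Pend (S - {p}) x)"
  proof (rule peel_step_PendI)
    show "perp x y" "extremal c y p S" "extremal c x p S"
      using num.hyps(1) quad_dirs_perp[OF num.hyps(1)] p(2) by (auto simp: perp_sym)
  qed (use p(1) r in auto)
  ultimately show ?case by (rule peel_accepts_ConsI[rotated])
next
  case (dir d w v d')
  obtain p e where p: "p \<in> S" "extremal c d p S" "\<forall>e. r = Some e \<longrightarrow> e = d"
      "perp e d" "cuts_off c e p S" "peels c (S - {p}) (Some e) w"
    using dir.prems by auto
  then have "peel_accepts c (Peel (S - {p}) (Some e)) v"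
    using dir.IH by simp
  then show ?case
    by (rule peel_accepts_ConsI[rotated]) (rule peel_step_PeelI, use p in auto)
qed

text \<open>The induction is on the length of \<open>v\<close>, since the two letters of a numeral
  are consumed by two steps of the automaton but give a single letter of the pin word.\<close>

lemma accepts_imp_reads:
  assumes "peel_accepts c (Peel S r) v"
    and "case d of None \<Rightarrow> r = None | Some d' \<Rightarrow> (\<exists>e. r = Some e \<and> perp e d')"
  shows "\<exists>w. peels c S r w \<and> reads d w v"
  using assms
proof (induction v arbitrary: S r d rule: length_induct)
  case (1 v)
  show ?case
  proof (cases v)
    case Nil
    with 1 show ?thesis by (auto intro!: exI[of _ "[]"] reads.nil split: option.splits)
  next
    case (Cons x v')
    with 1 obtain t where t: "peel_step c (Peel S r) x t" "peel_accepts c t v'" by auto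
    consider (loop) "r = None" "t = Peel S None"
      | (pend) p y where "p \<in> S" "extremal c x p S" "\<forall>e. r = Some e \<longrightarrow> e = x" "perp y x"
          "extremal c y p S" "t = Pend (S - {p}) y"
      | (dir) p y where "p \<in> S" "extremal c x p S" "\<forall>e. r = Some e \<longrightarrow> e = x" "perp y x"
          "cuts_off c y p S" "t = Peel (S - {p}) (Some y)"
      using t(1) by auto
    then show ?thesis
    proof cases
      case loop
      then have "d = None" using 1 by (auto split: option.splits)
      moreover obtain w where "peels c S None w" "reads None w v'"
        using 1(1)[rule_format, of v' S None None] Cons t(2) loop by auto
      ultimately show ?thesis using Cons loop by (auto intro: reads.skip)
    next
      case pend
      obtain v'' where v'': "v' = y # v''" "peel_accepts c (Peel (S - {p}) None) v''"
        using t(2) pend by (cases v') auto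
      obtain w where w: "peels c (S - {p}) None w" "reads None w v''"
        using 1(1)[rule_format, of v'' "S - {p}" None None] Cons v'' by auto
      obtain k where k: "quad_dirs k = {y, x}" using quad_dirs_ex[OF pend(4)] by auto
      have "reads d (Num k # w) v"
        unfolding Cons v''(1) using k w(2) pend(3) 1(3) by (intro reads.num) auto
      moreover have "peels c S r (Num k # w)"
        using pend w k by auto
      ultimately show ?thesis by blast
    next
      case dir
      obtain w where w: "peels c (S - {p}) (Some y) w" "reads (Some x) w v'"
        using 1(1)[rule_format, of v' "S - {p}" "Some y" "Some x"] Cons t(2) dir by auto
      have "reads d (Dir x # w) v" unfolding Cons using w by (intro reads.dir)
      moreover have "peels c S r (Dir x # w)" using dir w by auto
      ultimately show ?thesis by blast
    qed
  qed
qed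

lemma accepts_iff_reads:
  "peel_accepts c (Peel S None) v \<longleftrightarrow> (\<exists>w. peels c S None w \<and> reads None w v)"
  using reads_imp_accepts[of None _ v c S None] accepts_imp_reads[of c S None v None] by auto

section \<open>Reversed reading and the languages of factor lists\<close>

lemma reads_append: "reads None w t \<Longrightarrow> reads None w (s @ t)"
  by (induction s) (auto intro: reads.skip)

lemma reads_Nil: "reads None [] v"
  by (induction v) (auto intro: reads.intros)

text \<open>While a direction is remembered, \<open>skip\<close> does not apply. Hence a run of
  directions is read without interruption down to its numeral, and the last direction read dictates
  the order of the two letters of that numeral.\<close>

lemma reads_run:
  "reads (Some d) (map Dir ds @ Num k # w) v \<longleftrightarrow>
     (\<exists>x y v'. v = ds @ y # x # v' \<and> quad_dirs k = {x, y} \<and> perp y (last (d # ds)) \<and>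
        reads None w v')" (is "?L d ds v \<longleftrightarrow> ?R d ds v")
proof (induction ds arbitrary: d v)
  case Nil
  show ?case
  proof
    show "?L d [] v \<Longrightarrow> ?R d [] v"
      by (erule reads.cases) auto
    show "?R d [] v \<Longrightarrow> ?L d [] v"
      by (auto intro: reads.num)
  qed
next
  case (Cons a ds)
  have "?L d (a # ds) v \<longleftrightarrow> (\<exists>v1. v = a # v1 \<and> ?L a ds v1)"
    by (subst reads.simps) simp
  then show ?case using Cons.IH[of a] by auto
qed

lemma reads_None_Cons:
  "reads None (l # w) v \<longleftrightarrow> (\<exists>s t. v = s @ t \<and>
     (case l of Num k \<Rightarrow> (\<exists>x y v'. t = y # x # v' \<and> quad_dirs k = {x, y} \<and> reads None w v')
              | Dir d \<Rightarrow> (\<exists>v'. t = d # v' \<and> reads (Some d) w v')))"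
  (is "_ \<longleftrightarrow> ?R v")
proof
  show "reads None (l # w) v \<Longrightarrow> ?R v"
  proof (induction "None :: dir option" "l # w" v rule: reads.induct)
    case (skip v x)
    then obtain s t where "v = s @ t" "case l of Num k \<Rightarrow> (\<exists>x y v'. t = y # x # v' \<and> quad_dirs k = {x, y} \<and> reads None w v')
              | Dir d \<Rightarrow> (\<exists>v'. t = d # v' \<and> reads (Some d) w v')" by blast
    then show ?case by (intro exI[of _ "x # s"] exI[of _ t]) simp
  next
    case (num k x y v)
    then show ?case by (intro exI[of _ "[]"] exI[of _ "y # x # v"]) auto
  next
    case (dir d v)
    then show ?case by (intro exI[of _ "[]"] exI[of _ "d # v"]) auto
  qed
next
  assume "?R v"
  then obtain s t where v: "v = s @ t" and
    t: "case l of Num k \<Rightarrow> (\<exists>x y v'. t = y # x # v' \<and> quad_dirs k = {x, y} \<and> reads None w v')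
              | Dir d \<Rightarrow> (\<exists>v'. t = d # v' \<and> reads (Some d) w v')" by blast
  have "reads None (l # w) t"
    using t by (cases l) (auto intro: reads.intros)
  then show "reads None (l # w) v"
    unfolding v by (rule reads_append)
qed

lemma phi1_iff: "[x, y] \<in> phi1 k \<longleftrightarrow> quad_dirs k = {x, y}"
  by (cases k; cases x; cases y) auto

lemma phi1_length: "t \<in> phi1 k \<Longrightarrow> length t = 2"
  by (cases k) auto

text \<open>All sixteen equations of \<open>phi2\<close> follow one rule: take the two directions of
  the quadrant, ordered so that the second is perpendicular to the letter that follows.\<close>

lemma phi2_iff:
  "t = phi2 k d \<longleftrightarrow> (\<exists>x y. t = [x, y, d] \<and> quad_dirs k = {x, y} \<and> perp y d)"
proof
  show "t = phi2 k d \<Longrightarrow> \<exists>x y. t = [x, y, d] \<and> quad_dirs k = {x, y} \<and> perp y d"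
    by (cases k; cases d) (auto simp: perp_def)
  show "\<exists>x y. t = [x, y, d] \<and> quad_dirs k = {x, y} \<and> perp y d \<Longrightarrow> t = phi2 k d"
  proof (elim exE conjE)
    fix x y assume "t = [x, y, d]" "quad_dirs k = {x, y}" "perp y d"
    then show "t = phi2 k d" by (cases k; cases d; cases x; cases y) (auto simp: perp_def)
  qed
qed

lemma phi_iff:
  "t \<in> phi (k, ds) \<longleftrightarrow> (\<exists>x y. t = x # y # ds \<and> quad_dirs k = {x, y} \<and>
      (ds \<noteq> [] \<longrightarrow> perp y (hd ds)))"
proof (cases ds)
  case Nil
  have "t \<in> phi1 k \<longleftrightarrow> (\<exists>x y. t = [x, y] \<and> [x, y] \<in> phi1 k)"
    using phi1_length[of t k] by (auto simp: length_Suc_conv numeral_2_eq_2)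
  then show ?thesis using Nil phi1_iff by auto
next
  case (Cons d ds')
  obtain x y where xy: "phi2 k d = [x, y, d]" "quad_dirs k = {x, y}" "perp y d"
    using phi2_iff[of "phi2 k d" k d] by blast
  show ?thesis
  proof
    assume "t \<in> phi (k, ds)"
    then have "t = x # y # ds" using Cons xy(1) by simp
    then show "\<exists>x y. t = x # y # ds \<and> quad_dirs k = {x, y} \<and> (ds \<noteq> [] \<longrightarrow> perp y (hd ds))"
      using xy Cons by auto
  next
    assume "\<exists>x y. t = x # y # ds \<and> quad_dirs k = {x, y} \<and> (ds \<noteq> [] \<longrightarrow> perp y (hd ds))"
    then obtain x' y' where t: "t = x' # y' # ds" "quad_dirs k = {x', y'}" "perp y' d"
      using Cons by auto
    then have "[x', y', d] = phi2 k d" using phi2_iff by blast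
    then show "t \<in> phi (k, ds)" using t(1) Cons by simp
  qed
qed

text \<open>Letters can be skipped only before the first letter of the reversed factor; the rest is
  a mirrored image under \<open>phi\<close>. A factor that is a lone numeral leaves the order of its
  two letters open, in accordance with the two words in \<open>phi1\<close>.\<close>

lemma reads_factor:
  "reads None (rev (letters_of_strict u) @ w) v \<longleftrightarrow>
     (\<exists>s t v'. v = s @ rev t @ v' \<and> t \<in> phi u \<and> reads None w v')"
proof -
  obtain k ds where u: "u = (k, ds)" by (cases u)
  have R: "(\<exists>s t v'. v = s @ rev t @ v' \<and> t \<in> phi u \<and> reads None w v') \<longleftrightarrow>
      (\<exists>s x y v'. v = s @ rev ds @ y # x # v' \<and> quad_dirs k = {x, y} \<and>
         (ds \<noteq> [] \<longrightarrow> perp y (hd ds)) \<and> reads None w v')"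
  proof -
    have "(\<exists>s t v'. v = s @ rev t @ v' \<and> (\<exists>x y. t = x # y # ds \<and> P x y) \<and> reads None w v') \<longleftrightarrow>
      (\<exists>s x y v'. v = s @ rev (x # y # ds) @ v' \<and> P x y \<and> reads None w v')" for P
      by blast
    then show ?thesis unfolding u phi_iff by simp
  qed
  show ?thesis
  proof (cases ds rule: rev_cases)
    case Nil
    then show ?thesis unfolding R
      by (simp add: u letters_of_strict_def reads_None_Cons; blast)
  next
    case (snoc ds' d)
    have 1: "rev (letters_of_strict u) @ w = Dir d # map Dir (rev ds') @ Num k # w"
      by (simp add: u snoc letters_of_strict_def rev_map)
    have l: "last (d # rev ds') = hd ds" by (cases ds') (auto simp: snoc)
    show ?thesis unfolding 1 R
      unfolding reads_None_Cons pin_letter.case reads_run l by (simp add: snoc; blast)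
  qed
qed

lemma conc_assoc: "conc (conc K L) M = conc K (conc L M)"
  unfolding conc_def by (auto; metis append.assoc)

text \<open>\<open>factors_lang\<close> recurses from the first factor, but a reversed word begins
  with the last one; this is the unfolding at the other end.\<close>

lemma factors_lang_snoc: "factors_lang (us @ [u]) = conc (factors_lang us) (conc (phi u) UNIV)"
  by (induction us) (simp_all add: conc_assoc)

lemma reads_factors:
  "reads None (rev (concat (map letters_of_strict us))) v \<longleftrightarrow> rev v \<in> factors_lang us"
proof (induction us arbitrary: v rule: rev_induct)
  case Nil
  show ?case by (simp add: reads_Nil)
next
  case (snoc u us)
  have "rev v \<in> factors_lang (us @ [u]) \<longleftrightarrow>
      (\<exists>s t v'. rev v = v' @ t @ s \<and> v' \<in> factors_lang us \<and> t \<in> phi u)"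
    by (auto simp: factors_lang_snoc conc_def)
  also have "\<dots> \<longleftrightarrow> (\<exists>s t v'. v = s @ rev t @ v' \<and> t \<in> phi u \<and> rev v' \<in> factors_lang us)"
    by (metis rev_append rev_rev_ident append.assoc)
  finally show ?case using snoc.IH by (simp add: reads_factor)
qed

lemma decomposition_exists:
  "w = [] \<or> (\<exists>k w'. w = Num k # w') \<Longrightarrow> \<exists>us. is_sn_decomposition w us"
proof (induction w rule: rev_induct)
  case Nil
  show ?case by (auto simp: is_sn_decomposition_def intro: exI[of _ "[]"])
next
  case (snoc l w)
  show ?case
  proof (cases l)
    case (Num k)
    obtain us where "is_sn_decomposition w us"
      using snoc by (cases w) auto
    then have "is_sn_decomposition (w @ [l]) (us @ [(k, [])])"
      by (simp add: is_sn_decomposition_def letters_of_strict_def Num)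
    then show ?thesis by blast
  next
    case (Dir d)
    then obtain k w' where w: "w = Num k # w'"
      using snoc by (cases w) auto
    then obtain us where us: "w = concat (map letters_of_strict us)"
      using snoc unfolding is_sn_decomposition_def by auto
    then obtain us' k' ds where "us = us' @ [(k', ds)]"
      using w by (cases us rule: rev_cases) auto
    then have "is_sn_decomposition (w @ [l]) (us' @ [(k', ds @ [d])])"
      using us by (simp add: is_sn_decomposition_def letters_of_strict_def Dir)
    then show ?thesis by blast
  qed
qed

text \<open>A direction leaves a remembered cut, with which the empty word is rejected. So the first
  pin is always encoded by a numeral.\<close>

lemma peels_last: "peels c S r w \<Longrightarrow> w \<noteq> [] \<Longrightarrow> \<exists>k. last w = Num k"
proof (induction w arbitrary: S r)
  case (Cons l w)
  then show ?case by (cases l; cases w) auto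
qed simp

lemma reads_word_lang:
  assumes "peels c S None (rev w)"
  shows "reads None (rev w) v \<longleftrightarrow> rev v \<in> word_lang w"
proof -
  have "w = [] \<or> (\<exists>k w'. w = Num k # w')"
    using peels_last[OF assms] by (cases w) auto
  then obtain us where us: "is_sn_decomposition w us" using decomposition_exists by blast
  have "reads None (rev w) v \<longleftrightarrow> rev v \<in> factors_lang us'" if "is_sn_decomposition w us'" for us'
    using reads_factors that unfolding is_sn_decomposition_def by auto
  then show ?thesis using us by (auto simp: word_lang_def)
qed

lemma accepts_iff_word_lang:
  "peel_accepts c (Peel S None) v \<longleftrightarrow> (\<exists>w. peels c S None (rev w) \<and> rev v \<in> word_lang w)"
  unfolding accepts_iff_reads using reads_word_lang by (metis rev_rev_ident)

section \<open>Pin words and peeling\<close>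

text \<open>Coordinates carry a sign, so that every direction asks for large values and one argument
  serves all four directions.\<close>

fun crd :: "dir \<Rightarrow> point \<Rightarrow> real" where
  "crd Up p = snd p"
| "crd Down p = - snd p"
| "crd Left p = - fst p"
| "crd Right p = fst p"

lemma beyond_iff: "beyond d p S \<longleftrightarrow> (\<forall>q\<in>S. crd d q < crd d p)"
  by (cases d) auto

lemma quad_dirs_axis: "\<exists>d\<in>quad_dirs k. vert d = b"
  by (cases k; cases b) auto

fun opp :: "dir \<Rightarrow> dir" where
  "opp Up = Down" | "opp Down = Up" | "opp Left = Right" | "opp Right = Left"

lemma crd_opp [simp]: "crd (opp d) p = - crd d p"
  by (cases d) auto

lemma vert_opp [simp]: "vert (opp d) = vert d"
  by (cases d) auto

lemma same_axis: "vert d = vert e \<Longrightarrow> d = e \<or> d = opp e"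
  by (cases d; cases e) auto

lemma subset_bbox: "S \<subseteq> bbox S"
  unfolding bbox_def by auto

lemma bbox_subset:
  assumes "finite S" "S \<noteq> {}"
  shows "bbox S \<subseteq> {Min (fst ` S)..Max (fst ` S)} \<times> {Min (snd ` S)..Max (snd ` S)}"
  unfolding bbox_def
proof (rule Inter_lower, intro CollectI exI conjI, rule refl)
  show "S \<subseteq> {Min (fst ` S)..Max (fst ` S)} \<times> {Min (snd ` S)..Max (snd ` S)}"
  proof
    fix z assume "z \<in> S"
    then have "fst z \<in> fst ` S" "snd z \<in> snd ` S" by auto
    then show "z \<in> {Min (fst ` S)..Max (fst ` S)} \<times> {Min (snd ` S)..Max (snd ` S)}"
      using assms(1) by (simp add: mem_Times_iff)
  qed
qed

lemma beyond_bbox: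
  assumes "finite S" "S \<noteq> {}"
  shows "beyond d p (bbox S) \<longleftrightarrow> beyond d p S"
proof
  show "beyond d p (bbox S) \<Longrightarrow> beyond d p S"
    using subset_bbox[of S] unfolding beyond_iff by blast
  assume b: "beyond d p S"
  let ?X = "fst ` S" and ?Y = "snd ` S"
  have fin: "finite ?X" "finite ?Y" "?X \<noteq> {}" "?Y \<noteq> {}" using assms by auto
  show "beyond d p (bbox S)"
  proof (cases d)
    case Up
    then have "Max ?Y < snd p" using b fin by auto
    then show ?thesis using bbox_subset[OF assms] Up by fastforce
  next
    case Down
    then have "snd p < Min ?Y" using b fin by auto
    then show ?thesis using bbox_subset[OF assms] Down by fastforce
  next
    case Left
    then have "fst p < Min ?X" using b fin by auto
    then show ?thesis using bbox_subset[OF assms] Left by fastforce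
  next
    case Right
    then have "Max ?X < fst p" using b fin by auto
    then show ?thesis using bbox_subset[OF assms] Right by fastforce
  qed
qed

lemma separates_iff:
  "separates p P Q \<longleftrightarrow> (\<exists>e. (\<forall>z\<in>P. crd e p < crd e z) \<and> (\<forall>z\<in>Q. crd e z < crd e p))"
proof
  assume "separates p P Q"
  then consider "P \<subseteq> {q. fst q < fst p} \<and> Q \<subseteq> {q. fst q > fst p}"
    | "Q \<subseteq> {q. fst q < fst p} \<and> P \<subseteq> {q. fst q > fst p}"
    | "P \<subseteq> {q. snd q < snd p} \<and> Q \<subseteq> {q. snd q > snd p}"
    | "Q \<subseteq> {q. snd q < snd p} \<and> P \<subseteq> {q. snd q > snd p}"
    unfolding separates_def by blast
  then show "\<exists>e. (\<forall>z\<in>P. crd e p < crd e z) \<and> (\<forall>z\<in>Q. crd e z < crd e p)"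
  proof cases
    case 1 then show ?thesis by (intro exI[of _ Left]) auto
  next
    case 2 then show ?thesis by (intro exI[of _ Right]) auto
  next
    case 3 then show ?thesis by (intro exI[of _ Down]) auto
  next
    case 4 then show ?thesis by (intro exI[of _ Up]) auto
  qed
next
  assume "\<exists>e. (\<forall>z\<in>P. crd e p < crd e z) \<and> (\<forall>z\<in>Q. crd e z < crd e p)"
  then obtain e where "\<forall>z\<in>P. crd e p < crd e z" "\<forall>z\<in>Q. crd e z < crd e p" by blast
  then show "separates p P Q" unfolding separates_def by (cases e) auto
qed

text \<open>A numeral excludes every separation by itself, and the line by which a directional pin
  separates is perpendicular to its direction.\<close>

fun pin_at :: "point list \<Rightarrow> point \<Rightarrow> pin_letter \<Rightarrow> bool" where
  "pin_at qs p (Num k) \<longleftrightarrow> (\<forall>d\<in>quad_dirs k. beyond d p (set qs))"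
| "pin_at qs p (Dir d) \<longleftrightarrow> 2 \<le> length qs \<and> beyond d p (set qs) \<and>
     (\<exists>e. perp e d \<and> crd e p < crd e (last qs) \<and> (\<forall>z\<in>set (butlast qs). crd e z < crd e p))"

lemma beyond_not_separates:
  assumes "\<And>b. \<exists>d. vert d = b \<and> beyond d p S" "P \<subseteq> S" "Q \<subseteq> S" "P \<noteq> {}" "Q \<noteq> {}"
  shows "\<not> separates p P Q"
proof
  assume "separates p P Q"
  then obtain e where e: "\<forall>z\<in>P. crd e p < crd e z" "\<forall>z\<in>Q. crd e z < crd e p"
    unfolding separates_iff by blast
  obtain d where d: "vert d = vert e" "\<forall>z\<in>S. crd d z < crd d p"
    using assms(1)[of "vert e"] unfolding beyond_iff by blast
  obtain a b where "a \<in> P" "b \<in> Q" using assms by blast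
  then have "crd e p < crd e a" "crd e b < crd e p" "crd d a < crd d p" "crd d b < crd d p"
    using e d assms by auto
  then show False using same_axis[OF d(1)] by auto
qed

lemma letter_of_iff:
  assumes "qs \<noteq> []"
  shows "letter_of qs p l \<longleftrightarrow> pin_at qs p l"
proof (cases l)
  case (Num k)
  have "beyond d p (bbox (set qs)) \<longleftrightarrow> beyond d p (set qs)" for d
    using beyond_bbox assms by simp
  moreover have "\<not> separates p P Q" if "\<forall>d\<in>quad_dirs k. beyond d p (set qs)"
    "P \<noteq> {}" "Q \<noteq> {}" "P \<subseteq> set qs" "Q \<subseteq> set qs" for P Q
    using that beyond_not_separates[of p "set qs" P Q] quad_dirs_axis[of k] by blast
  ultimately show ?thesis unfolding Num letter_of.simps pin_at.simps by blast
next
  case (Dir d)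
  have "separates p {last qs} (set (butlast qs)) \<longleftrightarrow>
      (\<exists>e. perp e d \<and> crd e p < crd e (last qs) \<and> (\<forall>z\<in>set (butlast qs). crd e z < crd e p))"
    if len: "2 \<le> length qs" and b: "beyond d p (set qs)"
  proof -
    have "butlast qs \<noteq> []" using len by (cases qs; cases "tl qs") auto
    then obtain z where z: "z \<in> set (butlast qs)" by (meson list.set_sel(1))
    then have "z \<in> set qs" "last qs \<in> set qs" using assms by (auto dest: in_set_butlastD)
    then have "crd d z < crd d p" "crd d (last qs) < crd d p" using b by (auto simp: beyond_iff)
    \<comment> \<open>On the axis of \<open>d\<close>, both \<open>last qs\<close> and
      \<open>z\<close> lie on the same side of \<open>p\<close>, because \<open>p\<close> is beyond
      both; so the separating line belongs to the other axis.\<close>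
    have *: "perp e d" if "crd e p < crd e (last qs)" "crd e z < crd e p" for e
    proof (rule ccontr)
      assume "\<not> perp e d"
      then have "e = d \<or> e = opp d" using same_axis unfolding perp_def by blast
      then show False
        using that \<open>crd d z < crd d p\<close> \<open>crd d (last qs) < crd d p\<close> by auto
    qed
    show ?thesis unfolding separates_iff using z * by blast
  qed
  then show ?thesis unfolding Dir letter_of.simps pin_at.simps by blast
qed

section \<open>Pin sequences reduced to general position and a condition on each letter\<close>

definition generic :: "point list \<Rightarrow> bool" where
  "generic ps \<longleftrightarrow> (\<forall>i j. i < j \<and> j < length ps \<longrightarrow>
     fst (ps ! i) \<noteq> fst (ps ! j) \<and> snd (ps ! i) \<noteq> snd (ps ! j))"

definition pin_step :: "point list \<Rightarrow> point \<Rightarrow> bool" where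
  "pin_step qs p \<longleftrightarrow> p \<notin> bbox (set qs) \<and> (separates p {last qs} (set (butlast qs)) \<or>
     \<not> (\<exists>P Q. P \<noteq> {} \<and> Q \<noteq> {} \<and> P \<union> Q = set qs \<and> separates p P Q))"

lemma pin_sequence_iff:
  "pin_sequence ps \<longleftrightarrow>
     generic ps \<and> (\<forall>i. 1 \<le> i \<and> i < length ps \<longrightarrow> pin_step (take i ps) (ps ! i))"
proof -
  have "last (take i ps) = ps ! (i - 1) \<and> butlast (take i ps) = take (i - 1) ps"
    if "1 \<le> i" "i < length ps" for i
  proof -
    have "take i ps \<noteq> []" using that by auto
    then show ?thesis using that by (simp add: last_conv_nth butlast_take)
  qed
  then show ?thesis unfolding pin_sequence_def generic_def pin_step_def by auto
qed

text \<open>The list \<open>qs'\<close> may omit earlier points of \<open>qs\<close> as long as the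
  last one stays. This yields the pin sequence condition both with the origin and without
  it.\<close>

lemma pin_at_step:
  assumes "pin_at qs p l" "qs' \<noteq> []" "set qs' \<subseteq> set qs" "last qs' = last qs"
    "set (butlast qs') \<subseteq> set (butlast qs)"
  shows "pin_step qs' p"
proof -
  obtain d where "beyond d p (set qs)"
    using assms(1) quad_dirs_axis[of _ True] by (cases l; simp; blast)
  then have "beyond d p (bbox (set qs'))"
    using assms(2,3) beyond_bbox[of "set qs'"] unfolding beyond_iff by auto
  then have "p \<notin> bbox (set qs')" by (auto simp: beyond_iff)
  moreover have "separates p {last qs'} (set (butlast qs')) \<or>
     \<not> (\<exists>P Q. P \<noteq> {} \<and> Q \<noteq> {} \<and> P \<union> Q = set qs' \<and> separates p P Q)"
  proof (cases l)
    case (Num k)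
    have "\<exists>d. vert d = b \<and> beyond d p (set qs')" for b
      using assms(1,3) quad_dirs_axis[of k b] unfolding Num beyond_iff pin_at.simps by blast
    then show ?thesis using beyond_not_separates[of p "set qs'"] by blast
  next
    case (Dir d)
    then have "separates p {last qs'} (set (butlast qs'))"
      using assms unfolding separates_iff by auto
    then show ?thesis ..
  qed
  ultimately show ?thesis unfolding pin_step_def by blast
qed

definition pin_coding :: "point \<Rightarrow> point list \<Rightarrow> pin_letter list \<Rightarrow> bool" where
  "pin_coding p0 ps w \<longleftrightarrow> length w = length ps \<and>
     (\<forall>i < length ps. pin_at (p0 # take i ps) (ps ! i) (w ! i))"

lemma generic_tl: "generic (p # ps) \<Longrightarrow> generic ps"
  unfolding generic_def by (metis Suc_less_eq length_Cons nth_Cons_Suc)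

text \<open>A valid letter at each pin implies the step condition of pin sequences, for
  \<open>ps\<close> as well as for \<open>p0 # ps\<close>. Of the two pin sequence conditions only
  general position remains.\<close>

lemma pin_words_iff:
  "w \<in> pin_words n \<pi> \<longleftrightarrow> (\<exists>p0 ps. order_isomorphic (set ps) (diagram n \<pi>) \<and>
     generic (p0 # ps) \<and> pin_coding p0 ps w)"
proof -
  have enc: "encoded_by p0 ps w \<longleftrightarrow> pin_coding p0 ps w" for p0 ps
    unfolding encoded_by_def pin_coding_def by (simp add: letter_of_iff)
  have seq: "pin_sequence ps \<and> pin_sequence (p0 # ps)"
    if g: "generic (p0 # ps)" and c: "pin_coding p0 ps w" for p0 ps
  proof -
    have "pin_step (take i (p0 # ps)) ((p0 # ps) ! i)" if i: "1 \<le> i" "i < length (p0 # ps)" for i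
    proof -
      obtain j where j: "i = Suc j" "j < length ps" using i by (cases i) auto
      then show ?thesis
        using c unfolding pin_coding_def by (auto intro!: pin_at_step[of "p0 # take j ps" _ "w ! j"])
    qed
    moreover have "pin_step (take i ps) (ps ! i)" if "1 \<le> i" "i < length ps" for i
    proof -
      have "take i ps \<noteq> []" using that by auto
      then show ?thesis
        using c that unfolding pin_coding_def
        by (auto intro!: pin_at_step[of "p0 # take i ps" _ "w ! i"] dest: in_set_butlastD)
    qed
    ultimately show ?thesis
      unfolding pin_sequence_iff using g generic_tl by blast
  qed
  show ?thesis
    unfolding pin_words_def pin_representation_def mem_Collect_eq enc
    using seq pin_sequence_iff by blast
qed

section \<open>Pin words versus peelings, and the choice of the origin\<close>

definition leads :: "dir \<Rightarrow> pin_letter \<Rightarrow> bool" where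
  "leads e l \<longleftrightarrow> l = Dir e \<or> (\<exists>k. l = Num k \<and> e \<in> quad_dirs k)"

lemma peels_Some: "peels c S None (l # w) \<Longrightarrow> leads e l \<Longrightarrow> peels c S (Some e) (l # w)"
  unfolding leads_def by (cases l) auto

lemma pin_coding_snoc:
  "pin_coding p0 (ps @ [p]) w \<longleftrightarrow>
     (\<exists>w' l. w = w' @ [l] \<and> pin_coding p0 ps w' \<and> pin_at (p0 # ps) p l)"
proof (cases w rule: rev_cases)
  case Nil
  then show ?thesis by (auto simp: pin_coding_def)
next
  case (snoc w' l)
  then show ?thesis
    by (auto simp: pin_coding_def nth_append less_Suc_eq)
qed

lemma generic_butlast: "generic (ps @ [p]) \<Longrightarrow> generic ps"
  unfolding generic_def by (force simp: nth_append)

lemma generic_snoc_notin: "generic (ps @ [p]) \<Longrightarrow> p \<notin> set ps"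
  unfolding generic_def in_set_conv_nth
  by (metis length_append_singleton lessI nth_append nth_append_length)

text \<open>Since the line of \<open>p\<close> lies between \<open>q\<close> and all of
  \<open>qs\<close>, the pin \<open>q\<close> is beyond \<open>qs\<close> in direction
  \<open>e\<close>. A numeral encoding \<open>q\<close> therefore contains \<open>e\<close>. If
  \<open>q\<close> were encoded by a direction on the other axis, its own line on the axis of
  \<open>e\<close> would separate \<open>last qs\<close> from the earlier points, whereas all of
  \<open>qs\<close> lies on one side of it.\<close>

lemma pin_coding_leads:
  assumes "pin_at qs q l" "crd e p < crd e q" "\<forall>z\<in>set qs. crd e z < crd e p" "qs \<noteq> []"
  shows "leads e l"
proof -
  obtain z where z: "z \<in> set qs" using assms(4) by (meson list.set_sel(1))
  then have ze: "crd e z < crd e q" using assms by auto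
  show ?thesis
  proof (cases l)
    case (Num k)
    obtain d where d: "d \<in> quad_dirs k" "vert d = vert e" using quad_dirs_axis by blast
    then have "crd d z < crd d q" using assms(1) z Num by (auto simp: beyond_iff)
    then have "d = e" using same_axis[OF d(2)] ze by auto
    then show ?thesis using Num d by (auto simp: leads_def)
  next
    case (Dir d)
    obtain f where f: "perp f d" "crd f q < crd f (last qs)" "2 \<le> length qs"
       "\<forall>z\<in>set (butlast qs). crd f z < crd f q"
      and b: "beyond d q (set qs)"
      using assms(1) Dir by auto
    have "d = e"
    proof (cases "vert d = vert e")
      case True
      moreover have "crd d z < crd d q" using b z by (auto simp: beyond_iff)
      ultimately show ?thesis using same_axis[of d e] ze by auto
    next
      case False
      then have "vert f = vert e" using f(1) unfolding perp_def by blast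
      then consider "f = e" | "f = opp e" using same_axis by blast
      then show ?thesis
      proof cases
        case 1
        have "last qs \<in> set qs" using assms(4) by simp
        then have "crd e (last qs) < crd e p" using assms(3) by blast
        then show ?thesis using f(2) assms(2) 1 by auto
      next
        case 2
        have "butlast qs \<noteq> []" using f(3) by (cases qs; cases "tl qs") auto
        then obtain y where "y \<in> set (butlast qs)" by (meson list.set_sel(1))
        then have "crd f y < crd f q" "y \<in> set qs" using f(4) by (auto dest: in_set_butlastD)
        then show ?thesis using 2 assms(2,3) by force
      qed
    qed
    then show ?thesis using Dir by (simp add: leads_def)
  qed
qed

lemma pin_coding_peels:
  "generic (p0 # ps) \<Longrightarrow> pin_coding p0 ps w \<Longrightarrow> peels crd (set ps) None (rev w)"
proof (induction ps arbitrary: w rule: rev_induct)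
  case Nil
  then show ?case by (simp add: pin_coding_def)
next
  case (snoc p ps)
  obtain w' l where w: "w = w' @ [l]" "pin_coding p0 ps w'" "pin_at (p0 # ps) p l"
    using snoc.prems(2) pin_coding_snoc by blast
  have IH: "peels crd (set ps) None (rev w')"
    using snoc.IH[OF _ w(2)] snoc.prems(1) generic_butlast[of "p0 # ps" p] by simp
  have "p \<notin> set ps" using generic_snoc_notin[of "p0 # ps" p] snoc.prems(1) by simp
  then have del: "set (ps @ [p]) - {p} = set ps" by auto
  have ext: "extremal crd d p (set (ps @ [p]))" if "beyond d p (set (p0 # ps))" for d
    using that unfolding extremal_def beyond_iff del by simp
  show ?case
  proof (cases l)
    case (Num k)
    then have "\<forall>d\<in>quad_dirs k. extremal crd d p (set (ps @ [p]))"
      using ext w(3) by auto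
    moreover have "peels crd (set (ps @ [p]) - {p}) None (rev w')" using IH del by simp
    ultimately show ?thesis unfolding w Num rev_append rev.simps append_Nil append_Cons peels.simps
      by (intro bexI[of _ p]) auto
  next
    case (Dir d)
    obtain e where e: "perp e d" "crd e p < crd e (last (p0 # ps))"
        "\<forall>z\<in>set (butlast (p0 # ps)). crd e z < crd e p" "2 \<le> length (p0 # ps)"
      and b: "beyond d p (set (p0 # ps))"
      using w(3) Dir by auto
    obtain qs q where ps: "ps = qs @ [q]" using e(4) by (cases ps rule: rev_cases) auto
    obtain u m where u: "w' = u @ [m]" "pin_at (p0 # qs) q m"
      using w(2) ps pin_coding_snoc by blast
    have z: "\<forall>z\<in>set (p0 # qs). crd e z < crd e p" "crd e p < crd e q"
      using e ps by (simp_all add: butlast_append)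
    then have "leads e m" using pin_coding_leads[OF u(2)] by blast
    then have pe: "peels crd (set ps) (Some e) (rev w')"
      using IH peels_Some u(1) by simp
    have "cuts_off crd e p (set (ps @ [p]))"
      unfolding cuts_off_def using z ps by (intro bexI[of _ q]) auto
    then show ?thesis
      unfolding w Dir rev_append rev.simps append_Nil append_Cons peels.simps
      using ext[OF b] e(1) pe del by (intro bexI[of _ p] conjI exI[of _ e]) auto
  qed
qed

text \<open>Form of \<open>pin_at\<close> without the origin, where \<open>u\<close> is the word of
  the earlier pins. The separation from the origin is replaced by the demand that the preceding
  letter leads in direction \<open>e\<close>; this makes it possible to insert an origin
  afterwards.\<close>

fun pin_at' :: "point list \<Rightarrow> pin_letter list \<Rightarrow> point \<Rightarrow> pin_letter \<Rightarrow> bool" where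
  "pin_at' qs u p (Num k) \<longleftrightarrow> (\<forall>d\<in>quad_dirs k. beyond d p (set qs))"
| "pin_at' qs u p (Dir d) \<longleftrightarrow> qs \<noteq> [] \<and> beyond d p (set qs) \<and>
     (\<exists>e. perp e d \<and> crd e p < crd e (last qs) \<and> (\<forall>z\<in>set (butlast qs). crd e z < crd e p) \<and>
          leads e (last u))"

definition pin_coding' :: "point list \<Rightarrow> pin_letter list \<Rightarrow> bool" where
  "pin_coding' ps w \<longleftrightarrow> length w = length ps \<and>
     (\<forall>i < length ps. pin_at' (take i ps) (take i w) (ps ! i) (w ! i))"

lemma pin_coding'_snoc:
  "pin_coding' ps w \<Longrightarrow> pin_at' ps w p l \<Longrightarrow> pin_coding' (ps @ [p]) (w @ [l])"
  by (auto simp: pin_coding'_def nth_append less_Suc_eq)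

text \<open>The clause on a remembered \<open>e\<close> is what carries the induction: the last pin
  is then the extremal one in direction \<open>e\<close>, hence the very point that the following
  pin cuts off.\<close>

lemma peels_pin_coding':
  assumes "peels crd S r w"
  shows "\<exists>ps. pin_coding' ps (rev w) \<and> set ps = S \<and> distinct ps \<and>
    (\<forall>e. r = Some e \<longrightarrow> ps \<noteq> [] \<and> leads e (hd w) \<and> extremal crd e (last ps) S)"
  using assms
proof (induction w arbitrary: S r)
  case Nil
  then show ?case by (auto simp: pin_coding'_def)
next
  case (Cons l w)
  show ?case
  proof (cases l)
    case (Num k)
    obtain p where p: "p \<in> S" "\<forall>d\<in>quad_dirs k. extremal crd d p S"
      "\<forall>e. r = Some e \<longrightarrow> e \<in> quad_dirs k" "peels crd (S - {p}) None w"
      using Cons.prems Num by auto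
    obtain ps where ps: "pin_coding' ps (rev w)" "set ps = S - {p}" "distinct ps"
      using Cons.IH[OF p(4)] by blast
    have "pin_at' ps (rev w) p l"
      using p(2) ps(2) by (auto simp: Num extremal_def beyond_iff)
    then have "pin_coding' (ps @ [p]) (rev (l # w))"
      using pin_coding'_snoc ps(1) by simp
    then show ?thesis
      using ps p by (intro exI[of _ "ps @ [p]"]) (auto simp: Num leads_def)
  next
    case (Dir d)
    obtain p e where p: "p \<in> S" "extremal crd d p S" "\<forall>e. r = Some e \<longrightarrow> e = d"
       "perp e d" "cuts_off crd e p S" "peels crd (S - {p}) (Some e) w"
      using Cons.prems Dir by auto
    obtain ps where ps: "pin_coding' ps (rev w)" "set ps = S - {p}" "distinct ps" "ps \<noteq> []"
        "leads e (hd w)" "extremal crd e (last ps) (S - {p})"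
      using Cons.IH[OF p(6)] by blast
    obtain q where q: "q \<in> S" "crd e p < crd e q" "\<forall>z\<in>S - {p, q}. crd e z < crd e p"
      using p(5) unfolding cuts_off_def by blast
    have last: "last ps \<in> S - {p}" using ps(2,4) last_in_set by blast
    \<comment> \<open>Otherwise \<open>last ps\<close> would lie before the line of \<open>p\<close>
      in direction \<open>e\<close>, and yet beyond \<open>q\<close>, which lies behind that
      line.\<close>
    have l: "last ps = q"
    proof (rule ccontr)
      assume ne: "last ps \<noteq> q"
      have "q \<in> S - {p} - {last ps}" using q(1,2) ne by auto
      then have "crd e q < crd e (last ps)" using ps(6) unfolding extremal_def by blast
      moreover have "crd e (last ps) < crd e p" using q(3) last ne by blast
      ultimately show False using q(2) by simp
    qed
    have "distinct (butlast ps @ [last ps])" using ps(3,4) by simp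
    then have "q \<notin> set (butlast ps)" using l by simp
    then have "set (butlast ps) \<subseteq> S - {p, q}"
      using ps(2) by (auto dest: in_set_butlastD)
    moreover have "w \<noteq> []" using p(6) by auto
    ultimately have "\<forall>z\<in>set (butlast ps). crd e z < crd e p" "leads e (last (rev w))"
      using q(3) ps(5) by (blast, simp add: last_rev)
    moreover have "beyond d p (set ps)" using p(2) ps(2) unfolding extremal_def beyond_iff by blast
    ultimately have "pin_at' ps (rev w) p l"
      unfolding Dir pin_at'.simps using ps(4) p(4) q(2) l by blast
    then have "pin_coding' (ps @ [p]) (rev (l # w))"
      using pin_coding'_snoc ps(1) by simp
    then show ?thesis
      using ps p by (intro exI[of _ "ps @ [p]"]) (auto simp: Dir leads_def)
  qed
qed

lemma take_1: "xs \<noteq> [] \<Longrightarrow> take 1 xs = [xs ! 0]"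
  by (cases xs) auto

text \<open>On each axis the origin is put half a unit from a reference pin, on the side opposite to
  the quadrant \<open>k\<close>. For pins with integer coordinates half a unit meets no line through
  another pin and makes both coordinates of the origin new.\<close>

lemma offset_point:
  fixes g :: "bool \<Rightarrow> point"
  shows "\<exists>p0. \<forall>d. crd d p0 = crd d (g (vert d)) - (if d \<in> quad_dirs k then 1/2 else -1/2)"
proof -
  define hx where "hx = (if Right \<in> quad_dirs k then 1/2 else -1/2 :: real)"
  define hy where "hy = (if Up \<in> quad_dirs k then 1/2 else -1/2 :: real)"
  show ?thesis
  proof (intro exI allI)
    fix d
    show "crd d (fst (g False) - hx, snd (g True) - hy) =
        crd d (g (vert d)) - (if d \<in> quad_dirs k then 1/2 else -1/2)"
      by (cases d; cases k) (auto simp: hx_def hy_def)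
  qed
qed

text \<open>The origin may be placed next to \<open>p\<^sub>1\<close>, except that it is next to the vertical or horizontal
  line through \<open>p\<^sub>2\<close> when \<open>p\<^sub>2\<close> is encoded by a direction.\<close>

lemma pin_coding'_origin:
  assumes pc: "pin_coding' ps w" and gen: "generic ps"
    and ints: "\<forall>z\<in>set ps. fst z \<in> \<int> \<and> snd z \<in> \<int>"
  shows "\<exists>p0. generic (p0 # ps) \<and> pin_coding p0 ps w"
proof (cases "ps = []")
  case True
  then show ?thesis using pc by (auto simp: pin_coding_def pin_coding'_def generic_def)
next
  case False
  have at: "pin_at' (take i ps) (take i w) (ps ! i) (w ! i)" if "i < length ps" for i
    using pc that unfolding pin_coding'_def by blast
  have len: "length w = length ps" using pc unfolding pin_coding'_def by blast
  obtain k where k: "w ! 0 = Num k" using at[of 0] False by (cases "w ! 0") auto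
  define g where "g = (\<lambda>b. if 2 \<le> length ps \<and> (\<exists>d. w ! 1 = Dir d \<and> vert d \<noteq> b) then ps ! 1 else ps ! 0)"
  obtain p0 where p0: "\<And>d. crd d p0 = crd d (g (vert d)) - (if d \<in> quad_dirs k then 1/2 else -1/2)"
    using offset_point[of g k] by blast
  have gin: "g b \<in> set ps" for b using False by (auto simp: g_def)
  have int: "crd d z \<in> \<int>" if "z \<in> set ps" for z d
    using ints that by (cases d) auto
  have step: "crd d y + 1 \<le> crd d z" if yz: "crd d y < crd d z" "y \<in> set ps" "z \<in> set ps" for d y z
  proof -
    obtain a where a: "crd d y = of_int a" by (rule Ints_cases[OF int[OF yz(2), of d]])
    obtain b where b: "crd d z = of_int b" by (rule Ints_cases[OF int[OF yz(3), of d]])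
    have "a + 1 \<le> b" using yz(1) unfolding a b by simp
    then have "real_of_int (a + 1) \<le> real_of_int b" by (simp only: of_int_le_iff)
    then show ?thesis unfolding a b by simp
  qed
  \<comment> \<open>Between integer coordinates a strict inequality leaves a gap of at least 1,
    which exceeds the offset 1/2 of the origin.\<close>
  have near: "crd d p0 < crd d z" if "crd d (g (vert d)) < crd d z" "z \<in> set ps" for d z
    using step[OF that(1) gin that(2)] p0[of d] by (auto split: if_splits)
  have nint: "crd d p0 \<notin> \<int>" for d
  proof
    assume a: "crd d p0 \<in> \<int>"
    have "crd d (g (vert d)) \<in> \<int>" using int gin by blast
    then have "crd d (g (vert d)) - crd d p0 \<in> \<int>" using a by auto
    then have "(1/2::real) \<in> \<int> \<or> (-1/2::real) \<in> \<int>" unfolding p0 by (auto split: if_splits)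
    then have "(1/2::real) \<in> \<int>" using Ints_minus[of "-1/2::real"] by auto
    then obtain j :: int where "(1/2::real) = of_int j" by (auto elim: Ints_cases)
    then have "(1::real) = of_int (2 * j)" by simp
    then have "1 = 2 * j" by linarith
    then show False by presburger
  qed
  have "generic (p0 # ps)"
    unfolding generic_def
  proof (intro allI impI, elim conjE)
    fix i j assume ij: "i < j" "j < length (p0 # ps)"
    then obtain j' where j': "j = Suc j'" "j' < length ps" by (cases j) auto
    show "fst ((p0 # ps) ! i) \<noteq> fst ((p0 # ps) ! j) \<and> snd ((p0 # ps) ! i) \<noteq> snd ((p0 # ps) ! j)"
    proof (cases i)
      case 0
      have "fst p0 \<notin> \<int>" "snd p0 \<notin> \<int>" using nint[of Right] nint[of Up] by auto
      moreover have "fst (ps ! j') \<in> \<int>" "snd (ps ! j') \<in> \<int>" using ints j' by auto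
      ultimately show ?thesis using 0 j' by auto
    next
      case (Suc i')
      then show ?thesis using gen ij j' unfolding generic_def by auto
    qed
  qed
  moreover have "pin_at (p0 # take i ps) (ps ! i) (w ! i)" if i: "i < length ps" for i
  proof -
    consider (0) "i = 0" | (1) "i = 1" | (2) "2 \<le> i" by linarith
    then show ?thesis
    proof cases
      case 0
      have "crd d p0 < crd d (ps ! 0)" if d: "d \<in> quad_dirs k" for d
      proof (cases "g (vert d) = ps ! 0")
        case True
        then show ?thesis using p0[of d] d by simp
      next
        \<comment> \<open>On this axis the reference is the second pin. It cuts off the first one in
          direction \<open>d\<close>, so the origin next to it is still before the first
          pin.\<close>
        case g: False
        then obtain d1 where d1: "2 \<le> length ps" "w ! 1 = Dir d1" "vert d1 \<noteq> vert d" "g (vert d) = ps ! 1"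
          unfolding g_def by (auto split: if_splits)
        have t1: "take 1 ps = [ps ! 0]" "take 1 w = [w ! 0]"
          using d1(1) len take_1[of ps] take_1[of w] by fastforce+
        obtain e where e: "perp e d1" "crd e (ps ! 1) < crd e (ps ! 0)" "leads e (w ! 0)"
          using at[of 1] d1(1,2) t1 by auto
        have "e \<in> quad_dirs k" using e(3) k by (auto simp: leads_def)
        moreover have "vert e = vert d" using e(1) d1(3) unfolding perp_def by blast
        ultimately have "e = d" using quad_dirs_vert_unique d by blast
        then show ?thesis using e(2) d1(4) p0[of d] d by simp
      qed
      then show ?thesis using 0 k by (simp add: beyond_iff)
    next
      case 1
      have t1: "take 1 ps = [ps ! 0]" "take 1 w = [w ! 0]"
        using i 1 len take_1[of ps] take_1[of w] by fastforce+
      have in1: "ps ! 1 \<in> set ps" using i 1 by simp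
      have a: "pin_at' [ps ! 0] [w ! 0] (ps ! 1) (w ! 1)" using at[OF i] 1 t1 by simp
      show ?thesis
      proof (cases "w ! 1")
        case (Num k')
        then have "g b = ps ! 0" for b by (simp add: g_def)
        then show ?thesis using a near[OF _ in1] 1 t1 Num by (auto simp: beyond_iff)
      next
        case (Dir d)
        obtain e where e: "perp e d" "crd e (ps ! 1) < crd e (ps ! 0)" "leads e (w ! 0)"
          and b: "crd d (ps ! 0) < crd d (ps ! 1)"
          using a Dir by (auto simp: beyond_iff)
        have "g (vert d) = ps ! 0" using Dir by (simp add: g_def)
        then have "crd d p0 < crd d (ps ! 1)" using near[OF _ in1] b by simp
        moreover have "g (vert e) = ps ! 1"
          using Dir i 1 e(1) by (simp add: g_def perp_def; blast)
        then have "crd e p0 < crd e (ps ! 1)"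
          using e(3) k p0[of e] by (auto simp: leads_def)
        ultimately show ?thesis
          using 1 t1 Dir e b by (auto simp: beyond_iff intro!: exI[of _ e])
      qed
    next
      case 2
      have pi: "ps ! i \<in> set ps" using i by simp
      have nz: "take i ps \<noteq> []" using 2 i by auto
      have in01: "ps ! 0 \<in> set (take i ps)" "ps ! 1 \<in> set (take i ps)"
        using 2 i by (auto simp: in_set_conv_nth intro: exI[of _ 0] exI[of _ 1])
      have g01: "g b = ps ! 0 \<or> g b = ps ! 1" for b by (auto simp: g_def)
      have bey: "beyond d (ps ! i) (set (p0 # take i ps))" if "beyond d (ps ! i) (set (take i ps))" for d
        using that in01 g01[of "vert d"] near[OF _ pi, of d] unfolding beyond_iff by auto
      show ?thesis
      proof (cases "w ! i")
        case (Num k')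
        then show ?thesis using at[OF i] bey by auto
      next
        case (Dir d)
        obtain e where e: "perp e d" "crd e (ps ! i) < crd e (last (take i ps))"
            "\<forall>z\<in>set (butlast (take i ps)). crd e z < crd e (ps ! i)" "leads e (last (take i w))"
          and b: "beyond d (ps ! i) (set (take i ps))"
          using at[OF i] Dir by auto
        have bl: "butlast (take i ps) = take (i - 1) ps"
          using i by (simp add: butlast_take)
        \<comment> \<open>The third pin cuts off the second, so the second must not be the reference
          on the axis of \<open>e\<close>. Indeed, if the second pin is encoded by a direction, then
          this direction is \<open>e\<close>, and on its own axis the reference is the first
          pin.\<close>
        have "crd e (g (vert e)) < crd e (ps ! i)"
        proof (cases "i = 2")
          case True
          have "last (take i w) = w ! 1"
            using True i len by (simp add: take_Suc_conv_app_nth numeral_2_eq_2)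
          then have "g (vert e) = ps ! 0" using e(4) by (auto simp: g_def leads_def)
          moreover have "ps ! 0 \<in> set (butlast (take i ps))"
            unfolding bl using True i by (auto simp: in_set_conv_nth intro: exI[of _ 0])
          ultimately show ?thesis using e(3) by auto
        next
          case False
          then have "ps ! 0 \<in> set (butlast (take i ps))" "ps ! 1 \<in> set (butlast (take i ps))"
            unfolding bl using 2 i by (auto simp: in_set_conv_nth intro: exI[of _ 0] exI[of _ 1])
          then show ?thesis using e(3) g01[of "vert e"] by auto
        qed
        then have "crd e p0 < crd e (ps ! i)" using near[OF _ pi] by blast
        then have "\<forall>z\<in>set (butlast (p0 # take i ps)). crd e z < crd e (ps ! i)"
          using e(3) nz by auto
        then show ?thesis
          unfolding Dir pin_at.simps using bey[OF b] e nz 2 i by (intro conjI exI[of _ e]) auto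
      qed
    qed
  qed
  ultimately show ?thesis using len unfolding pin_coding_def by blast
qed

section \<open>Transport from points of the plane to positions of the permutation\<close>

lemma peels_transport:
  assumes "peels c S r w" "bij_betw f S T"
    and "\<And>d p q. p \<in> S \<Longrightarrow> q \<in> S \<Longrightarrow> c d p < c d q \<longleftrightarrow> c' d (f p) < c' d (f q)"
  shows "peels c' T r w"
  using assms
proof (induction w arbitrary: S T r)
  case Nil
  then show ?case by (simp add: bij_betw_def)
next
  case (Cons l w)
  have T: "T = f ` S" and inj: "inj_on f S" using Cons.prems(2) by (auto simp: bij_betw_def)
  have del: "bij_betw f (S - {p}) (T - {f p})" if "p \<in> S" for p
    using that inj unfolding T bij_betw_def by (auto simp: inj_on_def)
  have ext: "extremal c' d (f p) T" if "p \<in> S" "extremal c d p S" for d p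
    using that Cons.prems(3) unfolding extremal_def T by auto
  have cut: "cuts_off c' e (f p) T" if p: "p \<in> S" and cut: "cuts_off c e p S" for e p
  proof -
    obtain q where q: "q \<in> S" "c e p < c e q" "\<forall>z\<in>S - {p, q}. c e z < c e p"
      using cut unfolding cuts_off_def by blast
    then show ?thesis
      unfolding cuts_off_def using Cons.prems(3) p by (intro bexI[of _ "f q"]) (auto simp: T)
  qed
  have IH: "peels c' (T - {f p}) r' w" if "p \<in> S" "peels c (S - {p}) r' w" for p r'
    using Cons.IH[OF that(2) del[OF that(1)]] Cons.prems(3) by auto
  show ?case
  proof (cases l)
    case (Num k)
    then obtain p where "p \<in> S" "\<forall>d\<in>quad_dirs k. extremal c d p S"
      "\<forall>e. r = Some e \<longrightarrow> e \<in> quad_dirs k" "peels c (S - {p}) None w"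
      using Cons.prems(1) by auto
    then show ?thesis
      unfolding Num peels.simps using ext IH T by (intro bexI[of _ "f p"]) auto
  next
    case (Dir d)
    then obtain p e where "p \<in> S" "extremal c d p S" "\<forall>e. r = Some e \<longrightarrow> e = d"
       "perp e d" "cuts_off c e p S" "peels c (S - {p}) (Some e) w"
      using Cons.prems(1) by auto
    then show ?thesis
      unfolding Dir peels.simps using ext IH cut T
      by (intro bexI[of _ "f p"] conjI exI[of _ e]) auto
  qed
qed

text \<open>Positions are counted from 0 while the permutation acts on \<open>{1..n}\<close>. The
  abscissa is thus one less than in the diagram, which affects no comparison.\<close>

definition perm_crd :: "(nat \<Rightarrow> nat) \<Rightarrow> dir \<Rightarrow> nat \<Rightarrow> real" where
  "perm_crd \<pi> d i = crd d (real i, real (\<pi> (Suc i)))"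

lemma pin_words_peels:
  assumes "\<pi> permutes {1..n}"
  shows "w \<in> pin_words n \<pi> \<longleftrightarrow> peels (perm_crd \<pi>) {0..<n} None (rev w)"
proof -
  define h where "h = (\<lambda>i. (real (Suc i), real (\<pi> (Suc i))))"
  have bij: "bij_betw h {0..<n} (diagram n \<pi>)"
  proof -
    have "{1..n} = Suc ` {0..<n}" by (simp add: image_Suc_atLeastLessThan atLeastLessThanSuc_atLeastAtMost)
    then have "diagram n \<pi> = h ` {0..<n}" unfolding diagram_def h_def by (simp only: image_image)
    moreover have "inj_on h {0..<n}" by (auto simp: inj_on_def h_def)
    ultimately show ?thesis by (simp add: bij_betw_def)
  qed
  have ord: "perm_crd \<pi> d i < perm_crd \<pi> d j \<longleftrightarrow> crd d (h i) < crd d (h j)" for d i j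
    by (cases d) (auto simp: perm_crd_def h_def)
  have eq: "peels (perm_crd \<pi>) {0..<n} None v \<longleftrightarrow> peels crd (diagram n \<pi>) None v" for v
  proof
    show "peels (perm_crd \<pi>) {0..<n} None v \<Longrightarrow> peels crd (diagram n \<pi>) None v"
      by (erule peels_transport[OF _ bij]) (rule ord)
    have inv: "h (inv_into {0..<n} h p) = p" if "p \<in> diagram n \<pi>" for p
      using that by (rule bij_betw_inv_into_right[OF bij])
    show "peels crd (diagram n \<pi>) None v \<Longrightarrow> peels (perm_crd \<pi>) {0..<n} None v"
      by (erule peels_transport[OF _ bij_betw_inv_into[OF bij]]) (simp add: ord inv)
  qed
  show ?thesis
  proof
    assume "w \<in> pin_words n \<pi>"
    then obtain p0 ps where iso: "order_isomorphic (set ps) (diagram n \<pi>)"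
      and "generic (p0 # ps)" "pin_coding p0 ps w"
      unfolding pin_words_iff by blast
    then have p: "peels crd (set ps) None (rev w)" using pin_coding_peels by blast
    obtain f where f: "bij_betw f (set ps) (diagram n \<pi>)"
      "\<forall>p\<in>set ps. \<forall>q\<in>set ps. (fst p < fst q \<longleftrightarrow> fst (f p) < fst (f q)) \<and>
                      (snd p < snd q \<longleftrightarrow> snd (f p) < snd (f q))"
      using iso unfolding order_isomorphic_def by blast
    have f': "crd d p < crd d q \<longleftrightarrow> crd d (f p) < crd d (f q)" if "p \<in> set ps" "q \<in> set ps" for d p q
      using f(2) that by (cases d) auto
    show "peels (perm_crd \<pi>) {0..<n} None (rev w)"
      unfolding eq by (rule peels_transport[OF p f(1)]) (rule f')
  next
    assume "peels (perm_crd \<pi>) {0..<n} None (rev w)"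
    then obtain ps where ps: "pin_coding' ps w" "set ps = diagram n \<pi>" "distinct ps"
      unfolding eq using peels_pin_coding'[of "diagram n \<pi>" None "rev w"] by auto
    have inj: "fst p \<noteq> fst q \<and> snd p \<noteq> snd q"
      if pq: "p \<in> diagram n \<pi>" "q \<in> diagram n \<pi>" "p \<noteq> q" for p q
    proof -
      obtain i j where ij: "p = (real i, real (\<pi> i))" "q = (real j, real (\<pi> j))"
        using pq(1,2) unfolding diagram_def by blast
      then have "i \<noteq> j" using pq(3) by blast
      then have "\<pi> i \<noteq> \<pi> j" using permutes_inj[OF assms] by (simp add: inj_eq)
      then show ?thesis using \<open>i \<noteq> j\<close> unfolding ij by simp
    qed
    have "generic ps"
      unfolding generic_def
    proof (intro allI impI, elim conjE)
      fix i j assume ij: "i < j" "j < length ps"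
      then have "ps ! i \<in> diagram n \<pi>" "ps ! j \<in> diagram n \<pi>"
        using ps(2) nth_mem[of _ ps] by simp_all
      moreover have "ps ! i \<noteq> ps ! j" using ij ps(3) by (simp add: nth_eq_iff_index_eq)
      ultimately show "fst (ps ! i) \<noteq> fst (ps ! j) \<and> snd (ps ! i) \<noteq> snd (ps ! j)"
        by (rule inj)
    qed
    moreover have "\<forall>z\<in>set ps. fst z \<in> \<int> \<and> snd z \<in> \<int>"
      unfolding ps(2) diagram_def by auto
    ultimately obtain p0 where "generic (p0 # ps)" "pin_coding p0 ps w"
      using pin_coding'_origin[OF ps(1)] by blast
    moreover have "order_isomorphic (set ps) (diagram n \<pi>)"
      unfolding order_isomorphic_def ps(2) by (intro exI[of _ id]) auto
    ultimately show "w \<in> pin_words n \<pi>" unfolding pin_words_iff by blast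
  qed
qed

lemma perm_lang_iff_accepts:
  assumes "\<pi> permutes {1..n}"
  shows "v \<in> rev ` perm_lang n \<pi> \<longleftrightarrow> peel_accepts (perm_crd \<pi>) (Peel {0..<n} None) v"
proof -
  have "v \<in> rev ` perm_lang n \<pi> \<longleftrightarrow> rev v \<in> perm_lang n \<pi>"
    by (auto intro: image_eqI[of _ _ "rev v"])
  then show ?thesis
    unfolding accepts_iff_word_lang perm_lang_def using pin_words_peels[OF assms] by auto
qed

section \<open>Strips\<close>

text \<open>As coordinates are distinct, being extremal means that 0 points are further out, and
  cutting off means that exactly 1 point is. In the vertical directions these are the counts that
  the machine evaluates.\<close>

definition above :: "(nat \<Rightarrow> nat) \<Rightarrow> nat \<Rightarrow> nat set \<Rightarrow> nat" where
  "above \<pi> p S = card {j\<in>S. \<pi> (Suc p) < \<pi> (Suc j)}"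

definition below :: "(nat \<Rightarrow> nat) \<Rightarrow> nat \<Rightarrow> nat set \<Rightarrow> nat" where
  "below \<pi> p S = card {j\<in>S. \<pi> (Suc j) < \<pi> (Suc p)}"

lemma extremal_card:
  fixes c :: "dir \<Rightarrow> 'a \<Rightarrow> real"
  assumes "finite S" "inj_on (c d) S" "p \<in> S"
  shows "extremal c d p S \<longleftrightarrow> card {j\<in>S. c d p < c d j} = 0"
proof -
  have "extremal c d p S \<longleftrightarrow> {j\<in>S. c d p < c d j} = {}"
  proof
    assume ext: "extremal c d p S"
    have "\<not> c d p < c d j" if "j \<in> S" for j
    proof (cases "j = p")
      case False
      then have "c d j < c d p" using ext that unfolding extremal_def by blast
      then show ?thesis by simp
    qed simp
    then show "{j\<in>S. c d p < c d j} = {}" by blast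
  next
    assume none: "{j\<in>S. c d p < c d j} = {}"
    show "extremal c d p S"
      unfolding extremal_def
    proof
      fix q assume q: "q \<in> S - {p}"
      then have "\<not> c d p < c d q" using none by blast
      moreover have "c d q \<noteq> c d p" using inj_onD[OF assms(2), of q p] q assms(3) by auto
      ultimately show "c d q < c d p" by simp
    qed
  qed
  then show ?thesis using assms(1) by simp
qed

lemma cuts_off_card:
  fixes c :: "dir \<Rightarrow> 'a \<Rightarrow> real"
  assumes "finite S" "inj_on (c d) S" "p \<in> S"
  shows "cuts_off c d p S \<longleftrightarrow> card {j\<in>S. c d p < c d j} = 1"
proof -
  have "cuts_off c d p S \<longleftrightarrow> (\<exists>q. {j\<in>S. c d p < c d j} = {q})"
  proof
    assume "cuts_off c d p S"
    then obtain q where q: "q \<in> S" "c d p < c d q" "\<forall>z\<in>S - {p, q}. c d z < c d p"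
      unfolding cuts_off_def by blast
    have "j = q" if j: "j \<in> S" "c d p < c d j" for j
    proof (rule ccontr)
      assume "j \<noteq> q"
      moreover have "j \<noteq> p" using j(2) by auto
      ultimately have "c d j < c d p" using q(3) j(1) by blast
      then show False using j(2) by simp
    qed
    then have "{j\<in>S. c d p < c d j} = {q}" using q(1,2) by blast
    then show "\<exists>q. {j\<in>S. c d p < c d j} = {q}" ..
  next
    assume "\<exists>q. {j\<in>S. c d p < c d j} = {q}"
    then obtain q where q: "{j\<in>S. c d p < c d j} = {q}" ..
    have "c d z < c d p" if z: "z \<in> S - {p, q}" for z
    proof -
      have "z \<notin> {j\<in>S. c d p < c d j}" using z unfolding q by simp
      then have "\<not> c d p < c d z" using z by simp
      moreover have "c d z \<noteq> c d p" using inj_onD[OF assms(2), of z p] z assms(3) by auto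
      ultimately show ?thesis by simp
    qed
    moreover have "q \<in> S" "c d p < c d q" using q by auto
    ultimately show "cuts_off c d p S" unfolding cuts_off_def by blast
  qed
  then show ?thesis by (simp add: card_1_singleton_iff)
qed

lemma perm_crd_simps [simp]:
  "perm_crd \<pi> Up i = real (\<pi> (Suc i))" "perm_crd \<pi> Down i = - real (\<pi> (Suc i))"
  "perm_crd \<pi> Right i = real i" "perm_crd \<pi> Left i = - real i"
  by (simp_all add: perm_crd_def)

context
  fixes \<pi> :: "nat \<Rightarrow> nat"
  assumes inj: "inj \<pi>"
begin

lemma perm_crd_inj: "inj_on (perm_crd \<pi> d) S"
  by (cases d) (auto simp: inj_on_def dest: injD[OF inj])

lemma extremal_Up: "finite S \<Longrightarrow> p \<in> S \<Longrightarrow> extremal (perm_crd \<pi>) Up p S \<longleftrightarrow> above \<pi> p S = 0"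
  and extremal_Down: "finite S \<Longrightarrow> p \<in> S \<Longrightarrow> extremal (perm_crd \<pi>) Down p S \<longleftrightarrow> below \<pi> p S = 0"
  by (simp_all add: extremal_card[OF _ perm_crd_inj] above_def below_def del: card_eq_0_iff card_0_eq)

lemma cuts_off_Up: "finite S \<Longrightarrow> p \<in> S \<Longrightarrow> cuts_off (perm_crd \<pi>) Up p S \<longleftrightarrow> above \<pi> p S = 1"
  and cuts_off_Down: "finite S \<Longrightarrow> p \<in> S \<Longrightarrow> cuts_off (perm_crd \<pi>) Down p S \<longleftrightarrow> below \<pi> p S = 1"
  by (simp_all add: cuts_off_card[OF _ perm_crd_inj] above_def below_def)

end

section \<open>Horizontal conditions in an interval of positions\<close>

lemma extremal_Left_strip:
  assumes "p \<in> {a..<b}"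
  shows "extremal (perm_crd \<pi>) Left p {a..<b} \<longleftrightarrow> p = a"
proof
  assume ext: "extremal (perm_crd \<pi>) Left p {a..<b}"
  show "p = a"
  proof (rule ccontr)
    assume "p \<noteq> a"
    then have "a \<in> {a..<b} - {p}" using assms by auto
    then have "p < a" using ext unfolding extremal_def by force
    then show False using assms by simp
  qed
qed (auto simp: extremal_def)

lemma extremal_Right_strip:
  assumes "p \<in> {a..<b}"
  shows "extremal (perm_crd \<pi>) Right p {a..<b} \<longleftrightarrow> p = b - 1"
proof
  assume ext: "extremal (perm_crd \<pi>) Right p {a..<b}"
  show "p = b - 1"
  proof (rule ccontr)
    assume "p \<noteq> b - 1"
    then have "b - 1 \<in> {a..<b} - {p}" using assms by auto
    then have "b - 1 < p" using ext unfolding extremal_def by force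
    moreover have "p < b" using assms by simp
    ultimately show False by arith
  qed
qed (auto simp: extremal_def)

lemma cuts_off_Left_strip:
  assumes "p \<in> {a..<b}"
  shows "cuts_off (perm_crd \<pi>) Left p {a..<b} \<longleftrightarrow> p = a + 1"
proof
  assume "cuts_off (perm_crd \<pi>) Left p {a..<b}"
  then obtain q where q: "q \<in> {a..<b}" "q < p" and z: "z \<in> {a..<b} - {p, q} \<Longrightarrow> p < z" for z
    unfolding cuts_off_def by auto
  have "q = a"
  proof (rule ccontr)
    assume "q \<noteq> a"
    then have "p < a" using z[of a] q assms by simp
    then show False using assms by simp
  qed
  moreover have "\<not> a + 1 < p"
  proof
    assume "a + 1 < p"
    then have "p < a + 1" using z[of "a + 1"] assms \<open>q = a\<close> by simp
    then show False using \<open>a + 1 < p\<close> by simp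
  qed
  ultimately show "p = a + 1" using q by simp
next
  assume "p = a + 1"
  then show "cuts_off (perm_crd \<pi>) Left p {a..<b}"
    unfolding cuts_off_def using assms by (intro bexI[of _ a]) auto
qed

lemma cuts_off_Right_strip:
  assumes "p \<in> {a..<b}"
  shows "cuts_off (perm_crd \<pi>) Right p {a..<b} \<longleftrightarrow> p + 2 = b"
proof
  assume "cuts_off (perm_crd \<pi>) Right p {a..<b}"
  then obtain q where q: "q \<in> {a..<b}" "p < q" and z: "z \<in> {a..<b} - {p, q} \<Longrightarrow> z < p" for z
    unfolding cuts_off_def by auto
  have q1: "q = b - 1"
  proof (rule ccontr)
    assume "q \<noteq> b - 1"
    moreover have "q < b" "a \<le> p" using q(1) assms by simp_all
    ultimately have "b - 1 \<in> {a..<b} - {p, q}" using q(2) by auto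
    then have "b - 1 < p" by (rule z)
    then show False using \<open>q < b\<close> q(2) by arith
  qed
  moreover have "\<not> p + 1 < q"
  proof
    assume "p + 1 < q"
    then have "p + 1 < p" using z[of "p + 1"] assms q by simp
    then show False by simp
  qed
  ultimately show "p + 2 = b" using q by simp
next
  assume "p + 2 = b"
  then show "cuts_off (perm_crd \<pi>) Right p {a..<b}"
    unfolding cuts_off_def using assms by (intro bexI[of _ "p + 1"]) auto
qed

text \<open>When \<open>a + 1\<close> (resp. \<open>b - 2\<close>) has been peeled from the strip \<open>{a..<b}\<close> by a vertical pin,
  the point cut off by it has to be peeled next.\<close>

fun cell_state :: "nat \<times> nat \<times> nat \<Rightarrow> nat peel_state" where
  "cell_state (a, b, c) =
    (if c = 0 then Peel {a..<b} None
     else if c = 1 then Peel {a..<b} (Some Up)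
     else if c = 2 then Peel {a..<b} (Some Down)
     else if c = 3 then Peel (insert a {a + 2..<b}) (Some Left)
     else if c = 4 then Peel (insert (b - 1) {a..<b - 2}) (Some Right)
     else if c = 5 then Pend {a..<b} Up
     else if c = 6 then Pend {a..<b} Down
     else if c = 7 then Pend {a..<b} Left
     else Pend {a..<b} Right)"

text \<open>This numbers the counts on which transitions depend: 1 to 4 concern the ends of the
  strip, 5 to 8 their neighbours, and 9 to 12 the isolated end of a strip with a gap, counted in the
  part behind the gap. Number 0 is a constant, so that a row with \<open>m = 0\<close> carries no
  condition on heights.\<close>

fun rank :: "(nat \<Rightarrow> nat) \<Rightarrow> nat \<Rightarrow> nat \<Rightarrow> nat \<Rightarrow> nat" where
  "rank \<pi> a b r =
    (if r = 0 then 0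
     else if r = 1 then above \<pi> a {a..<b}
     else if r = 2 then below \<pi> a {a..<b}
     else if r = 3 then above \<pi> (b - 1) {a..<b}
     else if r = 4 then below \<pi> (b - 1) {a..<b}
     else if r = 5 then above \<pi> (a + 1) {a..<b}
     else if r = 6 then below \<pi> (a + 1) {a..<b}
     else if r = 7 then above \<pi> (b - 2) {a..<b}
     else if r = 8 then below \<pi> (b - 2) {a..<b}
     else if r = 9 then above \<pi> a {a + 2..<b}
     else if r = 10 then below \<pi> a {a + 2..<b}
     else if r = 11 then above \<pi> (b - 1) {a..<b - 2}
     else below \<pi> (b - 1) {a..<b - 2})"

text \<open>Peeling an end of a full strip moves a bound by one. Peeling the isolated end moves it
  by two, past the gap. When a gap arises, both bounds stay and only the kind of the state
  changes.\<close>

fun shift_cell :: "nat \<Rightarrow> nat \<Rightarrow> nat \<Rightarrow> nat \<times> nat" where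
  "shift_cell s a b =
    (if s = 0 then (a, b) else if s = 1 then (a + 1, b) else if s = 2 then (a, b - 1)
     else if s = 3 then (a + 2, b) else (a, b - 2))"

lemma cell_state_simps:
  "cell_state (a, b, 0) = Peel {a..<b} None"
  "cell_state (a, b, Suc 0) = Peel {a..<b} (Some Up)"
  "cell_state (a, b, 2) = Peel {a..<b} (Some Down)"
  "cell_state (a, b, 3) = Peel (insert a {a + 2..<b}) (Some Left)"
  "cell_state (a, b, 4) = Peel (insert (b - 1) {a..<b - 2}) (Some Right)"
  "cell_state (a, b, 5) = Pend {a..<b} Up"
  "cell_state (a, b, 6) = Pend {a..<b} Down"
  "cell_state (a, b, 7) = Pend {a..<b} Left"
  "cell_state (a, b, 8) = Pend {a..<b} Right"
  by simp_all

lemma rank_simps: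
  "rank \<pi> a b 0 = 0"
  "rank \<pi> a b (Suc 0) = above \<pi> a {a..<b}"
  "rank \<pi> a b 2 = below \<pi> a {a..<b}"
  "rank \<pi> a b 3 = above \<pi> (b - 1) {a..<b}"
  "rank \<pi> a b 4 = below \<pi> (b - 1) {a..<b}"
  "rank \<pi> a b 5 = above \<pi> (a + 1) {a..<b}"
  "rank \<pi> a b 6 = below \<pi> (a + 1) {a..<b}"
  "rank \<pi> a b 7 = above \<pi> (b - 2) {a..<b}"
  "rank \<pi> a b 8 = below \<pi> (b - 2) {a..<b}"
  "rank \<pi> a b 9 = above \<pi> a {a + 2..<b}"
  "rank \<pi> a b 10 = below \<pi> a {a + 2..<b}"
  "rank \<pi> a b 11 = above \<pi> (b - 1) {a..<b - 2}"
  "rank \<pi> a b 12 = below \<pi> (b - 1) {a..<b - 2}"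
  by simp_all

lemma shift_cell_simps:
  "shift_cell 0 a b = (a, b)"
  "shift_cell (Suc 0) a b = (a + 1, b)"
  "shift_cell 2 a b = (a, b - 1)"
  "shift_cell 3 a b = (a + 2, b)"
  "shift_cell 4 a b = (a, b - 2)"
  by simp_all

declare cell_state.simps [simp del] rank.simps [simp del] shift_cell.simps [simp del]

text \<open>A row \<open>(k, r, m, c, d, h, c')\<close> is a transition by the letter \<open>d\<close> from the state of kind \<open>c\<close>
  at \<open>(a, b)\<close> to the state of kind \<open>c'\<close> at \<open>shift_cell h a b\<close>, present if \<open>a + k \<le> b\<close> and
  \<open>rank \<pi> a b r = m\<close>.\<close>

type_synonym row = "nat \<times> nat \<times> nat \<times> nat \<times> dir \<times> nat \<times> nat"

definition rows :: "row list" where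
  "rows =
   [(0, 0, 0, 0, Up, 0, 0), (0, 0, 0, 0, Down, 0, 0), (0, 0, 0, 0, Left, 0, 0), (0, 0, 0, 0, Right, 0, 0),
    (0, 0, 0, 5, Up, 0, 0), (0, 0, 0, 6, Down, 0, 0), (0, 0, 0, 7, Left, 0, 0), (0, 0, 0, 8, Right, 0, 0),
    (1, 1, 0, 0, Left, 1, 5), (1, 2, 0, 0, Left, 1, 6), (1, 1, 0, 0, Up, 1, 7), (1, 2, 0, 0, Down, 1, 7),
    (1, 3, 0, 0, Right, 2, 5), (1, 4, 0, 0, Right, 2, 6), (1, 3, 0, 0, Up, 2, 8), (1, 4, 0, 0, Down, 2, 8),
    (1, 1, 0, 1, Up, 1, 7), (1, 3, 0, 1, Up, 2, 8), (1, 2, 0, 2, Down, 1, 7), (1, 4, 0, 2, Down, 2, 8),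
    (1, 1, 1, 0, Left, 1, 1), (1, 2, 1, 0, Left, 1, 2), (1, 3, 1, 0, Right, 2, 1), (1, 4, 1, 0, Right, 2, 2),
    (2, 5, 0, 0, Up, 0, 3), (2, 7, 0, 0, Up, 0, 4), (2, 5, 0, 1, Up, 0, 3), (2, 7, 0, 1, Up, 0, 4),
    (2, 6, 0, 0, Down, 0, 3), (2, 8, 0, 0, Down, 0, 4), (2, 6, 0, 2, Down, 0, 3), (2, 8, 0, 2, Down, 0, 4),
    (2, 9, 0, 3, Left, 3, 5), (2, 10, 0, 3, Left, 3, 6), (2, 9, 1, 3, Left, 3, 1), (2, 10, 1, 3, Left, 3, 2),
    (2, 11, 0, 4, Right, 4, 5), (2, 12, 0, 4, Right, 4, 6), (2, 11, 1, 4, Right, 4, 1), (2, 12, 1, 4, Right, 4, 2)]"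

fun row_step :: "(nat \<Rightarrow> nat) \<Rightarrow> nat \<times> nat \<times> nat \<Rightarrow> dir \<Rightarrow> nat \<times> nat \<times> nat \<Rightarrow> bool" where
  "row_step \<pi> (a, b, c) x (a', b', c') \<longleftrightarrow> (\<exists>k r m h. (k, r, m, c, x, h, c') \<in> set rows \<and> a + k \<le> b \<and>
     rank \<pi> a b r = m \<and> shift_cell h a b = (a', b'))"

fun cell_ok :: "nat \<Rightarrow> nat \<times> nat \<times> nat \<Rightarrow> bool" where
  "cell_ok n (a, b, c) \<longleftrightarrow> a \<le> b \<and> b \<le> n \<and> c < 9 \<and> (c = 3 \<or> c = 4 \<longrightarrow> a + 2 \<le> b)"

text \<open>The guard \<open>k\<close> is always large enough for the points and strips named by
  \<open>r\<close> and \<open>h\<close> to exist, and a gap arises only in a strip of at least two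
  points.\<close>

lemma rows_ok:
  "(k, r, m, c, d, h, c') \<in> set rows \<Longrightarrow> c < 9 \<and> c' < 9 \<and> r \<le> 12 \<and> m \<le> 1 \<and> h \<le> 4 \<and>
     (c' = 3 \<or> c' = 4 \<longrightarrow> h = 0 \<and> k = 2) \<and> (h = 1 \<or> h = 2 \<longrightarrow> 1 \<le> k) \<and> (3 \<le> h \<longrightarrow> 2 \<le> k) \<and>
     k \<le> 2 \<and> (1 \<le> r \<longrightarrow> 1 \<le> k) \<and> (5 \<le> r \<longrightarrow> 2 \<le> k)"
proof -
  have "list_all (\<lambda>(k, r, m, c, d, h, c'). c < 9 \<and> c' < 9 \<and> r \<le> 12 \<and> m \<le> 1 \<and> h \<le> 4 \<and>
     (c' = 3 \<or> c' = 4 \<longrightarrow> h = 0 \<and> k = 2) \<and> (h = 1 \<or> h = 2 \<longrightarrow> 1 \<le> k) \<and> (3 \<le> h \<longrightarrow> 2 \<le> k) \<and>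
     k \<le> 2 \<and> (1 \<le> r \<longrightarrow> 1 \<le> k) \<and> (5 \<le> r \<longrightarrow> 2 \<le> k)) rows"
    unfolding rows_def by simp
  then show "(k, r, m, c, d, h, c') \<in> set rows \<Longrightarrow> ?thesis"
    unfolding list_all_iff by fast
qed

lemma row_step_ok:
  assumes "cell_ok n (a, b, c)" "row_step \<pi> (a, b, c) x (a', b', c')"
  shows "cell_ok n (a', b', c')"
proof -
  obtain k r m h where row: "(k, r, m, c, x, h, c') \<in> set rows" "a + k \<le> b" "shift_cell h a b = (a', b')"
    using assms(2) unfolding row_step.simps by blast
  have "h \<le> 4" and c': "c' < 9" "h \<noteq> 0 \<Longrightarrow> c' \<noteq> 3 \<and> c' \<noteq> 4" "c' = 3 \<or> c' = 4 \<Longrightarrow> k = 2"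
    and k: "h = 1 \<or> h = 2 \<Longrightarrow> 1 \<le> k" "h = 3 \<or> h = 4 \<Longrightarrow> 2 \<le> k"
    using rows_ok[OF row(1)] by auto
  have ab: "a \<le> b" "b \<le> n" using assms(1) by simp_all
  consider "h = 0" | "h = 1" | "h = 2" | "h = 3" | "h = 4" using \<open>h \<le> 4\<close> by linarith
  then show ?thesis
  proof cases
    case 1
    then have eq: "a' = a" "b' = b" using row(3) by (simp_all add: shift_cell.simps)
    have "a + 2 \<le> b" if "c' = 3 \<or> c' = 4" using c'(3)[OF that] row(2) by simp
    then show ?thesis using ab c'(1) eq by simp
  next
    case 2
    then have "a' = a + 1" "b' = b" using row(3) by (simp_all add: shift_cell.simps)
    then show ?thesis using ab 2 c' k(1) row(2) by simp
  next
    case 3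
    then have eq: "a' = a" "b' = b - 1" using row(3) by (simp_all add: shift_cell.simps)
    have "1 \<le> k" using k(1) 3 by simp
    then have "a \<le> b - 1" "b - 1 \<le> n" using row(2) ab by linarith+
    then show ?thesis unfolding eq using 3 c'(1,2) by simp
  next
    case 4
    then have "a' = a + 2" "b' = b" using row(3) by (simp_all add: shift_cell.simps)
    then show ?thesis using ab 4 c' k(2) row(2) by simp
  next
    case 5
    then have eq: "a' = a" "b' = b - 2" using row(3) by (simp_all add: shift_cell.simps)
    have "2 \<le> k" using k(2) 5 by simp
    then have "a \<le> b - 2" "b - 2 \<le> n" using row(2) ab by linarith+
    then show ?thesis unfolding eq using 5 c'(1,2) by simp
  qed
qed

lemma ex_perp:
  "(\<exists>y. perp y Up \<and> P y) \<longleftrightarrow> P Left \<or> P Right" "(\<exists>y. perp y Down \<and> P y) \<longleftrightarrow> P Left \<or> P Right"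
  "(\<exists>y. perp y Left \<and> P y) \<longleftrightarrow> P Up \<or> P Down" "(\<exists>y. perp y Right \<and> P y) \<longleftrightarrow> P Up \<or> P Down"
proof -
  have "perp y Up \<longleftrightarrow> y = Left \<or> y = Right" "perp y Down \<longleftrightarrow> y = Left \<or> y = Right"
    "perp y Left \<longleftrightarrow> y = Up \<or> y = Down" "perp y Right \<longleftrightarrow> y = Up \<or> y = Down" for y
    by (cases y; simp add: perp_def)+
  then show "(\<exists>y. perp y Up \<and> P y) \<longleftrightarrow> P Left \<or> P Right" "(\<exists>y. perp y Down \<and> P y) \<longleftrightarrow> P Left \<or> P Right"
    "(\<exists>y. perp y Left \<and> P y) \<longleftrightarrow> P Up \<or> P Down" "(\<exists>y. perp y Right \<and> P y) \<longleftrightarrow> P Up \<or> P Down"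
    by (simp_all add: conj_disj_distribR ex_disj_distrib)
qed


text \<open>This is the part of a step common to all remembered directions; such a direction merely
  restricts the letter and excludes the loop.\<close>

definition peels_to :: "(dir \<Rightarrow> 'a \<Rightarrow> real) \<Rightarrow> 'a set \<Rightarrow> dir \<Rightarrow> 'a peel_state \<Rightarrow> bool" where
  "peels_to c S x t \<longleftrightarrow> (\<exists>p\<in>S. extremal c x p S \<and> (\<exists>y. perp y x \<and>
     (extremal c y p S \<and> t = Pend (S - {p}) y \<or> cuts_off c y p S \<and> t = Peel (S - {p}) (Some y))))"

lemma peel_step_Peel:
  "peel_step c (Peel S None) x t \<longleftrightarrow> t = Peel S None \<or> peels_to c S x t"
  "peel_step c (Peel S (Some e)) x t \<longleftrightarrow> e = x \<and> peels_to c S x t"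
  unfolding peels_to_def by (simp, simp, blast)

text \<open>The topmost or lowest point may have any position. But the second condition on the pin
  is horizontal and fixes the position: an end of the strip for a numeral, the second or the last
  but one for a direction. This is why the remaining sets stay within a quadratic family.\<close>

lemma peels_to_vertical:
  assumes "d = Up \<or> d = Down"
  shows "peels_to (perm_crd \<pi>) {a..<b} d t \<longleftrightarrow>
    a + 1 \<le> b \<and> extremal (perm_crd \<pi>) d a {a..<b} \<and> t = Pend {a + 1..<b} Left \<or>
    a + 2 \<le> b \<and> extremal (perm_crd \<pi>) d (a + 1) {a..<b} \<and> t = Peel (insert a {a + 2..<b}) (Some Left) \<or>
    a + 1 \<le> b \<and> extremal (perm_crd \<pi>) d (b - 1) {a..<b} \<and> t = Pend {a..<b - 1} Right \<or>
    a + 2 \<le> b \<and> extremal (perm_crd \<pi>) d (b - 2) {a..<b} \<and> t = Peel (insert (b - 1) {a..<b - 2}) (Some Right)"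
    (is "?L \<longleftrightarrow> ?R")
proof -
  let ?S = "{a..<b}" and ?c = "perm_crd \<pi>"
  have perp: "(\<exists>y. perp y d \<and> P y) \<longleftrightarrow> P Left \<or> P Right" for P
    using assms by (elim disjE) (simp_all only: ex_perp)
  have "?L \<longleftrightarrow> (\<exists>p\<in>?S. extremal ?c d p ?S \<and>
      (p = a \<and> t = Pend (?S - {p}) Left \<or> p = a + 1 \<and> t = Peel (?S - {p}) (Some Left) \<or>
       p = b - 1 \<and> t = Pend (?S - {p}) Right \<or> p + 2 = b \<and> t = Peel (?S - {p}) (Some Right)))"
    unfolding peels_to_def perp
    by (intro bex_cong refl) (simp only: extremal_Left_strip extremal_Right_strip
      cuts_off_Left_strip cuts_off_Right_strip disj_assoc)
  also have "\<dots> \<longleftrightarrow>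
    a \<in> ?S \<and> extremal ?c d a ?S \<and> t = Pend (?S - {a}) Left \<or>
    a + 1 \<in> ?S \<and> extremal ?c d (a + 1) ?S \<and> t = Peel (?S - {a + 1}) (Some Left) \<or>
    b - 1 \<in> ?S \<and> extremal ?c d (b - 1) ?S \<and> t = Pend (?S - {b - 1}) Right \<or>
    b - 2 \<in> ?S \<and> 2 \<le> b \<and> extremal ?c d (b - 2) ?S \<and> t = Peel (?S - {b - 2}) (Some Right)"
  proof -
    \<comment> \<open>Subtraction is truncated, so \<open>b - 2\<close> is the intended point only
      under \<open>2 \<le> b\<close>.\<close>
    have "p + 2 = b \<longleftrightarrow> p = b - 2 \<and> 2 \<le> b" for p by auto
    then show ?thesis by (simp only: conj_disj_distribL bex_disj_distrib) blast
  qed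
  also have "\<dots> \<longleftrightarrow> ?R"
  proof -
    have "?S - {a} = {a + 1..<b}" "?S - {b - 1} = {a..<b - 1}" by auto
    moreover have "?S - {a + 1} = insert a {a + 2..<b}" if "a + 2 \<le> b" using that by auto
    moreover have "?S - {b - 2} = insert (b - 1) {a..<b - 2}" if "a + 2 \<le> b" using that by auto
    moreover have "a \<in> ?S \<longleftrightarrow> a + 1 \<le> b" "a + 1 \<in> ?S \<longleftrightarrow> a + 2 \<le> b" "b - 1 \<in> ?S \<longleftrightarrow> a + 1 \<le> b"
      "b - 2 \<in> ?S \<and> 2 \<le> b \<longleftrightarrow> a + 2 \<le> b" by auto
    ultimately show ?thesis by (simp only: conj_assoc[symmetric]) (simp only: conj_assoc cong: conj_cong)
  qed
  finally show ?thesis .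
qed

text \<open>A horizontal letter determines the pin, namely the end \<open>q\<close> of the strip.
  What remains open is the vertical direction, and whether it belongs to a numeral or to a
  cut.\<close>

lemma peels_to_unique:
  assumes "\<And>p. p \<in> S \<Longrightarrow> extremal c d p S \<longleftrightarrow> p = q" "q \<in> S"
    "\<And>P. (\<exists>y. perp y d \<and> P y) \<longleftrightarrow> P Up \<or> P Down"
  shows "peels_to c S d t \<longleftrightarrow>
    extremal c Up q S \<and> t = Pend (S - {q}) Up \<or> cuts_off c Up q S \<and> t = Peel (S - {q}) (Some Up) \<or>
    extremal c Down q S \<and> t = Pend (S - {q}) Down \<or> cuts_off c Down q S \<and> t = Peel (S - {q}) (Some Down)"
proof -
  have "peels_to c S d t \<longleftrightarrow> (\<exists>p\<in>S. p = q \<and> (\<exists>y. perp y d \<and>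
     (extremal c y p S \<and> t = Pend (S - {p}) y \<or> cuts_off c y p S \<and> t = Peel (S - {p}) (Some y))))"
    unfolding peels_to_def using assms(1) by (intro bex_cong refl) simp
  then show ?thesis unfolding assms(3) using assms(2) by auto
qed

text \<open>The comparison is strict, so the point itself does not count; hence in a strip with a
  gap it suffices to count behind the gap.\<close>

lemma above_insert: "finite S \<Longrightarrow> above \<pi> p (insert p S) = above \<pi> p S"
  and below_insert: "finite S \<Longrightarrow> below \<pi> p (insert p S) = below \<pi> p S"
  by (auto simp: above_def below_def intro!: arg_cong[of _ _ card])

text \<open>Kinds 0 to 2 are full strips, where the results on intervals apply. Kinds 3 and 4 have a
  gap: their only letter is \<open>Left\<close> or \<open>Right\<close>, the isolated end is the
  extremal point, and its removal leaves a full strip. Kinds 5 to 8 have a single step, by the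
  pending letter.\<close>

lemma cell_state_step:
  assumes inj: "inj \<pi>" and ok: "cell_ok n (a, b, c)"
  shows "peel_step (perm_crd \<pi>) (cell_state (a, b, c)) x t \<longleftrightarrow>
    (\<exists>a' b' c'. row_step \<pi> (a, b, c) x (a', b', c') \<and> t = cell_state (a', b', c'))"
    (is "?L \<longleftrightarrow> ?R")
proof -
  let ?S = "{a..<b}" and ?c = "perm_crd \<pi>"
  have ends: "a + 1 \<le> b \<Longrightarrow> a \<in> ?S" "a + 1 \<le> b \<Longrightarrow> b - 1 \<in> ?S"
    "a + 2 \<le> b \<Longrightarrow> a + 1 \<in> ?S" "a + 2 \<le> b \<Longrightarrow> b - 2 \<in> ?S" by auto
  note ext = extremal_Up[OF inj] extremal_Down[OF inj] cuts_off_Up[OF inj] cuts_off_Down[OF inj]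
  have left: "peels_to ?c ?S Left t \<longleftrightarrow> a + 1 \<le> b \<and>
      (above \<pi> a ?S = 0 \<and> t = Pend {a + 1..<b} Up \<or> above \<pi> a ?S = 1 \<and> t = Peel {a + 1..<b} (Some Up) \<or>
       below \<pi> a ?S = 0 \<and> t = Pend {a + 1..<b} Down \<or> below \<pi> a ?S = 1 \<and> t = Peel {a + 1..<b} (Some Down))"
  proof (cases "a + 1 \<le> b")
    case True
    have "?S - {a} = {a + 1..<b}" by auto
    then show ?thesis
      using True ends(1)[OF True] peels_to_unique[of ?S ?c Left a t, OF extremal_Left_strip ends(1)[OF True] ex_perp(3)]
      by (simp add: ext)
  qed (auto simp: peels_to_def)
  have right: "peels_to ?c ?S Right t \<longleftrightarrow> a + 1 \<le> b \<and>
      (above \<pi> (b - 1) ?S = 0 \<and> t = Pend {a..<b - 1} Up \<or> above \<pi> (b - 1) ?S = 1 \<and> t = Peel {a..<b - 1} (Some Up) \<or>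
       below \<pi> (b - 1) ?S = 0 \<and> t = Pend {a..<b - 1} Down \<or> below \<pi> (b - 1) ?S = 1 \<and> t = Peel {a..<b - 1} (Some Down))"
  proof (cases "a + 1 \<le> b")
    case True
    have "?S - {b - 1} = {a..<b - 1}" by auto
    then show ?thesis
      using True ends(2)[OF True] peels_to_unique[of ?S ?c Right "b - 1" t, OF extremal_Right_strip ends(2)[OF True] ex_perp(4)]
      by (simp add: ext)
  qed (auto simp: peels_to_def)
  have vertical: "peels_to ?c ?S Up t \<longleftrightarrow>
      a + 1 \<le> b \<and> above \<pi> a ?S = 0 \<and> t = Pend {a + 1..<b} Left \<or>
      a + 2 \<le> b \<and> above \<pi> (a + 1) ?S = 0 \<and> t = Peel (insert a {a + 2..<b}) (Some Left) \<or>
      a + 1 \<le> b \<and> above \<pi> (b - 1) ?S = 0 \<and> t = Pend {a..<b - 1} Right \<or>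
      a + 2 \<le> b \<and> above \<pi> (b - 2) ?S = 0 \<and> t = Peel (insert (b - 1) {a..<b - 2}) (Some Right)"
    "peels_to ?c ?S Down t \<longleftrightarrow>
      a + 1 \<le> b \<and> below \<pi> a ?S = 0 \<and> t = Pend {a + 1..<b} Left \<or>
      a + 2 \<le> b \<and> below \<pi> (a + 1) ?S = 0 \<and> t = Peel (insert a {a + 2..<b}) (Some Left) \<or>
      a + 1 \<le> b \<and> below \<pi> (b - 1) ?S = 0 \<and> t = Pend {a..<b - 1} Right \<or>
      a + 2 \<le> b \<and> below \<pi> (b - 2) ?S = 0 \<and> t = Peel (insert (b - 1) {a..<b - 2}) (Some Right)"
    unfolding peels_to_vertical[OF disjI1[OF refl]] peels_to_vertical[OF disjI2[OF refl]]
    by (simp_all only: ext[OF finite_atLeastLessThan ends(1)] ext[OF finite_atLeastLessThan ends(2)]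
      ext[OF finite_atLeastLessThan ends(3)] ext[OF finite_atLeastLessThan ends(4)] cong: conj_cong)
  have ab: "a \<le> b" and "c < 9" using ok by simp_all
  then consider "c = 0" | "c = 1" | "c = 2" | "c = 3" | "c = 4" | "c = 5" | "c = 6" | "c = 7" | "c = 8"
    by linarith
  then show ?thesis
  proof cases
    case 1
    show ?thesis
      by (cases x)
        (simp add: 1 peel_step_Peel left right vertical rows_def cell_state_simps rank_simps
          shift_cell_simps ab conj_disj_distribR ex_disj_distrib
          del: peel_step.simps(1); simp only: conj_disj_distribL disj_ac)+
  next
    case 2
    show ?thesis
      by (cases x)
        (simp add: 2 peel_step_Peel vertical rows_def cell_state_simps rank_simps
          shift_cell_simps ab conj_disj_distribR ex_disj_distrib
          del: peel_step.simps(1); simp only: conj_disj_distribL disj_ac)+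
  next
    case 3
    show ?thesis
      by (cases x)
        (simp add: 3 peel_step_Peel vertical rows_def cell_state_simps rank_simps
          shift_cell_simps ab conj_disj_distribR ex_disj_distrib
          del: peel_step.simps(1); simp only: conj_disj_distribL disj_ac)+
  next
    case 4
    have ab: "a + 2 \<le> b" using ok 4 by simp
    let ?T = "insert a {a + 2..<b}"
    have del: "?T - {a} = {a + 2..<b}" by auto
    have "extremal ?c Left p ?T \<longleftrightarrow> p = a" if "p \<in> ?T" for p
    proof
      assume e: "extremal ?c Left p ?T"
      show "p = a"
      proof (rule ccontr)
        assume "p \<noteq> a"
        then have "a \<in> ?T - {p}" by simp
        then have "p < a" using e unfolding extremal_def by force
        then show False using that by auto
      qed
    qed (auto simp: extremal_def)
    note pt = peels_to_unique[of ?T ?c Left a t, OF this insertI1 ex_perp(3), unfolded del]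
    have ai: "a \<in> ?T" "finite ?T" by simp_all
    note T = ext[OF ai(2,1)]
    have "peels_to ?c ?T Left t \<longleftrightarrow>
      above \<pi> a {a + 2..<b} = 0 \<and> t = Pend {a + 2..<b} Up \<or> above \<pi> a {a + 2..<b} = 1 \<and> t = Peel {a + 2..<b} (Some Up) \<or>
      below \<pi> a {a + 2..<b} = 0 \<and> t = Pend {a + 2..<b} Down \<or> below \<pi> a {a + 2..<b} = 1 \<and> t = Peel {a + 2..<b} (Some Down)"
      using pt by (simp only: T above_insert below_insert finite_atLeastLessThan)
    then show ?thesis
      using ab by (cases x)
        (simp add: 4 peel_step_Peel rows_def cell_state_simps rank_simps
          shift_cell_simps ab conj_disj_distribR ex_disj_distrib
          del: peel_step.simps(1); simp only: conj_disj_distribL disj_ac)+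
  next
    case 5
    have ab: "a + 2 \<le> b" using ok 5 by simp
    let ?T = "insert (b - 1) {a..<b - 2}"
    have del: "?T - {b - 1} = {a..<b - 2}" by auto
    have "extremal ?c Right p ?T \<longleftrightarrow> p = b - 1" if "p \<in> ?T" for p
    proof
      assume e: "extremal ?c Right p ?T"
      show "p = b - 1"
      proof (rule ccontr)
        assume "p \<noteq> b - 1"
        then have "b - 1 \<in> ?T - {p}" by simp
        then have "b - 1 < p" using e unfolding extremal_def by force
        then show False using that by auto
      qed
    qed (auto simp: extremal_def)
    note pt = peels_to_unique[of ?T ?c Right "b - 1" t, OF this insertI1 ex_perp(4), unfolded del]
    have ai: "b - 1 \<in> ?T" "finite ?T" by simp_all
    note T = ext[OF ai(2,1)]
    have "peels_to ?c ?T Right t \<longleftrightarrow>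
      above \<pi> (b - 1) {a..<b - 2} = 0 \<and> t = Pend {a..<b - 2} Up \<or> above \<pi> (b - 1) {a..<b - 2} = 1 \<and> t = Peel {a..<b - 2} (Some Up) \<or>
      below \<pi> (b - 1) {a..<b - 2} = 0 \<and> t = Pend {a..<b - 2} Down \<or> below \<pi> (b - 1) {a..<b - 2} = 1 \<and> t = Peel {a..<b - 2} (Some Down)"
      using pt by (simp only: T above_insert below_insert finite_atLeastLessThan)
    then show ?thesis
      using ab by (cases x)
        (simp add: 5 peel_step_Peel rows_def cell_state_simps rank_simps
          shift_cell_simps ab conj_disj_distribR ex_disj_distrib
          del: peel_step.simps(1); simp only: conj_disj_distribL disj_ac)+
  next
    case 6
    show ?thesis by (cases x) (simp_all add: 6 rows_def cell_state_simps rank_simps shift_cell_simps ab)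
  next
    case 7
    show ?thesis by (cases x) (simp_all add: 7 rows_def cell_state_simps rank_simps shift_cell_simps ab)
  next
    case 8
    show ?thesis by (cases x) (simp_all add: 8 rows_def cell_state_simps rank_simps shift_cell_simps ab)
  next
    case 9
    show ?thesis by (cases x) (simp_all add: 9 rows_def cell_state_simps rank_simps shift_cell_simps ab)
  qed
qed

section \<open>The automaton\<close>

text \<open>Positional numbering: the bounds of the strip are digits in base \<open>n + 1\<close>,
  followed by the kind in base 9. Euclidean division recovers the triple.\<close>

fun state_id :: "nat \<Rightarrow> nat \<times> nat \<times> nat \<Rightarrow> nat" where
  "state_id n (a, b, c) = 9 * (a * (n + 1) + b) + c"

fun row_trans :: "nat \<Rightarrow> (nat \<Rightarrow> nat) \<Rightarrow> nat \<Rightarrow> row \<Rightarrow> nat \<times> dir \<times> nat" where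
  "row_trans n \<pi> i (k, r, m, c, d, h, c') =
    (let a = i div (n + 1); b = i mod (n + 1) in
     if a + k \<le> b \<and> rank \<pi> a b r = m
     then (9 * i + c, d, state_id n (fst (shift_cell h a b), snd (shift_cell h a b), c'))
     else (0, Up, 0))"

text \<open>Absent rows are replaced by the transition \<open>(0, Up, 0)\<close>, which state \<open>0\<close>, representing the
  empty strip, has anyway. Hence the position of each entry in the list is known in advance.\<close>

definition perm_nfa :: "nat \<Rightarrow> (nat \<Rightarrow> nat) \<Rightarrow> fa" where
  "perm_nfa n \<pi> =
    \<lparr>fa_states = 9 * (n + 1) ^ 2, fa_init = [9 * n],
     fa_final = map (\<lambda>i. if i div (n + 1) = i mod (n + 1) then 9 * i else 0) [0..<(n + 1) ^ 2],
     fa_trans = concat (map (\<lambda>i. map (row_trans n \<pi> i) rows) [0..<(n + 1) ^ 2])\<rparr>"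

lemma cell_index_less:
  fixes n :: nat
  assumes "a \<le> n" "b \<le> n"
  shows "a * (n + 1) + b < (n + 1) ^ 2"
proof -
  from \<open>b \<le> n\<close> have "b < n + 1" by simp
  then have "a * (n + 1) + b < a * (n + 1) + (n + 1)" by (rule add_strict_left_mono)
  also have "\<dots> = (a + 1) * (n + 1)" by simp
  also have "\<dots> \<le> (n + 1) * (n + 1)" using \<open>a \<le> n\<close> by (intro mult_right_mono) auto
  finally show ?thesis by (simp add: power2_eq_square)
qed

lemma id_less: "x < N \<Longrightarrow> c < 9 \<Longrightarrow> 9 * x + c < 9 * N" for N :: nat
  by linarith

lemma cell_index_div:
  fixes n :: nat
  assumes "b \<le> n"
  shows "(a * (n + 1) + b) div (n + 1) = a"
proof -
  have "(a * (n + 1) + b) div (n + 1) = a + b div (n + 1)" by (rule div_mult_self3) simp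
  then show ?thesis using assms by simp
qed

lemma cell_index_mod:
  fixes n :: nat
  assumes "b \<le> n"
  shows "(a * (n + 1) + b) mod (n + 1) = b"
  unfolding mod_mult_self3 using assms by simp

lemma perm_nfa_trans:
  "(p, x, q) \<in> set (fa_trans (perm_nfa n \<pi>)) \<longleftrightarrow>
    (\<exists>i row. i < (n + 1) ^ 2 \<and> row \<in> set rows \<and> (p, x, q) = row_trans n \<pi> i row)"
  unfolding perm_nfa_def fa.select_convs set_concat set_map set_upt image_image
  by (simp only: UN_iff image_iff atLeast0LessThan lessThan_iff Bex_def conj_assoc ex_simps)

lemma perm_nfa_step:
  assumes ok: "cell_ok n (a, b, c)"
  shows "(state_id n (a, b, c), x, q) \<in> set (fa_trans (perm_nfa n \<pi>)) \<longleftrightarrow>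
    (\<exists>a' b' c'. row_step \<pi> (a, b, c) x (a', b', c') \<and> q = state_id n (a', b', c'))"
    (is "?L \<longleftrightarrow> ?R")
proof
  have ab: "a \<le> n" "b \<le> n" "c < 9" using ok by simp_all
  define i where "i = a * (n + 1) + b"
  have i: "i < (n + 1) ^ 2" "i div (n + 1) = a" "i mod (n + 1) = b"
    unfolding i_def using ab by (simp_all only: cell_index_less cell_index_div cell_index_mod)
  have id: "state_id n (a, b, c) = 9 * i + c" by (simp add: i_def)
  {
    assume ?L
    then obtain j row where j: "j < (n + 1) ^ 2" "row \<in> set rows" "(9 * i + c, x, q) = row_trans n \<pi> j row"
      unfolding perm_nfa_trans id by blast
    obtain k r m c0 d h c' where row: "row = (k, r, m, c0, d, h, c')" by (rule prod_cases7)
    show ?R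
    proof (cases "j div (n + 1) + k \<le> j mod (n + 1) \<and> rank \<pi> (j div (n + 1)) (j mod (n + 1)) r = m")
      case True
      then have eq: "9 * i + c = 9 * j + c0" "x = d"
        "q = state_id n (fst (shift_cell h (j div (n + 1)) (j mod (n + 1))), snd (shift_cell h (j div (n + 1)) (j mod (n + 1))), c')"
        using j(3) by (simp_all add: row Let_def del: state_id.simps)
      have "c0 < 9" using rows_ok j(2) row by blast
      \<comment> \<open>Quotient and remainder modulo 9 are unique.\<close>
      then have "i = j" "c0 = c" using eq(1) ab(3) by presburger+
      have "row_step \<pi> (a, b, c) x (fst (shift_cell h a b), snd (shift_cell h a b), c')"
        unfolding row_step.simps
        using True j(2) \<open>i = j\<close> \<open>c0 = c\<close> eq(2) i(2,3) row by (intro exI[of _ k] exI[of _ r] exI[of _ m] exI[of _ h]) auto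
      then show ?thesis using eq(3) \<open>i = j\<close> i(2,3) by blast
    next
      case False
      then have eq: "9 * i + c = 0" "x = Up" "q = 0"
        using j(3) by (auto simp: row Let_def split: if_splits)
      then have "a = 0" "b = 0" "c = 0" by (simp_all add: i_def)
      have "(0, 0, 0, 0, Up, 0, 0) \<in> set rows" by (simp add: rows_def)
      then have "row_step \<pi> (a, b, c) x (0, 0, 0)"
        unfolding row_step.simps \<open>a = 0\<close> \<open>b = 0\<close> \<open>c = 0\<close> eq(2)
        by (intro exI[of _ 0] conjI) (simp_all add: rank_simps shift_cell_simps)
      then show ?thesis using eq(3) by (intro exI[of _ 0] conjI) simp_all
    qed
  }
  assume ?R
  then obtain k r m h a' b' c' where row: "(k, r, m, c, x, h, c') \<in> set rows" "a + k \<le> b"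
    "rank \<pi> a b r = m" "shift_cell h a b = (a', b')" "q = state_id n (a', b', c')"
    unfolding row_step.simps by blast
  then have "row_trans n \<pi> i (k, r, m, c, x, h, c') = (state_id n (a, b, c), x, q)"
    unfolding row_trans.simps i(2,3) Let_def id by simp
  then show ?L unfolding perm_nfa_trans using row(1) i(1) by metis
qed

text \<open>Here all pairs of bounds up to \<open>n\<close> occur, including those with
  \<open>a > b\<close>. The rows that shift a bound are guarded, so the new bounds are again at most
  \<open>n\<close>.\<close>

lemma perm_nfa_wf: "fa_wf (perm_nfa n \<pi>)"
proof -
  have "q < 9 * (n + 1) ^ 2 \<and> p < 9 * (n + 1) ^ 2"
    if tr: "(p, x, q) \<in> set (fa_trans (perm_nfa n \<pi>))" for p x q
  proof -
    obtain i row where i: "i < (n + 1) ^ 2" "row \<in> set rows" "(p, x, q) = row_trans n \<pi> i row"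
      using tr unfolding perm_nfa_trans by blast
    obtain k r m c d h c' where row: "row = (k, r, m, c, d, h, c')" by (rule prod_cases7)
    have ok: "c < 9" "c' < 9" "h \<le> 4" "h = 1 \<or> h = 2 \<Longrightarrow> 1 \<le> k" "3 \<le> h \<Longrightarrow> 2 \<le> k"
      using rows_ok[of k r m c d h c'] i(2) row by auto
    define a where "a = i div (n + 1)"
    define b where "b = i mod (n + 1)"
    have b: "b \<le> n" unfolding b_def using mod_less_divisor[of "n + 1" i] by simp
    have a: "a \<le> n"
      using i(1) unfolding a_def power2_eq_square
      by (simp add: less_mult_imp_div_less flip: less_Suc_eq_le)
    show ?thesis
    proof (cases "a + k \<le> b \<and> rank \<pi> a b r = m")
      case True
      then have eq: "p = 9 * i + c" "q = state_id n (fst (shift_cell h a b), snd (shift_cell h a b), c')"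
        using i(3) by (simp_all add: row Let_def a_def b_def del: state_id.simps)
      consider "h = 0" | "h = 1" | "h = 2" | "h = 3" | "h = 4" using ok(3) by linarith
      then have "fst (shift_cell h a b) \<le> n \<and> snd (shift_cell h a b) \<le> n"
        using a b ok(4,5) True by cases (simp_all add: shift_cell.simps)
      then have "fst (shift_cell h a b) * (n + 1) + snd (shift_cell h a b) < (n + 1) ^ 2"
        using cell_index_less by blast
      then show ?thesis unfolding eq state_id.simps using ok(1,2) i(1) by (intro conjI id_less)
    next
      case False
      then have "p = 0" "q = 0" using i(3) by (auto simp: row Let_def a_def b_def split: if_splits)
      then show ?thesis by simp
    qed
  qed
  then have "set (fa_trans (perm_nfa n \<pi>)) \<subseteq> {..<9 * (n + 1) ^ 2} \<times> UNIV \<times> {..<9 * (n + 1) ^ 2}"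
    by (intro subsetI) (metis SigmaI UNIV_I lessThan_iff prod_cases3)
  moreover have "9 * n < 9 * (n + 1) ^ 2" using cell_index_less[of 0 n n] by simp
  then have "set (fa_init (perm_nfa n \<pi>)) \<subseteq> {..<9 * (n + 1) ^ 2}"
    by (simp add: perm_nfa_def)
  moreover have "set (fa_final (perm_nfa n \<pi>)) \<subseteq> {..<9 * (n + 1) ^ 2}"
    by (auto simp: perm_nfa_def)
  moreover have "fa_states (perm_nfa n \<pi>) = 9 * (n + 1) ^ 2" by (simp add: perm_nfa_def)
  ultimately show ?thesis
    unfolding fa_wf_def by simp
qed

lemma cell_state_final:
  assumes "cell_ok n (a, b, c)"
  shows "state_id n (a, b, c) \<in> set (fa_final (perm_nfa n \<pi>)) \<longleftrightarrow> cell_state (a, b, c) = Peel {} None"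
proof -
  have ab: "a \<le> n" "b \<le> n" "c < 9" "a \<le> b" using assms by simp_all
  define i where "i = a * (n + 1) + b"
  have i: "i < (n + 1) ^ 2" "i div (n + 1) = a" "i mod (n + 1) = b"
    unfolding i_def using ab by (simp_all only: cell_index_less cell_index_div cell_index_mod)
  have "cell_state (a, b, c) = Peel {} None \<longleftrightarrow> c = 0 \<and> a = b"
    using ab(4) by (auto simp: cell_state.simps)
  moreover have "9 * i + c \<in> set (fa_final (perm_nfa n \<pi>)) \<longleftrightarrow> c = 0 \<and> a = b"
  proof
    assume "9 * i + c \<in> set (fa_final (perm_nfa n \<pi>))"
    then obtain j where j: "j < (n + 1) ^ 2"
      "9 * i + c = (if j div (n + 1) = j mod (n + 1) then 9 * j else 0)"
      unfolding perm_nfa_def by auto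
    show "c = 0 \<and> a = b"
    proof (cases "j div (n + 1) = j mod (n + 1)")
      case True
      then have "9 * i + c = 9 * j" using j(2) by simp
      then have "i = j" "c = 0" using ab(3) by presburger+
      then show ?thesis using True i by simp
    next
      \<comment> \<open>The filler 0 is the state of the empty strip at \<open>(0, 0)\<close>, which
        is final anyway.\<close>
      case False
      then show ?thesis using j(2) by (simp add: i_def)
    qed
  next
    assume "c = 0 \<and> a = b"
    then show "9 * i + c \<in> set (fa_final (perm_nfa n \<pi>))"
      unfolding perm_nfa_def using i by (auto intro!: image_eqI[of _ _ i])
  qed
  ultimately show ?thesis by (simp add: i_def)
qed

lemma perm_nfa_run:
  assumes "inj \<pi>" "cell_ok n s"
  shows "(\<exists>q\<in>set (fa_final (perm_nfa n \<pi>)). fa_run (perm_nfa n \<pi>) (state_id n s) w q) \<longleftrightarrow>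
    peel_accepts (perm_crd \<pi>) (cell_state s) w"
  using assms(2)
proof (induction w arbitrary: s)
  case Nil
  then show ?case by (cases s) (simp add: cell_state_final del: state_id.simps)
next
  case (Cons x w)
  obtain a b c where s: "s = (a, b, c)" by (cases s)
  let ?acc = "\<lambda>p. \<exists>q\<in>set (fa_final (perm_nfa n \<pi>)). fa_run (perm_nfa n \<pi>) p w q"
  have "(\<exists>q\<in>set (fa_final (perm_nfa n \<pi>)). fa_run (perm_nfa n \<pi>) (state_id n s) (x # w) q) \<longleftrightarrow>
      (\<exists>p. (state_id n s, x, p) \<in> set (fa_trans (perm_nfa n \<pi>)) \<and> ?acc p)"
    by auto
  also have "\<dots> \<longleftrightarrow> (\<exists>a' b' c'. row_step \<pi> s x (a', b', c') \<and> ?acc (state_id n (a', b', c')))"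
    unfolding s perm_nfa_step[OF Cons.prems[unfolded s]] by blast
  also have "\<dots> \<longleftrightarrow> (\<exists>a' b' c'. row_step \<pi> s x (a', b', c') \<and> peel_accepts (perm_crd \<pi>) (cell_state (a', b', c')) w)"
    using Cons.IH row_step_ok Cons.prems unfolding s by blast
  also have "\<dots> \<longleftrightarrow> (\<exists>t. peel_step (perm_crd \<pi>) (cell_state s) x t \<and> peel_accepts (perm_crd \<pi>) t w)"
    unfolding s cell_state_step[OF assms(1) Cons.prems[unfolded s]] by blast
  finally show ?case by simp
qed

lemma perm_nfa_lang:
  assumes "\<pi> permutes {1..n}"
  shows "fa_lang (perm_nfa n \<pi>) = rev ` perm_lang n \<pi>"
proof -
  have "w \<in> fa_lang (perm_nfa n \<pi>) \<longleftrightarrow>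
      (\<exists>q\<in>set (fa_final (perm_nfa n \<pi>)). fa_run (perm_nfa n \<pi>) (state_id n (0, n, 0)) w q)" for w
    by (simp add: fa_lang_def perm_nfa_def)
  moreover have "cell_state (0, n, 0) = Peel {0..<n} None" by (simp add: cell_state_simps)
  ultimately have "w \<in> fa_lang (perm_nfa n \<pi>) \<longleftrightarrow> w \<in> rev ` perm_lang n \<pi>" for w
    using perm_nfa_run[OF permutes_inj[OF assms], of n "(0, n, 0)" w] perm_lang_iff_accepts[OF assms, of w]
    by simp
  then show ?thesis by blast
qed

section \<open>The program\<close>

text \<open>One pass costs at most \<open>T\<close> steps plus one for the test, and the final test
  costs one more. The body itself advances the counter, since \<open>Inv\<close> ties register
  \<open>x\<close> to \<open>i\<close>.\<close>

lemma for_loop: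
  assumes body: "\<And>i s. i < K \<Longrightarrow> Inv i s \<Longrightarrow> \<exists>t s'. t \<le> T \<and> exec W M c s t s' \<and> Inv (Suc i) s'"
    and reg: "\<And>i s. Inv i s \<Longrightarrow> fst s x = i \<and> fst s y = K"
    and "K < W" "i \<le> K" "Inv i s"
  shows "\<exists>t s'. t \<le> (K - i) * (T + 1) + 1 \<and> exec W M (While (Less (Reg x) (Reg y)) c) s t s' \<and> Inv K s'"
  using assms(4,5)
proof (induction "K - i" arbitrary: i s)
  case 0
  then have i: "i = K" by simp
  then have "exec W M (While (Less (Reg x) (Reg y)) c) s 1 s"
    using reg[OF 0(3)] assms(3) by (intro exec.WhileFalse) auto
  then show ?case using 0(3) i by (intro exI[of _ 1] exI[of _ s]) simp
next
  case (Suc k)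
  then have i: "i < K" by simp
  obtain t s' where s': "t \<le> T" "exec W M c s t s'" "Inv (Suc i) s'"
    using body[OF i Suc.prems(2)] by blast
  obtain t' s'' where s'': "t' \<le> (K - Suc i) * (T + 1) + 1"
    "exec W M (While (Less (Reg x) (Reg y)) c) s' t' s''" "Inv K s''"
  proof -
    have "k = K - Suc i" using Suc.hyps(2) by simp
    moreover have "Suc i \<le> K" using i by simp
    ultimately show ?thesis using Suc.hyps(1)[OF _ _ s'(3)] that by blast
  qed
  have "exec W M (While (Less (Reg x) (Reg y)) c) s (1 + t + t') s''"
    using reg[OF Suc.prems(2)] i assms(3) by (intro exec.WhileTrue[OF _ _ s'(2) s''(2)]) auto
  moreover have "1 + t + t' \<le> (K - i) * (T + 1) + 1"
  proof -
    have "K - i = Suc (K - Suc i)" using i by simp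
    then have "(K - i) * (T + 1) = (T + 1) + (K - Suc i) * (T + 1)" by simp
    then show ?thesis using s'(1) s''(1) by linarith
  qed
  ultimately show ?case using s''(3) by blast
qed

text \<open>Overflow is excluded statically: \<open>upper\<close> bounds an expression over all
  states whose registers 0 to 5 are at most \<open>\<rho>\<close> and whose memory words are at most
  \<open>V\<close>, and \<open>word_ok\<close> asks that these bounds fit. Differences and quotients
  are bounded by their first operand.\<close>

fun upper :: "(nat \<Rightarrow> nat) \<Rightarrow> nat \<Rightarrow> aexp \<Rightarrow> nat" where
  "upper \<rho> V (Const k) = k"
| "upper \<rho> V (Reg x) = \<rho> x"
| "upper \<rho> V (Mem a) = V"
| "upper \<rho> V (Add a b) = upper \<rho> V a + upper \<rho> V b"
| "upper \<rho> V (Sub a b) = upper \<rho> V a"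
| "upper \<rho> V (Mul a b) = upper \<rho> V a * upper \<rho> V b"
| "upper \<rho> V (Quo a b) = upper \<rho> V a"

fun word_ok :: "nat \<Rightarrow> nat \<Rightarrow> (nat \<Rightarrow> nat) \<Rightarrow> nat \<Rightarrow> aexp \<Rightarrow> bool" where
  "word_ok W M \<rho> V (Const k) \<longleftrightarrow> k < W"
| "word_ok W M \<rho> V (Reg x) \<longleftrightarrow> x < 6 \<and> \<rho> x < W"
| "word_ok W M \<rho> V (Mem a) \<longleftrightarrow> word_ok W M \<rho> V a \<and> upper \<rho> V a < M \<and> V < W"
| "word_ok W M \<rho> V (Add a b) \<longleftrightarrow> word_ok W M \<rho> V a \<and> word_ok W M \<rho> V b \<and> upper \<rho> V a + upper \<rho> V b < W"
| "word_ok W M \<rho> V (Sub a b) \<longleftrightarrow> word_ok W M \<rho> V a \<and> word_ok W M \<rho> V b \<and> upper \<rho> V a < W"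
| "word_ok W M \<rho> V (Mul a b) \<longleftrightarrow> word_ok W M \<rho> V a \<and> word_ok W M \<rho> V b \<and> upper \<rho> V a * upper \<rho> V b < W"
| "word_ok W M \<rho> V (Quo a b) \<longleftrightarrow> word_ok W M \<rho> V a \<and> word_ok W M \<rho> V b \<and> upper \<rho> V a < W"

lemma aval_upper:
  "word_ok W M \<rho> V e \<Longrightarrow> \<forall>x<6. fst s x \<le> \<rho> x \<Longrightarrow> \<forall>x. snd s x \<le> V \<Longrightarrow> aval e s \<le> upper \<rho> V e"
proof (induction e)
  case (Sub a b)
  then have "aval a s \<le> upper \<rho> V a" by simp
  then show ?case by (simp add: le_diff_conv trans_le_add1)
next
  case (Quo a b)
  then have "aval a s \<le> upper \<rho> V a" by simp
  then show ?case by (simp add: order.trans[OF div_le_dividend])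
qed (auto intro: add_mono mult_mono)

lemma word_ok_afits:
  assumes "word_ok W M \<rho> V e" and s: "\<forall>x<6. fst s x \<le> \<rho> x" "\<forall>x. snd s x \<le> V"
  shows "afits W M e s"
  using assms(1)
proof (induction e)
  case (Reg x)
  then have "fst s x \<le> \<rho> x" "\<rho> x < W" using s(1) by auto
  then show ?case by simp
next
  case (Mem a)
  then have "aval a s \<le> upper \<rho> V a" using aval_upper[OF _ s, of W M a] by simp
  moreover have "snd s (aval a s) \<le> V" using s(2) by blast
  ultimately show ?case using Mem by auto
next
  case (Add a b)
  then show ?case using aval_upper[OF Add.prems s] by auto
next
  case (Sub a b)
  then show ?case using aval_upper[OF Sub.prems s] by auto
next
  case (Mul a b)
  then show ?case using aval_upper[OF Mul.prems s] by auto
next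
  case (Quo a b)
  then show ?case using aval_upper[OF Quo.prems s] by auto
qed simp

fun emit :: "aexp \<Rightarrow> nat \<Rightarrow> aexp list \<Rightarrow> com" where
  "emit X t [] = Skip"
| "emit X t (e # es) = Seq (Store (Add X (Const t)) e) (emit X (Suc t) es)"

text \<open>The expressions read the same memory that is being written. The invariant
  \<open>G\<close> has to determine their values and to survive the writes, all of which happen at
  or after the address \<open>B + t\<close>.\<close>

lemma exec_emit:
  assumes base: "\<And>mem. aval X (r, mem) = B \<and> afits W M X (r, mem)"
    and vals: "list_all2 (\<lambda>e u. u \<le> V \<and> (\<forall>mem. G mem \<longrightarrow> afits W M e (r, mem) \<and> aval e (r, mem) = u)) es us"
    and keep: "\<And>mem x u. G mem \<Longrightarrow> B + t \<le> x \<Longrightarrow> u \<le> V \<Longrightarrow> G (mem(x := u))"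
    and size: "B + t + length es \<le> M" "M \<le> W" and G: "G mem"
  shows "\<exists>mem'. exec W M (emit X t es) (r, mem) (length es + 1) (r, mem') \<and> G mem' \<and>
    (\<forall>j<length es. mem' (B + t + j) = us ! j) \<and>
    (\<forall>x. x < B + t \<or> B + t + length es \<le> x \<longrightarrow> mem' x = mem x)"
  using vals keep size(1) G
proof (induction es us arbitrary: t mem rule: list_all2_induct)
  case Nil
  have "exec W M (emit X t []) (r, mem) (length ([]::aexp list) + 1) (r, mem)"
    using exec.Skip[of W M "(r, mem)"] by simp
  then show ?case using Nil by (intro exI[of _ mem]) simp
next
  case (Cons e es u us)
  let ?mem = "mem(B + t := u)"
  have e: "u \<le> V" "afits W M e (r, mem)" "aval e (r, mem) = u"
    using Cons.hyps(1) Cons.prems(3) by blast+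
  have "afits W M (Add X (Const t)) (r, mem)" "B + t < M"
    using base[of mem] Cons.prems(2) size(2) by auto
  then have st: "exec W M (Store (Add X (Const t)) e) (r, mem) 1 (r, ?mem)"
    using exec.Store[of W M "Add X (Const t)" "(r, mem)" e] e base[of mem] by simp
  have "G ?mem" by (rule Cons.prems(1)[OF Cons.prems(3) _ e(1)]) simp
  moreover have "\<And>mem x u. G mem \<Longrightarrow> B + Suc t \<le> x \<Longrightarrow> u \<le> V \<Longrightarrow> G (mem(x := u))"
    by (rule Cons.prems(1)) simp_all
  moreover have "B + Suc t + length es \<le> M" using Cons.prems(2) by simp
  ultimately obtain mem' where m: "exec W M (emit X (Suc t) es) (r, ?mem) (length es + 1) (r, mem')" "G mem'"
    "\<forall>j<length es. mem' (B + Suc t + j) = us ! j"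
    "\<forall>x. x < B + Suc t \<or> B + Suc t + length es \<le> x \<longrightarrow> mem' x = ?mem x"
    using Cons.IH[of "Suc t" ?mem] by blast
  have "exec W M (emit X t (e # es)) (r, mem) (1 + (length es + 1)) (r, mem')"
    unfolding emit.simps by (rule exec.Seq[OF st m(1)])
  moreover have "mem' (B + t + j) = (u # us) ! j" if "j < length (e # es)" for j
    using m(3,4) that by (cases j) auto
  moreover have "mem' x = mem x" if "x < B + t \<or> B + t + length (e # es) \<le> x" for x
    using m(4) that by auto
  ultimately show ?case using m(2) by (intro exI[of _ mem']) auto
qed

section \<open>Heights within a strip from prefix counts\<close>

definition count_less :: "(nat \<Rightarrow> nat) \<Rightarrow> nat \<Rightarrow> nat \<Rightarrow> nat" where
  "count_less \<pi> p q = card {j. j < p \<and> \<pi> (Suc q) < \<pi> (Suc j)}"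

lemma count_less_0 [simp]: "count_less \<pi> 0 q = 0"
  by (simp add: count_less_def)

lemma count_less_Suc:
  "count_less \<pi> (Suc p) q = count_less \<pi> p q + (if \<pi> (Suc q) < \<pi> (Suc p) then 1 else 0)"
proof -
  have "{j. j < Suc p \<and> \<pi> (Suc q) < \<pi> (Suc j)} =
     {j. j < p \<and> \<pi> (Suc q) < \<pi> (Suc j)} \<union> (if \<pi> (Suc q) < \<pi> (Suc p) then {p} else {})"
    by (auto simp: less_Suc_eq)
  then show ?thesis by (auto simp: count_less_def)
qed

lemma count_less_le: "count_less \<pi> p q \<le> p"
  by (induction p) (auto simp: count_less_Suc)

lemma above_count:
  assumes "lo \<le> hi"
  shows "above \<pi> q {lo..<hi} = count_less \<pi> hi q - count_less \<pi> lo q"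
  using assms
proof (induction hi rule: dec_induct)
  case base
  then show ?case by (simp add: above_def)
next
  case (step hi)
  have "{j \<in> {lo..<Suc hi}. \<pi> (Suc q) < \<pi> (Suc j)} =
      {j \<in> {lo..<hi}. \<pi> (Suc q) < \<pi> (Suc j)} \<union> (if \<pi> (Suc q) < \<pi> (Suc hi) then {hi} else {})"
    using step(1) by (auto simp: less_Suc_eq)
  then have "above \<pi> q {lo..<Suc hi} = above \<pi> q {lo..<hi} + (if \<pi> (Suc q) < \<pi> (Suc hi) then 1 else 0)"
    by (auto simp: above_def)
  moreover have "count_less \<pi> lo q \<le> count_less \<pi> hi q"
    using step(1) by (induction hi rule: dec_induct) (auto simp: count_less_Suc)
  ultimately show ?case using step.IH by (simp add: count_less_Suc)
qed

text \<open>Every point of \<open>S\<close> other than \<open>q\<close> is either above or below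
  \<open>q\<close>, so a single table serves both kinds of counts.\<close>

lemma below_above:
  assumes "inj \<pi>" "finite S"
  shows "below \<pi> q S = card (S - {q}) - above \<pi> q S"
proof -
  have "S - {q} = {j \<in> S. \<pi> (Suc j) < \<pi> (Suc q)} \<union> {j \<in> S. \<pi> (Suc q) < \<pi> (Suc j)}" (is "_ = ?A \<union> ?B")
  proof (intro equalityI subsetI)
    fix j assume "j \<in> S - {q}"
    then have "\<pi> (Suc j) \<noteq> \<pi> (Suc q)" using injD[OF assms(1)] by blast
    then show "j \<in> ?A \<union> ?B" using \<open>j \<in> S - {q}\<close> by auto
  qed auto
  moreover have "card (?A \<union> ?B) = card ?A + card ?B"
    using assms(2) by (intro card_Un_disjoint) auto
  ultimately show ?thesis by (simp add: above_def below_def)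
qed


text \<open>Truncated subtraction turns comparisons into the numbers 0 and 1. Guards can then be
  multiplied into the values to be stored, and the program has no branching besides its
  loops.\<close>

definition le_exp :: "aexp \<Rightarrow> aexp \<Rightarrow> aexp" where
  "le_exp x y = Sub (Const 1) (Sub x y)"

definition eq_exp :: "aexp \<Rightarrow> aexp \<Rightarrow> aexp" where
  "eq_exp x y = Mul (le_exp x y) (le_exp y x)"

lemma aval_le_exp: "aval (le_exp x y) s = (if aval x s \<le> aval y s then 1 else 0)"
  by (simp add: le_exp_def)

lemma aval_eq_exp: "aval (eq_exp x y) s = (if aval x s = aval y s then 1 else 0)"
  by (auto simp: eq_exp_def aval_le_exp)

text \<open>Registers: 0 holds \<open>n\<close>, 1 the loop counter, 2 \<open>n + 1\<close>, 3 the bound of the loop, and in the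
  body of a loop 4 and 5 hold the coordinates of the current cell. The memory cell
  \<open>n + p * n + q\<close> holds \<open>count_less \<pi> p q\<close>.\<close>

definition count_exp :: "aexp \<Rightarrow> aexp \<Rightarrow> aexp" where
  "count_exp p q = Mem (Add (Reg 0) (Add (Mul p (Reg 0)) q))"

definition above_exp :: "aexp \<Rightarrow> aexp \<Rightarrow> aexp \<Rightarrow> aexp" where
  "above_exp q lo hi = Sub (count_exp hi q) (count_exp lo q)"

text \<open>The number \<open>k\<close> is 1 or 0 according to whether \<open>q\<close> belongs to
  the strip, and thus has to be left out of its cardinality.\<close>

definition below_exp :: "nat \<Rightarrow> aexp \<Rightarrow> aexp \<Rightarrow> aexp \<Rightarrow> aexp" where
  "below_exp k q lo hi = Sub (Sub (Sub hi lo) (Const k)) (above_exp q lo hi)"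

abbreviation a_exp :: "nat \<Rightarrow> aexp" where "a_exp k \<equiv> Add (Reg 4) (Const k)"
abbreviation b_exp :: "nat \<Rightarrow> aexp" where "b_exp k \<equiv> Sub (Reg 5) (Const k)"

definition rank_exp :: "nat \<Rightarrow> aexp" where
  "rank_exp r =
    (if r = 0 then Const 0
     else if r = 1 then above_exp (a_exp 0) (a_exp 0) (b_exp 0)
     else if r = 2 then below_exp 1 (a_exp 0) (a_exp 0) (b_exp 0)
     else if r = 3 then above_exp (b_exp 1) (a_exp 0) (b_exp 0)
     else if r = 4 then below_exp 1 (b_exp 1) (a_exp 0) (b_exp 0)
     else if r = 5 then above_exp (a_exp 1) (a_exp 0) (b_exp 0)
     else if r = 6 then below_exp 1 (a_exp 1) (a_exp 0) (b_exp 0)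
     else if r = 7 then above_exp (b_exp 2) (a_exp 0) (b_exp 0)
     else if r = 8 then below_exp 1 (b_exp 2) (a_exp 0) (b_exp 0)
     else if r = 9 then above_exp (a_exp 0) (a_exp 2) (b_exp 0)
     else if r = 10 then below_exp 0 (a_exp 0) (a_exp 2) (b_exp 0)
     else if r = 11 then above_exp (b_exp 1) (a_exp 0) (b_exp 2)
     else below_exp 0 (b_exp 1) (a_exp 0) (b_exp 2))"

text \<open>On the index \<open>a * (n + 1) + b\<close>, raising \<open>a\<close> by one adds
  \<open>n + 1\<close>, and lowering \<open>b\<close> by one subtracts 1.\<close>

definition shift_exp :: "nat \<Rightarrow> aexp" where
  "shift_exp h =
    (if h = 0 then Reg 1 else if h = 1 then Add (Reg 1) (Reg 2) else if h = 2 then Sub (Reg 1) (Const 1)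
     else if h = 3 then Add (Reg 1) (Add (Reg 2) (Reg 2)) else Sub (Reg 1) (Const 2))"

definition id_exp :: "aexp \<Rightarrow> nat \<Rightarrow> aexp" where
  "id_exp e c = Add (Mul (Const 9) e) (Const c)"

text \<open>An absent row is written as \<open>0, 0, 0\<close>, whence the factor that is the truth value of the guard.\<close>

fun row_exps :: "row \<Rightarrow> aexp list" where
  "row_exps (k, r, m, c, d, h, c') = map
     (Mul (Mul (le_exp (a_exp k) (Reg 5)) (eq_exp (rank_exp r) (Const m))))
     [id_exp (Reg 1) c, Const (dir_code d), id_exp (shift_exp h) c']"

text \<open>Pass \<open>i = p * n + q\<close> obtains the entry of row \<open>p + 1\<close> from
  that of row \<open>p\<close> and one comparison; its address \<open>2 * n + i\<close> equals
  \<open>n + ((p + 1) * n + q)\<close>. Row 0 consists of zeros and is supplied by the initial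
  memory.\<close>

definition table_body :: com where
  "table_body = Seq (Assign 4 (Quo (Reg 1) (Reg 0))) (Seq (Assign 5 (Sub (Reg 1) (Mul (Reg 4) (Reg 0))))
     (Seq (Store (Add (Add (Reg 0) (Reg 0)) (Reg 1))
            (Add (Mem (Add (Reg 0) (Reg 1))) (le_exp (Add (Mem (Reg 5)) (Const 1)) (Mem (Reg 4)))))
       (Assign 1 (Add (Reg 1) (Const 1)))))"

text \<open>Offset 4 accounts for the header: number of states, the initial list with its length,
  and the length of the final list. Offset 5 adds the word that holds the number of transitions.
  Each cell contributes 120 words, three for each of the 40 rows.\<close>

definition cell_body :: com where
  "cell_body = Seq (Assign 4 (Quo (Reg 1) (Reg 2))) (Seq (Assign 5 (Sub (Reg 1) (Mul (Reg 4) (Reg 2))))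
     (Seq (emit (Add (Reg 3) (Reg 1)) 4 [Mul (eq_exp (Reg 4) (Reg 5)) (id_exp (Reg 1) 0)])
       (Seq (emit (Add (Add (Reg 3) (Reg 3)) (Mul (Const 120) (Reg 1))) 5 (concat (map row_exps rows)))
         (Assign 1 (Add (Reg 1) (Const 1))))))"

text \<open>The table ends below the address \<open>(n + 1) * (n + 1)\<close>, where the code
  starts. In the second half, register 3 therefore serves both as loop bound and as base address,
  and it is finally handed over as the output address.\<close>

definition perm_program :: com where
  "perm_program = Seq (Assign 2 (Add (Reg 0) (Const 1))) (Seq (Assign 3 (Mul (Reg 0) (Reg 0)))
     (Seq (While (Less (Reg 1) (Reg 3)) table_body)
     (Seq (Assign 3 (Mul (Reg 2) (Reg 2))) (Seq (Assign 1 (Const 0))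
     (Seq (emit (Reg 3) 0 [Mul (Const 9) (Reg 3), Const 1, Mul (Const 9) (Reg 0), Reg 3])
     (Seq (emit (Add (Reg 3) (Reg 3)) 4 [Mul (Const 40) (Reg 3)])
     (Seq (While (Less (Reg 1) (Reg 3)) cell_body)
       (Assign 0 (Reg 3)))))))))"

lemma aval_above_exp:
  assumes C: "\<And>p q. p \<le> n \<Longrightarrow> q < n \<Longrightarrow> snd s (n + (p * n + q)) = count_less \<pi> p q"
    and n: "fst s 0 = n"
    and "aval lo s \<le> aval hi s" "aval hi s \<le> n" "aval q s < n"
  shows "aval (above_exp q lo hi) s = above \<pi> (aval q s) {aval lo s..<aval hi s}"
  using assms by (simp add: above_exp_def count_exp_def above_count)

lemma aval_below_exp:
  assumes C: "\<And>p q. p \<le> n \<Longrightarrow> q < n \<Longrightarrow> snd s (n + (p * n + q)) = count_less \<pi> p q"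
    and n: "fst s 0 = n"
    and le: "aval lo s \<le> aval hi s" "aval hi s \<le> n" "aval q s < n"
    and inj: "inj \<pi>"
    and k: "k = (if aval q s \<in> {aval lo s..<aval hi s} then 1 else 0)"
  shows "aval (below_exp k q lo hi) s = below \<pi> (aval q s) {aval lo s..<aval hi s}"
proof -
  have "card ({aval lo s..<aval hi s} - {aval q s}) = aval hi s - aval lo s - k"
    unfolding k by (auto simp: card_Diff_singleton_if)
  moreover have "aval (above_exp q lo hi) s = above \<pi> (aval q s) {aval lo s..<aval hi s}"
    by (rule aval_above_exp[OF C n le])
  ultimately show ?thesis
    unfolding below_above[OF inj finite_atLeastLessThan] by (simp add: below_exp_def)
qed

lemma aval_rank_exp:
  assumes C: "\<And>p q. p \<le> n \<Longrightarrow> q < n \<Longrightarrow> snd s (n + (p * n + q)) = count_less \<pi> p q"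
    and n: "fst s 0 = n" and ab: "fst s 4 = a" "fst s 5 = b"
    and inj: "inj \<pi>"
    and r: "r \<le> 12" "1 \<le> r \<Longrightarrow> a + 1 \<le> b" "5 \<le> r \<Longrightarrow> a + 2 \<le> b" and b: "b \<le> n"
  shows "aval (rank_exp r) s = rank \<pi> a b r"
proof -
  have "r = 0 \<or> r = 1 \<or> r = 2 \<or> r = 3 \<or> r = 4 \<or> r = 5 \<or> r = 6 \<or> r = 7 \<or> r = 8 \<or>
    r = 9 \<or> r = 10 \<or> r = 11 \<or> r = 12" using r(1) by presburger
  then consider "r = 0" | "r = 1" | "r = 2" | "r = 3" | "r = 4" | "r = 5" | "r = 6" | "r = 7" | "r = 8"
    | "r = 9" | "r = 10" | "r = 11" | "r = 12" by blast
  moreover have last: "\<not> b - Suc 0 < b - 2" by arith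
  ultimately show ?thesis
    using r(2,3) b
    by cases (simp_all add: last rank_exp_def rank.simps aval_above_exp[OF C n] aval_below_exp[OF C n _ _ _ inj] ab)
qed

lemma aval_shift_exp:
  assumes s: "fst s 1 = i" "fst s 2 = n + 1"
    and i: "i = a * (n + 1) + b"
    and h: "h \<le> 4" "h = 2 \<Longrightarrow> 1 \<le> b" "h = 4 \<Longrightarrow> 2 \<le> b"
  shows "aval (id_exp (shift_exp h) c) s = state_id n (fst (shift_cell h a b), snd (shift_cell h a b), c)"
proof -
  consider "h = 0" | "h = 1" | "h = 2" | "h = 3" | "h = 4" using h(1) by linarith
  then show ?thesis
    using h(2,3) by cases (simp_all add: id_exp_def shift_exp_def shift_cell.simps s[simplified] i algebra_simps)
qed

fun trans_code :: "nat \<times> dir \<times> nat \<Rightarrow> nat list" where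
  "trans_code (p, d, q) = [p, dir_code d, q]"

text \<open>If \<open>a + k \<le> b\<close> fails, the factor 0 wipes out all three entries,
  whatever the truncated subtractions in the other factors yield. Otherwise the points and strips in
  question exist and the expressions have their intended values.\<close>

lemma aval_row_exps:
  assumes C: "\<And>p q. p \<le> n \<Longrightarrow> q < n \<Longrightarrow> snd s (n + (p * n + q)) = count_less \<pi> p q"
    and s: "fst s 0 = n" "fst s 1 = i" "fst s 2 = n + 1" "fst s 4 = i div (n + 1)" "fst s 5 = i mod (n + 1)"
    and inj: "inj \<pi>"
    and row: "row \<in> set rows"
  shows "map (\<lambda>e. aval e s) (row_exps row) = trans_code (row_trans n \<pi> i row)"
proof -
  obtain k r m c d h c' where row': "row = (k, r, m, c, d, h, c')" by (rule prod_cases7)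
  have ok: "r \<le> 12" "h \<le> 4" "1 \<le> r \<Longrightarrow> 1 \<le> k" "5 \<le> r \<Longrightarrow> 2 \<le> k" "h = 2 \<Longrightarrow> 1 \<le> k" "h = 4 \<Longrightarrow> 2 \<le> k"
    using rows_ok[of k r m c d h c'] row row' by auto
  define a b where "a = i div (n + 1)" and "b = i mod (n + 1)"
  have b: "b \<le> n" unfolding b_def using mod_less_divisor[of "n + 1" i] by simp
  have i: "i = a * (n + 1) + b" unfolding a_def b_def by (rule div_mult_mod_eq[symmetric])
  have s4: "fst s 4 = a" "fst s 5 = b" using s(4,5) by (simp_all only: a_def b_def)
  have rt: "row_trans n \<pi> i row = (if a + k \<le> b \<and> rank \<pi> a b r = m
      then (9 * i + c, d, state_id n (fst (shift_cell h a b), snd (shift_cell h a b), c')) else (0, Up, 0))"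
    unfolding row' row_trans.simps Let_def a_def b_def ..
  show ?thesis
  proof (cases "a + k \<le> b")
    case True
    have rk: "aval (rank_exp r) s = rank \<pi> a b r"
      using ok True b by (intro aval_rank_exp[OF C s(1) _ _ inj]) (auto simp: s4)
    have sh: "aval (id_exp (shift_exp h) c') s = state_id n (fst (shift_cell h a b), snd (shift_cell h a b), c')"
      using ok True by (intro aval_shift_exp[OF s(2,3) i]) auto
    have id: "aval (id_exp (Reg 1) c) s = 9 * i + c" by (simp add: id_exp_def s[simplified])
    show ?thesis
      unfolding rt using True by (simp add: row' rk sh id[simplified] aval_le_exp aval_eq_exp s4 del: state_id.simps)
  next
    case False
    then show ?thesis
      unfolding rt by (simp add: row' aval_le_exp s4)
  qed
qed

definition cells :: "nat \<Rightarrow> nat" where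
  "cells n = (n + 1) * (n + 1)"

definition reg_bound :: "nat \<Rightarrow> nat \<Rightarrow> nat" where
  "reg_bound n x = (if x = 1 \<or> x = 3 then cells n else n + 1)"

text \<open>The constants are generous. The code has \<open>121 * cells n + 5\<close> words starting
  at \<open>cells n\<close>; stored words are at most \<open>40 * cells n\<close>, a value attained
  by the number of transitions; the word size leaves room for the estimates of intermediate
  results.\<close>

abbreviation exec' :: "nat \<Rightarrow> com \<Rightarrow> state \<Rightarrow> nat \<Rightarrow> state \<Rightarrow> bool" where
  "exec' n \<equiv> exec (1000 * cells n) (200 * cells n)"

abbreviation word_ok' :: "nat \<Rightarrow> aexp \<Rightarrow> bool" where
  "word_ok' n \<equiv> word_ok (1000 * cells n) (200 * cells n) (reg_bound n) (40 * cells n)"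

abbreviation upper' :: "nat \<Rightarrow> aexp \<Rightarrow> nat" where
  "upper' n \<equiv> upper (reg_bound n) (40 * cells n)"

lemma reg_bound_simps [simp]:
  "reg_bound n 0 = n + 1" "reg_bound n (Suc 0) = cells n" "reg_bound n 2 = n + 1"
  "reg_bound n 3 = cells n" "reg_bound n 4 = n + 1" "reg_bound n 5 = n + 1"
  by (simp_all add: reg_bound_def)

text \<open>With these facts the size checks become linear in \<open>n\<close>, \<open>n * n\<close>
  and \<open>cells n\<close>.\<close>

lemma cells_bounds:
  assumes "1 \<le> n"
  shows "n * n + 2 * n + 1 = cells n" "4 \<le> cells n" "n + 1 \<le> cells n"
proof -
  show "n * n + 2 * n + 1 = cells n" by (simp add: cells_def)
  moreover have "1 * 1 \<le> n * n" using assms by (intro mult_mono) auto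
  ultimately show "4 \<le> cells n" "n + 1 \<le> cells n" using assms by linarith+
qed

lemma word_ok_rank_exp:
  assumes "1 \<le> n" "r \<le> 12"
  shows "word_ok' n (rank_exp r) \<and> upper' n (rank_exp r) \<le> 40 * cells n"
proof -
  have "r = 0 \<or> r = 1 \<or> r = 2 \<or> r = 3 \<or> r = 4 \<or> r = 5 \<or> r = 6 \<or> r = 7 \<or> r = 8 \<or>
    r = 9 \<or> r = 10 \<or> r = 11 \<or> r = 12" using assms(2) by presburger
  then consider "r = 0" | "r = 1" | "r = 2" | "r = 3" | "r = 4" | "r = 5" | "r = 6" | "r = 7" | "r = 8"
    | "r = 9" | "r = 10" | "r = 11" | "r = 12" by blast
  then show ?thesis
    using cells_bounds[OF assms(1)]
    by cases (simp_all add: rank_exp_def above_exp_def below_exp_def count_exp_def algebra_simps)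
qed

lemma word_ok_id_exp:
  assumes "1 \<le> n" "h \<le> 4" "c < 9"
  shows "word_ok' n (id_exp (shift_exp h) c) \<and> upper' n (id_exp (shift_exp h) c) \<le> 40 * cells n"
proof -
  consider "h = 0" | "h = 1" | "h = 2" | "h = 3" | "h = 4" using assms(2) by linarith
  then show ?thesis
    using cells_bounds[OF assms(1)] assms(3)
    by cases (simp_all add: id_exp_def shift_exp_def)
qed

text \<open>The guard is bounded by 1, so multiplying by it does not enlarge the estimate for the
  other factor.\<close>

lemma word_ok_row_exps:
  assumes n: "1 \<le> n" and row: "row \<in> set rows" and e: "e \<in> set (row_exps row)"
  shows "word_ok' n e \<and> upper' n e \<le> 40 * cells n"
proof -
  obtain k r m c d h c' where row': "row = (k, r, m, c, d, h, c')" by (rule prod_cases7)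
  have ok: "r \<le> 12" "h \<le> 4" "k \<le> 2" "m \<le> 1" "c < 9" "c' < 9"
    using rows_ok[of k r m c d h c'] row row' by auto
  let ?g = "Mul (le_exp (a_exp k) (Reg 5)) (eq_exp (rank_exp r) (Const m))"
  have g: "word_ok' n ?g" "upper' n ?g = 1"
    using cells_bounds[OF n] ok word_ok_rank_exp[OF n ok(1)]
    by (simp_all add: le_exp_def eq_exp_def)
  have "word_ok' n (id_exp (Reg 1) c) \<and> upper' n (id_exp (Reg 1) c) \<le> 40 * cells n"
    using word_ok_id_exp[OF n _ ok(5), of 0] by (simp add: shift_exp_def)
  moreover have "dir_code d \<le> 3" by (cases d) auto
  then have "word_ok' n (Const (dir_code d)) \<and> upper' n (Const (dir_code d)) \<le> 40 * cells n"
    using cells_bounds[OF n] by simp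
  ultimately have "\<forall>x\<in>set [id_exp (Reg 1) c, Const (dir_code d), id_exp (shift_exp h) c'].
      word_ok' n x \<and> upper' n x \<le> 40 * cells n"
    using word_ok_id_exp[OF n ok(2,6)] by simp
  moreover obtain x where x: "e = Mul ?g x" "x \<in> set [id_exp (Reg 1) c, Const (dir_code d), id_exp (shift_exp h) c']"
    using e unfolding row' row_exps.simps set_map by blast
  ultimately have "word_ok' n x" "upper' n x \<le> 40 * cells n" by blast+
  then show ?thesis
    unfolding x(1) word_ok.simps(6)[of _ _ _ _ ?g x] upper.simps(6)[of _ _ ?g x] g(2)
    using g(1) cells_bounds(2)[OF n] by (simp del: word_ok.simps)
qed

section \<open>Layout of the code in memory and the loop invariants\<close>

definition row_codes :: "nat \<Rightarrow> (nat \<Rightarrow> nat) \<Rightarrow> nat \<Rightarrow> nat list" where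
  "row_codes n \<pi> i = concat (map (\<lambda>row. trans_code (row_trans n \<pi> i row)) rows)"

lemma length_rows: "length rows = 40"
  by (simp add: rows_def)

lemma length_row_codes: "length (row_codes n \<pi> i) = 120"
proof -
  have "length (trans_code x) = 3" for x by (cases x) simp
  then have "length (row_codes n \<pi> i) = sum_list (map (\<lambda>_. 3) rows)"
    unfolding row_codes_def length_concat by (simp add: comp_def)
  then show ?thesis by (simp add: sum_list_triv length_rows)
qed

definition stored :: "(nat \<Rightarrow> nat) \<Rightarrow> nat \<Rightarrow> nat list \<Rightarrow> bool" where
  "stored mem b xs \<longleftrightarrow> (\<forall>j<length xs. mem (b + j) = xs ! j)"

lemma stored_append: "stored mem b (xs @ ys) \<longleftrightarrow> stored mem b xs \<and> stored mem (b + length xs) ys"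
proof
  assume s: "stored mem b (xs @ ys)"
  have "mem (b + j) = xs ! j" if "j < length xs" for j
    using s that unfolding stored_def by (auto simp: nth_append dest!: spec[of _ j])
  moreover have "mem (b + length xs + j) = ys ! j" if "j < length ys" for j
    using s that unfolding stored_def by (auto simp: nth_append add.assoc dest!: spec[of _ "length xs + j"])
  ultimately show "stored mem b xs \<and> stored mem (b + length xs) ys" unfolding stored_def by blast
next
  assume s: "stored mem b xs \<and> stored mem (b + length xs) ys"
  show "stored mem b (xs @ ys)"
    unfolding stored_def
  proof (intro allI impI)
    fix j assume j: "j < length (xs @ ys)"
    show "mem (b + j) = (xs @ ys) ! j"
    proof (cases "j < length xs")
      case True
      then show ?thesis using s by (simp add: stored_def nth_append)
    next
      case False
      then have "j - length xs < length ys" "b + length xs + (j - length xs) = b + j" using j by auto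
      then have "mem (b + j) = ys ! (j - length xs)"
        using s unfolding stored_def by metis
      then show ?thesis using False by (simp add: nth_append)
    qed
  qed
qed

lemma stored_concat:
  "(\<And>i. i < k \<Longrightarrow> length (f i) = l \<and> stored mem (b + l * i) (f i)) \<Longrightarrow>
    stored mem b (concat (map f [0..<k])) \<and> length (concat (map f [0..<k])) = l * k"
proof (induction k)
  case 0
  then show ?case by (simp add: stored_def)
next
  case (Suc k)
  then have "stored mem b (concat (map f [0..<k]))" "length (concat (map f [0..<k])) = l * k" by auto
  moreover have "length (f k) = l" "stored mem (b + l * k) (f k)" using Suc.prems[of k] by auto
  ultimately show ?case by (simp add: stored_append)
qed

lemma exec_Assign: "afits W M a (r, mem) \<Longrightarrow> aval a (r, mem) = v \<Longrightarrow>
    exec W M (Assign x a) (r, mem) 1 (r(x := v), mem)"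
  using exec.Assign[of W M a "(r, mem)" x] by simp

text \<open>This is the invariant \<open>G\<close> for \<open>exec_emit\<close>: with the table
  intact and all words bounded, the emitted expressions keep their values. The table ends before the
  address \<open>cells n\<close>, where the output begins.\<close>

definition table_done :: "nat \<Rightarrow> (nat \<Rightarrow> nat) \<Rightarrow> (nat \<Rightarrow> nat) \<Rightarrow> bool" where
  "table_done n \<pi> mem \<longleftrightarrow> (\<forall>p q. p \<le> n \<longrightarrow> q < n \<longrightarrow> mem (n + (p * n + q)) = count_less \<pi> p q) \<and>
     (\<forall>x. mem x \<le> 40 * cells n)"

definition cell_codes :: "nat \<Rightarrow> nat \<Rightarrow> nat" where
  "cell_codes n i = (if i div (n + 1) = i mod (n + 1) then 9 * i else 0)"

definition cell_inv :: "nat \<Rightarrow> (nat \<Rightarrow> nat) \<Rightarrow> nat \<Rightarrow> state \<Rightarrow> bool" where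
  "cell_inv n \<pi> i s \<longleftrightarrow> (case s of (r, mem) \<Rightarrow>
     i \<le> cells n \<and> r 0 = n \<and> r 1 = i \<and> r 2 = n + 1 \<and> r 3 = cells n \<and> (\<forall>x<6. r x \<le> reg_bound n x) \<and>
     table_done n \<pi> mem \<and> stored mem (cells n) [9 * cells n, 1, 9 * n, cells n] \<and>
     mem (2 * cells n + 4) = 40 * cells n \<and>
     (\<forall>j<i. mem (cells n + 4 + j) = cell_codes n j) \<and>
     (\<forall>j<i. stored mem (2 * cells n + 5 + 120 * j) (row_codes n \<pi> j)))"

lemma table_done_upd:
  assumes "table_done n \<pi> mem" "cells n \<le> x" "u \<le> 40 * cells n"
  shows "table_done n \<pi> (mem(x := u))"
proof -
  have "n + (p * n + q) \<noteq> x" if "p \<le> n" "q < n" for p q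
  proof -
    have "p * n \<le> n * n" using that by simp
    moreover have "n * n + 2 * n + 1 = cells n" by (simp add: cells_def)
    ultimately show ?thesis using that assms(2) by linarith
  qed
  then show ?thesis using assms(1,3) unfolding table_done_def by auto
qed

text \<open>The 126 steps are three assignments, 2 steps for the entry in the final list and 121 for
  the transitions; each \<open>emit\<close> ends with a \<open>Skip\<close>.\<close>

lemma exec_cell_body:
  assumes n: "1 \<le> n" and inj: "inj \<pi>" and i: "i < cells n" and inv: "cell_inv n \<pi> i s"
  shows "\<exists>t s'. t \<le> 126 \<and> exec' n cell_body s t s' \<and> cell_inv n \<pi> (Suc i) s'"
proof -
  obtain r mem where s: "s = (r, mem)" by (cases s)
  note cb = cells_bounds[OF n]
  let ?W = "1000 * cells n" and ?M = "200 * cells n" and ?V = "40 * cells n"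
  have r: "r 0 = n" "r 1 = i" "r 2 = n + 1" "r 3 = cells n" and rb: "\<forall>x<6. r x \<le> reg_bound n x"
    and G: "table_done n \<pi> mem" and hdr: "stored mem (cells n) [9 * cells n, 1, 9 * n, cells n]"
    "mem (2 * cells n + 4) = 40 * cells n"
    and fin: "\<And>j. j < i \<Longrightarrow> mem (cells n + 4 + j) = cell_codes n j"
    and trs: "\<And>j. j < i \<Longrightarrow> stored mem (2 * cells n + 5 + 120 * j) (row_codes n \<pi> j)"
    using inv unfolding s cell_inv_def by auto
  have mb: "\<forall>x. snd (r', m) x \<le> ?V" if "table_done n \<pi> m" for r' m
    using that unfolding table_done_def by simp
  have fits: "afits ?W ?M e (r', m)"
    if "word_ok' n e" "\<forall>x<6. r' x \<le> reg_bound n x" "table_done n \<pi> m" for e r' m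
    using word_ok_afits[OF that(1), of "(r', m)"] that(2) mb[OF that(3)] by simp
  define a b where "a = i div (n + 1)" and "b = i mod (n + 1)"
  have b: "b \<le> n" unfolding b_def using mod_less_divisor[of "n + 1" i] by simp
  have a: "a \<le> n"
    using i unfolding a_def cells_def
    by (simp add: less_mult_imp_div_less flip: less_Suc_eq_le)
  define r1 where "r1 = r(4 := a)"
  define r2 where "r2 = r1(5 := b)"
  have rb1: "\<forall>x<6. r1 x \<le> reg_bound n x" using rb a by (auto simp: r1_def)
  have rb2: "\<forall>x<6. r2 x \<le> reg_bound n x" using rb1 b by (auto simp: r2_def)
  have r2: "r2 0 = n" "r2 1 = i" "r2 2 = n + 1" "r2 3 = cells n" "r2 4 = a" "r2 5 = b"
    using r by (simp_all add: r2_def r1_def)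
  have x1: "exec' n (Assign 4 (Quo (Reg 1) (Reg 2))) (r, mem) 1 (r1, mem)"
    unfolding r1_def by (rule exec_Assign, rule fits[OF _ rb G]) (use cb r in \<open>simp_all add: a_def\<close>)
  have x2: "exec' n (Assign 5 (Sub (Reg 1) (Mul (Reg 4) (Reg 2)))) (r1, mem) 1 (r2, mem)"
    unfolding r2_def
  proof (rule exec_Assign, rule fits[OF _ rb1 G])
    show "word_ok' n (Sub (Reg 1) (Mul (Reg 4) (Reg 2)))"
      using cb by (simp add: cells_def)
    show "aval (Sub (Reg 1) (Mul (Reg 4) (Reg 2))) (r1, mem) = b"
      using r by (simp add: r1_def a_def b_def minus_div_mult_eq_mod del: mult_Suc_right)
  qed
  let ?X = "Add (Reg 3) (Reg 1)" and ?f = "Mul (eq_exp (Reg 4) (Reg 5)) (id_exp (Reg 1) 0)"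
  have f: "word_ok' n ?f" "aval ?f (r2, m) = cell_codes n i" for m
  proof -
    show "word_ok' n ?f" using cb by (simp add: eq_exp_def le_exp_def id_exp_def)
    have "aval (id_exp (Reg 1) 0) (r2, m) = 9 * i" using r2 by (simp add: id_exp_def)
    then show "aval ?f (r2, m) = cell_codes n i"
      unfolding cell_codes_def a_def[symmetric] b_def[symmetric] using r2 by (simp add: aval_eq_exp)
  qed
  have cc: "cell_codes n i \<le> ?V" using i by (simp add: cell_codes_def)
  have "\<exists>mem1. exec' n (emit ?X 4 [?f]) (r2, mem) (length [?f] + 1) (r2, mem1) \<and>
    table_done n \<pi> mem1 \<and> (\<forall>j<length [?f]. mem1 (cells n + i + 4 + j) = [cell_codes n i] ! j) \<and>
    (\<forall>x. x < cells n + i + 4 \<or> cells n + i + 4 + length [?f] \<le> x \<longrightarrow> mem1 x = mem x)"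
  proof (rule exec_emit[where G = "table_done n \<pi>" and V = ?V])
    show "aval ?X (r2, m) = cells n + i \<and> afits ?W ?M ?X (r2, m)" for m
      using r2 i cb by simp
    show "list_all2 (\<lambda>e u. u \<le> ?V \<and> (\<forall>mem. table_done n \<pi> mem \<longrightarrow> afits ?W ?M e (r2, mem) \<and> aval e (r2, mem) = u))
        [?f] [cell_codes n i]"
      using fits[OF f(1) rb2] f(2) cc by auto
  qed (use G i cb table_done_upd in auto)
  then obtain mem1 where x3': "exec' n (emit ?X 4 [?f]) (r2, mem) (length [?f] + 1) (r2, mem1)"
    and G1: "table_done n \<pi> mem1"
    and m1': "\<forall>j<length [?f]. mem1 (cells n + i + 4 + j) = [cell_codes n i] ! j"
    and k1': "\<forall>x. x < cells n + i + 4 \<or> cells n + i + 4 + length [?f] \<le> x \<longrightarrow> mem1 x = mem x"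
    by blast
  have x3: "exec' n (emit ?X 4 [?f]) (r2, mem) 2 (r2, mem1)"
  proof -
    have "length [?f] + 1 = 2" by simp
    then show ?thesis using x3' by (simp only:)
  qed
  have m1: "mem1 (cells n + i + 4) = cell_codes n i"
    using m1'[rule_format, of 0] by simp
  have k1: "mem1 x = mem x" if "x \<noteq> cells n + i + 4" for x
    using k1'[rule_format, of x] that by force
  let ?Y = "Add (Add (Reg 3) (Reg 3)) (Mul (Const 120) (Reg 1))" and ?es = "concat (map row_exps rows)"
  have vals: "map (\<lambda>e. aval e (r2, m)) ?es = row_codes n \<pi> i" if m: "table_done n \<pi> m" for m
  proof -
    have "map (\<lambda>e. aval e (r2, m)) (row_exps row) = trans_code (row_trans n \<pi> i row)" if "row \<in> set rows" for row
      using that r2 m by (intro aval_row_exps[OF _ _ _ _ _ _ inj]) (auto simp: table_done_def a_def b_def)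
    then show ?thesis unfolding row_codes_def map_concat by (simp add: comp_def cong: map_cong)
  qed
  have len: "length ?es = 120" using vals[OF G] length_row_codes[of n \<pi> i] by (metis length_map)
  have es: "word_ok' n e" "upper' n e \<le> ?V" if "e \<in> set ?es" for e
    using that word_ok_row_exps[OF n] by auto
  have "\<exists>mem2. exec' n (emit ?Y 5 ?es) (r2, mem1) (length ?es + 1) (r2, mem2) \<and>
    table_done n \<pi> mem2 \<and> (\<forall>j<length ?es. mem2 (2 * cells n + 120 * i + 5 + j) = row_codes n \<pi> i ! j) \<and>
    (\<forall>x. x < 2 * cells n + 120 * i + 5 \<or> 2 * cells n + 120 * i + 5 + length ?es \<le> x \<longrightarrow> mem2 x = mem1 x)"
  proof (rule exec_emit[where G = "table_done n \<pi>" and V = ?V])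
    show "aval ?Y (r2, m) = 2 * cells n + 120 * i \<and> afits ?W ?M ?Y (r2, m)" for m
      using r2 i cb by simp
    show "list_all2 (\<lambda>e u. u \<le> ?V \<and> (\<forall>mem. table_done n \<pi> mem \<longrightarrow> afits ?W ?M e (r2, mem) \<and> aval e (r2, mem) = u))
        ?es (row_codes n \<pi> i)"
      unfolding list_all2_conv_all_nth
    proof (intro conjI allI impI)
      show "length ?es = length (row_codes n \<pi> i)" by (simp only: len length_row_codes)
      fix j assume j: "j < length ?es"
      have v: "aval (?es ! j) (r2, m) = row_codes n \<pi> i ! j" if "table_done n \<pi> m" for m
        using vals[OF that] j by (metis nth_map)
      have e: "?es ! j \<in> set ?es" using j by (rule nth_mem)
      have "aval (?es ! j) (r2, mem) \<le> upper' n (?es ! j)"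
        using aval_upper[OF es(1)[OF e], of "(r2, mem)"] rb2 mb[OF G] by simp
      then show "row_codes n \<pi> i ! j \<le> ?V" using v[OF G] es(2)[OF e] by linarith
      fix m assume "table_done n \<pi> m"
      then show "afits ?W ?M (?es ! j) (r2, m)" "aval (?es ! j) (r2, m) = row_codes n \<pi> i ! j"
        using fits[OF es(1)[OF e] rb2] v by blast+
    qed
    show "2 * cells n + 120 * i + 5 + length ?es \<le> ?M" unfolding len using i cb by linarith
  qed (use G1 cb table_done_upd in auto)
  then obtain mem2 where x4: "exec' n (emit ?Y 5 ?es) (r2, mem1) 121 (r2, mem2)"
    and G2: "table_done n \<pi> mem2" and m2: "stored mem2 (2 * cells n + 5 + 120 * i) (row_codes n \<pi> i)"
    and k2: "\<And>x. x < 2 * cells n + 120 * i + 5 \<Longrightarrow> mem2 x = mem1 x"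
    unfolding len stored_def length_row_codes by (auto simp: ac_simps)
  define r3 where "r3 = r2(1 := Suc i)"
  have x5: "exec' n (Assign 1 (Add (Reg 1) (Const 1))) (r2, mem2) 1 (r3, mem2)"
    unfolding r3_def by (rule exec_Assign, rule fits[OF _ rb2 G2]) (use cb r2 in simp_all)
  have "exec' n cell_body s (1 + (1 + (2 + (121 + 1)))) (r3, mem2)"
    unfolding s cell_body_def by (intro exec.Seq[OF x1] exec.Seq[OF x2] exec.Seq[OF x3] exec.Seq[OF x4] x5)
  moreover have "cell_inv n \<pi> (Suc i) (r3, mem2)"
    unfolding cell_inv_def prod.case
  proof (intro conjI allI impI)
    show "r3 x \<le> reg_bound n x" if "x < 6" for x
      using rb2 i that by (auto simp: r3_def reg_bound_def)
    show "stored mem2 (cells n) [9 * cells n, 1, 9 * n, cells n]"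
      using hdr(1) cb by (auto simp: stored_def k1 k2 less_Suc_eq numeral_eq_Suc)
    show "mem2 (2 * cells n + 4) = 40 * cells n" using hdr(2) i by (simp add: k1 k2)
    show "mem2 (cells n + 4 + j) = cell_codes n j" if "j < Suc i" for j
    proof (cases "j = i")
      case True
      then show ?thesis using m1 i by (simp add: k2 ac_simps)
    next
      case False
      then show ?thesis using fin[of j] that i by (simp add: k1 k2)
    qed
    show "stored mem2 (2 * cells n + 5 + 120 * j) (row_codes n \<pi> j)" if "j < Suc i" for j
    proof (cases "j = i")
      case True
      then show ?thesis using m2 by simp
    next
      case False
      then have "j < i" using that by simp
      then show ?thesis using trs[of j] i by (simp add: stored_def length_row_codes k1 k2)
    qed
  qed (use i r2 G2 in \<open>simp_all add: r3_def\<close>)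
  ultimately show ?thesis by force
qed


text \<open>The addresses from \<open>n\<close> to \<open>2 * n - 1\<close> form row 0 of the table,
  which is zero from the start. Hence the part of the memory known in \<open>table_inv\<close>
  already reaches up to \<open>2 * n\<close> before the first pass.\<close>

definition table_cell :: "nat \<Rightarrow> (nat \<Rightarrow> nat) \<Rightarrow> nat \<Rightarrow> nat" where
  "table_cell n \<pi> y = (if y < n then \<pi> (Suc y) else count_less \<pi> ((y - n) div n) ((y - n) mod n))"

definition table_inv :: "nat \<Rightarrow> (nat \<Rightarrow> nat) \<Rightarrow> nat \<Rightarrow> state \<Rightarrow> bool" where
  "table_inv n \<pi> i s \<longleftrightarrow> (case s of (r, mem) \<Rightarrow>
     i \<le> n * n \<and> r 0 = n \<and> r 1 = i \<and> r 2 = n + 1 \<and> r 3 = n * n \<and> (\<forall>x<6. r x \<le> reg_bound n x) \<and>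
     (\<forall>y<2 * n + i. mem y = table_cell n \<pi> y) \<and> (\<forall>x. mem x \<le> 40 * cells n))"

lemma exec_table_body:
  assumes n: "1 \<le> n" and i: "i < n * n" and inv: "table_inv n \<pi> i s"
  shows "\<exists>t s'. t \<le> 4 \<and> exec' n table_body s t s' \<and> table_inv n \<pi> (Suc i) s'"
proof -
  obtain r mem where s: "s = (r, mem)" by (cases s)
  note cb = cells_bounds[OF n]
  let ?W = "1000 * cells n" and ?M = "200 * cells n" and ?V = "40 * cells n"
  have r: "r 0 = n" "r 1 = i" "r 2 = n + 1" "r 3 = n * n" and rb: "\<forall>x<6. r x \<le> reg_bound n x"
    and tab: "\<And>y. y < 2 * n + i \<Longrightarrow> mem y = table_cell n \<pi> y" and mb: "\<forall>x. mem x \<le> ?V"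
    using inv unfolding s table_inv_def by auto
  have fits: "afits ?W ?M e (r', mem)" if "word_ok' n e" "\<forall>x<6. r' x \<le> reg_bound n x" for e r'
    using word_ok_afits[OF that(1), of "(r', mem)"] that(2) mb by simp
  define p q where "p = i div n" and "q = i mod n"
  have q: "q < n" unfolding q_def using n by simp
  have p: "p < n" unfolding p_def using i by (simp add: less_mult_imp_div_less)
  define r1 where "r1 = r(4 := p)"
  define r2 where "r2 = r1(5 := q)"
  have rb1: "\<forall>x<6. r1 x \<le> reg_bound n x" using rb p by (auto simp: r1_def)
  have rb2: "\<forall>x<6. r2 x \<le> reg_bound n x" using rb1 q by (auto simp: r2_def)
  have r2: "r2 0 = n" "r2 1 = i" "r2 2 = n + 1" "r2 3 = n * n" "r2 4 = p" "r2 5 = q"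
    using r by (simp_all add: r2_def r1_def)
  have x1: "exec' n (Assign 4 (Quo (Reg 1) (Reg 0))) (r, mem) 1 (r1, mem)"
    unfolding r1_def by (rule exec_Assign, rule fits[OF _ rb]) (use cb r in \<open>simp_all add: p_def\<close>)
  have x2: "exec' n (Assign 5 (Sub (Reg 1) (Mul (Reg 4) (Reg 0)))) (r1, mem) 1 (r2, mem)"
    unfolding r2_def
  proof (rule exec_Assign, rule fits[OF _ rb1])
    show "word_ok' n (Sub (Reg 1) (Mul (Reg 4) (Reg 0)))"
      using cb by (simp add: cells_def)
    show "aval (Sub (Reg 1) (Mul (Reg 4) (Reg 0))) (r1, mem) = q"
      using r by (simp add: r1_def p_def q_def minus_div_mult_eq_mod)
  qed
  let ?a = "Add (Add (Reg 0) (Reg 0)) (Reg 1)"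
  let ?e = "Add (Mem (Add (Reg 0) (Reg 1))) (le_exp (Add (Mem (Reg 5)) (Const 1)) (Mem (Reg 4)))"
  have a: "aval ?a (r2, mem) = 2 * n + i" "afits ?W ?M ?a (r2, mem)"
    using r2 cb by (simp, intro fits[OF _ rb2], simp)
  have e: "afits ?W ?M ?e (r2, mem)"
    using cb by (intro fits[OF _ rb2]) (simp add: le_exp_def)
  define u where "u = aval ?e (r2, mem)"
  have u: "u = count_less \<pi> (Suc p) q"
  proof -
    have "mem (n + i) = count_less \<pi> p q" using tab[of "n + i"] n by (simp add: table_cell_def p_def q_def)
    moreover have "mem q = \<pi> (Suc q)" "mem p = \<pi> (Suc p)"
      using tab[of q] tab[of p] p q by (simp_all add: table_cell_def)
    ultimately show ?thesis
      using r2 by (simp add: u_def aval_le_exp count_less_Suc)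
  qed
  define mem' where "mem' = mem(2 * n + i := u)"
  have x3: "exec' n (Store ?a ?e) (r2, mem) 1 (r2, mem')"
    using exec.Store[OF a(2) e] a(1) i cb unfolding mem'_def u_def by simp
  define r3 where "r3 = r2(1 := Suc i)"
  have uV: "u \<le> ?V" using count_less_le[of \<pi> "Suc p" q] p cb unfolding u by linarith
  have x4: "exec' n (Assign 1 (Add (Reg 1) (Const 1))) (r2, mem') 1 (r3, mem')"
    unfolding r3_def
  proof (rule exec_Assign)
    show "afits ?W ?M (Add (Reg 1) (Const 1)) (r2, mem')"
      using r2 i cb by simp
  qed (use r2 in simp)
  have "exec' n table_body s (1 + (1 + (1 + 1))) (r3, mem')"
    unfolding s table_body_def by (intro exec.Seq[OF x1] exec.Seq[OF x2] exec.Seq[OF x3] x4)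
  moreover have "table_inv n \<pi> (Suc i) (r3, mem')"
    unfolding table_inv_def prod.case
  proof (intro conjI allI impI)
    show "r3 x \<le> reg_bound n x" if "x < 6" for x
      using rb2 i cb that by (auto simp: r3_def reg_bound_def)
    show "mem' y = table_cell n \<pi> y" if "y < 2 * n + Suc i" for y
    proof (cases "y = 2 * n + i")
      case True
      have "table_cell n \<pi> y = count_less \<pi> ((n + i) div n) ((n + i) mod n)"
        unfolding True table_cell_def by simp
      then show ?thesis using n unfolding True mem'_def u p_def q_def by simp
    next
      case False
      then show ?thesis using tab[of y] that by (simp add: mem'_def)
    qed
    show "mem' x \<le> ?V" for x using mb uV by (simp add: mem'_def)
  qed (use i r2 in \<open>simp_all add: r3_def\<close>)
  ultimately show ?thesis by (intro exI[of _ "1 + (1 + (1 + 1))"] exI[of _ "(r3, mem')"]) simp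
qed

lemma table_inv_done:
  assumes "1 \<le> n" "table_inv n \<pi> (n * n) (r, mem)"
  shows "table_done n \<pi> mem"
  unfolding table_done_def
proof (intro conjI allI impI)
  fix p q assume pq: "p \<le> n" "q < n"
  then have "p * n \<le> n * n" by simp
  then have "n + (p * n + q) < 2 * n + n * n" using pq(2) by linarith
  then have "mem (n + (p * n + q)) = table_cell n \<pi> (n + (p * n + q))"
    using assms(2) unfolding table_inv_def by auto
  then show "mem (n + (p * n + q)) = count_less \<pi> p q"
    using pq by (simp add: table_cell_def)
qed (use assms(2) in \<open>auto simp: table_inv_def\<close>)

section \<open>The output code and the total cost\<close>

lemma fa_code_perm_nfa:
  "fa_code (perm_nfa n \<pi>) = [9 * cells n, 1, 9 * n, cells n] @ map (cell_codes n) [0..<cells n] @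
     [40 * cells n] @ concat (map (row_codes n \<pi>) [0..<cells n])"
proof -
  have sq: "(n + 1)\<^sup>2 = cells n" by (simp add: power2_eq_square cells_def)
  have code: "(\<lambda>(p, a, q). [p, dir_code a, q]) = trans_code" by auto
  have "length (concat (map (\<lambda>i. map (row_trans n \<pi> i) rows) [0..<k])) = 40 * k" for k
    by (induction k) (simp_all add: length_rows)
  moreover have "concat (map trans_code (concat (map (\<lambda>i. map (row_trans n \<pi> i) rows) [0..<k]))) =
      concat (map (row_codes n \<pi>) [0..<k])" for k
    by (induction k) (simp_all add: row_codes_def comp_def)
  ultimately show ?thesis
    unfolding fa_code_def code perm_nfa_def sq by (simp add: cell_codes_def[abs_def])
qed

lemma exec_perm_program:
  assumes n: "1 \<le> n" and perm: "\<pi> permutes {1..n}"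
  shows "\<exists>t s. exec' n perm_program (input_state n \<pi>) t s \<and> t \<le> 200 * cells n \<and>
    outputs (200 * cells n) s (perm_nfa n \<pi>)"
proof -
  note cb = cells_bounds[OF n]
  let ?W = "1000 * cells n" and ?M = "200 * cells n" and ?V = "40 * cells n"
  define mem0 where "mem0 = (\<lambda>i. if i < n then \<pi> (Suc i) else 0)"
  define r0 :: "nat \<Rightarrow> nat" where "r0 = (\<lambda>_. 0)(0 := n)"
  have inj: "inj \<pi>" using perm by (rule permutes_inj)
  have init: "input_state n \<pi> = (r0, mem0)" by (simp add: input_state_def r0_def mem0_def)
  have mb0: "\<forall>x. mem0 x \<le> ?V"
  proof
    fix x
    have "\<pi> (Suc x) \<le> n" if "x < n" using permutes_in_image[OF perm, of "Suc x"] that by simp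
    then show "mem0 x \<le> ?V" using cb unfolding mem0_def by (cases "x < n") auto
  qed
  define r1 where "r1 = r0(2 := n + 1)"
  define r2 where "r2 = r1(3 := n * n)"
  have x1: "exec' n (Assign 2 (Add (Reg 0) (Const 1))) (r0, mem0) 1 (r1, mem0)"
    unfolding r1_def by (rule exec_Assign) (use cb in \<open>simp_all add: r0_def\<close>)
  have x2: "exec' n (Assign 3 (Mul (Reg 0) (Reg 0))) (r1, mem0) 1 (r2, mem0)"
    unfolding r2_def by (rule exec_Assign) (use cb in \<open>simp_all add: r1_def r0_def\<close>)
  have "table_inv n \<pi> 0 (r2, mem0)"
    unfolding table_inv_def prod.case
  proof (intro conjI allI impI)
    show "r2 x \<le> reg_bound n x" if "x < 6" for x
      using cb by (auto simp: r2_def r1_def r0_def reg_bound_def)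
    show "mem0 y = table_cell n \<pi> y" if "y < 2 * n + 0" for y
      using that by (auto simp: mem0_def table_cell_def)
    show "mem0 x \<le> ?V" for x using mb0 by blast
  qed (simp_all add: r2_def r1_def r0_def)
  moreover have "fst s 1 = i \<and> fst s 3 = n * n" if "table_inv n \<pi> i s" for i s
    using that by (auto simp: table_inv_def)
  moreover have "n * n < ?W" using cb by linarith
  ultimately obtain t3 s3 where t3: "t3 \<le> (n * n - 0) * (4 + 1) + 1"
    and x3: "exec' n (While (Less (Reg 1) (Reg 3)) table_body) (r2, mem0) t3 s3"
    and inv: "table_inv n \<pi> (n * n) s3"
    using for_loop[of "n * n" "table_inv n \<pi>" 4 ?W ?M table_body 1 3 0 "(r2, mem0)"] exec_table_body[OF n]
    by blast
  obtain r3 mem3 where s3: "s3 = (r3, mem3)" by (cases s3)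
  have r3: "r3 0 = n" "r3 2 = n + 1" "\<forall>x<6. r3 x \<le> reg_bound n x"
    using inv unfolding s3 table_inv_def by auto
  have G3: "table_done n \<pi> mem3" using table_inv_done[OF n] inv unfolding s3 by blast
  define r4 where "r4 = r3(3 := cells n)"
  define r5 where "r5 = r4(1 := 0)"
  have x4: "exec' n (Assign 3 (Mul (Reg 2) (Reg 2))) (r3, mem3) 1 (r4, mem3)"
    unfolding r4_def by (rule exec_Assign) (use cb r3 in \<open>simp_all add: cells_def\<close>)
  have x5: "exec' n (Assign 1 (Const 0)) (r4, mem3) 1 (r5, mem3)"
    unfolding r5_def by (rule exec_Assign) (use cb in simp_all)
  have r5: "r5 0 = n" "r5 1 = 0" "r5 2 = n + 1" "r5 3 = cells n"
    using r3 by (simp_all add: r5_def r4_def)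
  have rb5: "\<forall>x<6. r5 x \<le> reg_bound n x" using r3(3) by (auto simp: r5_def r4_def)
  let ?h = "[Mul (Const 9) (Reg 3), Const 1, Mul (Const 9) (Reg 0), Reg 3]"
  let ?hv = "[9 * cells n, 1, 9 * n, cells n]"
  have "\<exists>mem'. exec' n (emit (Reg 3) 0 ?h) (r5, mem3) (length ?h + 1) (r5, mem') \<and>
    table_done n \<pi> mem' \<and> (\<forall>j<length ?h. mem' (cells n + 0 + j) = ?hv ! j) \<and>
    (\<forall>x. x < cells n + 0 \<or> cells n + 0 + length ?h \<le> x \<longrightarrow> mem' x = mem3 x)"
    by (rule exec_emit[where G = "table_done n \<pi>" and V = ?V])
      (use G3 cb r5 table_done_upd in auto)
  then obtain mem4 where x6: "exec' n (emit (Reg 3) 0 ?h) (r5, mem3) (length ?h + 1) (r5, mem4)"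
    and G4: "table_done n \<pi> mem4" and h4: "\<forall>j<length ?h. mem4 (cells n + 0 + j) = ?hv ! j"
    by blast
  let ?c = "[Mul (Const 40) (Reg 3)]"
  have "\<exists>mem'. exec' n (emit (Add (Reg 3) (Reg 3)) 4 ?c) (r5, mem4) (length ?c + 1) (r5, mem') \<and>
    table_done n \<pi> mem' \<and> (\<forall>j<length ?c. mem' (2 * cells n + 4 + j) = [40 * cells n] ! j) \<and>
    (\<forall>x. x < 2 * cells n + 4 \<or> 2 * cells n + 4 + length ?c \<le> x \<longrightarrow> mem' x = mem4 x)"
    by (rule exec_emit[where G = "table_done n \<pi>" and V = ?V])
      (use G4 cb r5 table_done_upd in auto)
  then obtain mem5 where x7: "exec' n (emit (Add (Reg 3) (Reg 3)) 4 ?c) (r5, mem4) (length ?c + 1) (r5, mem5)"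
    and G5: "table_done n \<pi> mem5" and c5: "\<forall>j<length ?c. mem5 (2 * cells n + 4 + j) = [40 * cells n] ! j"
    and k5: "\<forall>x. x < 2 * cells n + 4 \<or> 2 * cells n + 4 + length ?c \<le> x \<longrightarrow> mem5 x = mem4 x"
    by blast
  have "stored mem5 (cells n) ?hv"
    unfolding stored_def
  proof (intro allI impI)
    fix j assume j: "j < length ?hv"
    then have "mem5 (cells n + j) = mem4 (cells n + j)" using k5 by simp
    then show "mem5 (cells n + j) = ?hv ! j" using h4 j by simp
  qed
  moreover have "mem5 (2 * cells n + 4) = 40 * cells n" using c5 by simp
  ultimately have "cell_inv n \<pi> 0 (r5, mem5)"
    unfolding cell_inv_def prod.case using r5 rb5 G5 by simp
  moreover have "fst s 1 = i \<and> fst s 3 = cells n" if "cell_inv n \<pi> i s" for i s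
    using that by (auto simp: cell_inv_def)
  moreover have "cells n < ?W" using cb by linarith
  ultimately obtain t8 s8 where t8: "t8 \<le> (cells n - 0) * (126 + 1) + 1"
    and x8: "exec' n (While (Less (Reg 1) (Reg 3)) cell_body) (r5, mem5) t8 s8"
    and inv8: "cell_inv n \<pi> (cells n) s8"
    using for_loop[of "cells n" "cell_inv n \<pi>" 126 ?W ?M cell_body 1 3 0 "(r5, mem5)"]
      exec_cell_body[OF n inj] by blast
  obtain r8 mem8 where s8: "s8 = (r8, mem8)" by (cases s8)
  have r8: "r8 3 = cells n" and hdr: "stored mem8 (cells n) ?hv" "mem8 (2 * cells n + 4) = 40 * cells n"
    and fin: "\<And>j. j < cells n \<Longrightarrow> mem8 (cells n + 4 + j) = cell_codes n j"
    and trs: "\<And>j. j < cells n \<Longrightarrow> stored mem8 (2 * cells n + 5 + 120 * j) (row_codes n \<pi> j)"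
    using inv8 unfolding s8 cell_inv_def by auto
  define r9 where "r9 = r8(0 := cells n)"
  have x9: "exec' n (Assign 0 (Reg 3)) (r8, mem8) 1 (r9, mem8)"
    unfolding r9_def by (rule exec_Assign) (use cb r8 in simp_all)
  define t where "t = 1 + (1 + (t3 + (1 + (1 + ((length ?h + 1) + ((length ?c + 1) + (t8 + 1)))))))"
  have "exec' n perm_program (input_state n \<pi>) t (r9, mem8)"
    unfolding init perm_program_def t_def
    by (intro exec.Seq[OF x1] exec.Seq[OF x2] exec.Seq[OF x3[unfolded s3]] exec.Seq[OF x4] exec.Seq[OF x5]
        exec.Seq[OF x6] exec.Seq[OF x7] exec.Seq[OF x8[unfolded s8]] x9)
  \<comment> \<open>The loops cost at most \<open>5 * (n * n) + 1\<close> and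
    \<open>127 * cells n + 1\<close> steps, and the remaining commands 12 steps in total.\<close>
  moreover have "t \<le> ?M"
    unfolding t_def using t3 t8 cb by simp
  moreover have "outputs ?M (r9, mem8) (perm_nfa n \<pi>)"
  proof -
    have tr: "stored mem8 (2 * cells n + 5) (concat (map (row_codes n \<pi>) [0..<cells n]))"
      "length (concat (map (row_codes n \<pi>) [0..<cells n])) = 120 * cells n"
      using stored_concat[of "cells n" "row_codes n \<pi>" 120 mem8 "2 * cells n + 5"] trs length_row_codes
      by blast+
    have addr: "cells n + length ?hv = cells n + 4"
      "cells n + 4 + length (map (cell_codes n) [0..<cells n]) = 2 * cells n + 4"
      "2 * cells n + 4 + length [40 * cells n] = 2 * cells n + 5"
      by simp_all
    have "stored mem8 (cells n + 4) (map (cell_codes n) [0..<cells n])"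
      using fin by (simp add: stored_def)
    moreover have "stored mem8 (2 * cells n + 4) [40 * cells n]" using hdr(2) by (simp add: stored_def)
    ultimately have "stored mem8 (cells n) (fa_code (perm_nfa n \<pi>))"
      unfolding fa_code_perm_nfa stored_append addr using hdr(1) tr(1) by blast
    moreover have "length (fa_code (perm_nfa n \<pi>)) = 121 * cells n + 5"
      unfolding fa_code_perm_nfa length_append tr(2) by simp
    ultimately show ?thesis
      unfolding outputs_def stored_def using cb by (simp add: r9_def)
  qed
  ultimately show ?thesis by blast
qed

lemma cells_bigo: "(\<lambda>n. real (c * cells n)) \<in> O(\<lambda>n. real n ^ 2)"
proof (rule bigoI)
  show "\<forall>\<^sub>F n in at_top. norm (real (c * cells n)) \<le> (4 * real c) * norm (real n ^ 2)"
    using eventually_ge_at_top[of 1]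
  proof eventually_elim
    case (elim n)
    then have "(n + 1) * (n + 1) \<le> (2 * n) * (2 * n)" by (intro mult_mono) auto
    then have "c * cells n \<le> c * (4 * n\<^sup>2)" unfolding cells_def by (intro mult_left_mono) (auto simp: power2_eq_square)
    then have "real (c * cells n) \<le> real (c * (4 * n\<^sup>2))" by (rule of_nat_mono)
    then show ?case by simp
  qed
qed

lemma perm_program_builds:
  "builds_automaton perm_program (\<lambda>n \<pi> K. K = rev ` perm_lang n \<pi>) (\<lambda>n. real n ^ 2)"
  unfolding builds_automaton_def
proof (rule exI[of _ "\<lambda>n. 200 * cells n"], rule exI[of _ "\<lambda>n. 200 * cells n"],
    rule exI[of _ "\<lambda>n. 1000 * cells n"], rule exI[of _ 2], intro conjI allI impI)
  fix n \<pi> assume "1 \<le> n \<and> pin_permutation n \<pi>"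
  then have "1 \<le> n" and perm: "\<pi> permutes {1..n}" by (auto simp: pin_permutation_def)
  then obtain t s where "exec' n perm_program (input_state n \<pi>) t s" "t \<le> 200 * cells n"
    "outputs (200 * cells n) s (perm_nfa n \<pi>)"
    using exec_perm_program by blast
  then show "\<exists>t s A. exec' n perm_program (input_state n \<pi>) t s \<and> t \<le> 200 * cells n \<and>
      outputs (200 * cells n) s A \<and> fa_wf A \<and> fa_lang A = rev ` perm_lang n \<pi>"
    using perm_nfa_wf perm_nfa_lang[OF perm] by blast
qed (rule cells_bigo)+

lemma builds_automaton_mono:
  assumes "builds_automaton c P f" "f \<in> O(g)" "\<And>n \<pi> K. P n \<pi> K \<Longrightarrow> Q n \<pi> K"
  shows "builds_automaton c Q g"
proof -
  obtain T M W k where *: "(\<lambda>n. real (T n)) \<in> O(f)" "(\<lambda>n. real (M n)) \<in> O(f)"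
    "(\<lambda>n. real (W n)) \<in> O(\<lambda>n. real n ^ k)"
    "\<And>n \<pi>. 1 \<le> n \<and> pin_permutation n \<pi> \<Longrightarrow>
           (\<exists>t s A. exec (W n) (M n) c (input_state n \<pi>) t s \<and> t \<le> T n \<and>
              outputs (M n) s A \<and> fa_wf A \<and> P n \<pi> (fa_lang A))"
    using assms(1) unfolding builds_automaton_def by blast
  have "(\<lambda>n. real (T n)) \<in> O(g)" "(\<lambda>n. real (M n)) \<in> O(g)"
    using *(1,2) assms(2) landau_o.big_trans by blast+
  moreover have "\<exists>t s A. exec (W n) (M n) c (input_state n \<pi>) t s \<and> t \<le> T n \<and>
              outputs (M n) s A \<and> fa_wf A \<and> Q n \<pi> (fa_lang A)" if "1 \<le> n \<and> pin_permutation n \<pi>" for n \<pi>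
    using *(4)[OF that] assms(3) by blast
  ultimately show ?thesis unfolding builds_automaton_def using *(3) by blast
qed

theorem theorem4p1:
  shows "(\<exists>c. builds_automaton c
            (\<lambda>n \<pi> K. K = rev ` perm_lang n \<pi>)
            (\<lambda>n. real n ^ 4)) \<and>
         (\<exists>c. builds_automaton c
            (\<lambda>n \<pi> K. K \<inter> alternating_words = rev ` perm_lang n \<pi> \<inter> alternating_words)
            (\<lambda>n. real n ^ 2))"
proof (intro conjI exI)
  have "(\<lambda>n. real n ^ 2) \<in> O(\<lambda>n. real n ^ 4)"
  proof (rule bigoI[where c = 1])
    show "\<forall>\<^sub>F n in at_top. norm (real n ^ 2) \<le> 1 * norm (real n ^ 4)"
      using eventually_ge_at_top[of 1] by eventually_elim (simp add: power_increasing)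
  qed
  then show "builds_automaton perm_program (\<lambda>n \<pi> K. K = rev ` perm_lang n \<pi>) (\<lambda>n. real n ^ 4)"
    by (rule builds_automaton_mono[OF perm_program_builds])
  show "builds_automaton perm_program
      (\<lambda>n \<pi> K. K \<inter> alternating_words = rev ` perm_lang n \<pi> \<inter> alternating_words) (\<lambda>n. real n ^ 2)"
    by (rule builds_automaton_mono[OF perm_program_builds]) auto
qed

end
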